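(* Let $N\geq 2$ and $s\in(0,1)$. There is $\tau_0\in(0,1)$ such that for any $\tau\in[\tau_0,1)$, any second eigenfunction corresponding to $\lambda_{2,s}\big(B_1(0)\setminus \overline{B_\tau(0)}\big)$ is nonradial.
   Context: $B_r(a)$ is the open ball in $\mathbb{R}^N$ of radius $r$ centered at $a$. For $s\in(0,1)$, $b_{N,s}=\frac{s4^s\Gamma(\frac N2+s)}{\pi^{N/2}\Gamma(1-s)}$, and $\mathcal{E}_s(\phi,\psi)=\frac{b_{N,s}}{2}\int_{\mathbb{R}^{2N}}\frac{(\phi(x)-\phi(y))(\psi(x)-\psi(y))}{|x-y|^{N+2s}}\,dx\,dy$ is the bilinear form of the fractional Laplacian $(-\Delta)^s$. For a bounded open set $\Omega\subset\mathbb{R}^N$, $\mathcal{H}^s_0(\Omega)$ is the completion of $C_c^\infty(\Omega)$ with respect to the norm $\mathcal{E}_s(\psi,\psi)^{1/2}$ (functions extended by $0$ outside $\Omega$). A function $\phi\in\mathcal{H}^s_0(\Omega)$ is a weak solution of $(-\Delta)^s\phi=\mu\phi$ in $\Omega$, $\phi=0$ in $\mathbb{R}^N\setminus\Omega$, if $\mathcal{E}_s(\phi,\psi)=\mu\int_\Omega\phi\psi\,dx$ for all $\psi\in\mathcal{H}^s_0(\Omega)$. The eigenvalues (those $\mu$ with a nontrivial weak solution), counted with multiplicity, are $0<\lambda_{1,s}(\Omega)<\lambda_{2,s}(\Omega)\le\lambda_{3,s}(\Omega)\le\dots\nearrow+\infty$. A second eigenfunction of $\Omega$ is a nontrivial weak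 solution with $\mu=\lambda_{2,s}(\Omega)$. A function is radial if it depends only on $|x|$ (a.e.), and nonradial otherwise. *)

theory Defs
  imports "HOL-Analysis.Analysis"
begin

text \<open>
  The space $\mathbb{R}^N$ is a type of class \<^class>\<open>euclidean_space\<close> and $N$ is its
  dimension \<open>DIM('a)\<close>. Functions on $\Omega$ are functions on the whole space that vanish
  outside $\Omega$; elements of function spaces are Borel representatives of their classes
  modulo equality almost everywhere, so equality, triviality, independence and radiality
  are all understood almost everywhere.
\<close>

primrec Ck_function :: "nat \<Rightarrow> ('a::euclidean_space \<Rightarrow> real) \<Rightarrow> bool" where
  "Ck_function 0 f \<longleftrightarrow> continuous_on UNIV f"
| "Ck_function (Suc k) f \<longleftrightarrow>
     (\<forall>x. f differentiable (at x)) \<and>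
     (\<forall>v. Ck_function k (\<lambda>x. frechet_derivative f (at x) v))"

definition smooth_compact_support :: "'a::euclidean_space set \<Rightarrow> ('a \<Rightarrow> real) set" where
  "smooth_compact_support \<Omega> =
     {f. (\<forall>k. Ck_function k f) \<and> compact (closure {x. f x \<noteq> 0}) \<and> closure {x. f x \<noteq> 0} \<subseteq> \<Omega>}"

definition fractional_constant :: "nat \<Rightarrow> real \<Rightarrow> real" where
  "fractional_constant N s =
     s * 4 powr s * Gamma (real N / 2 + s) / (pi powr (real N / 2) * Gamma (1 - s))"

definition difference_kernel ::
  "real \<Rightarrow> ('a::euclidean_space \<Rightarrow> real) \<Rightarrow> ('a \<Rightarrow> real) \<Rightarrow> 'a \<times> 'a \<Rightarrow> real" where
  "difference_kernel s \<phi> \<psi> =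
     (\<lambda>(x, y). (\<phi> x - \<phi> y) * (\<psi> x - \<psi> y) / norm (x - y) powr (real DIM('a) + 2 * s))"

definition fractional_form ::
  "real \<Rightarrow> ('a::euclidean_space \<Rightarrow> real) \<Rightarrow> ('a \<Rightarrow> real) \<Rightarrow> real" where
  "fractional_form s \<phi> \<psi> =
     fractional_constant DIM('a) s / 2 * (LINT z|(lborel \<Otimes>\<^sub>M lborel). difference_kernel s \<phi> \<psi> z)"

definition finite_energy :: "real \<Rightarrow> ('a::euclidean_space \<Rightarrow> real) \<Rightarrow> bool" where
  "finite_energy s \<phi> \<longleftrightarrow> integrable (lborel \<Otimes>\<^sub>M lborel) (difference_kernel s \<phi> \<phi>)"

text \<open>
  The completion of the smooth compactly supported functions is realised as their closure in the
  space of finite-energy functions vanishing almost everywhere outside $\Omega$. For bounded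
  $\Omega$ the energy norm dominates the $L^2$ norm on that space (fractional Poincare
  inequality), so the space is complete and the closure is the completion. The condition
  \<open>finite_energy s u\<close> is needed because the Bochner integral of a non-integrable
  function is zero.
\<close>

definition fractional_sobolev :: "real \<Rightarrow> 'a::euclidean_space set \<Rightarrow> ('a \<Rightarrow> real) set" where
  "fractional_sobolev s \<Omega> =
     {u \<in> borel_measurable borel.
        (AE x in lborel. x \<notin> \<Omega> \<longrightarrow> u x = 0) \<and> finite_energy s u \<and>
        (\<exists>f. (\<forall>n. f n \<in> smooth_compact_support \<Omega>) \<and>
             (\<lambda>n. sqrt (fractional_form s (\<lambda>x. f n x - u x) (\<lambda>x. f n x - u x))) \<longlonglongrightarrow> 0)}"

definition weak_solution ::
  "real \<Rightarrow> 'a::euclidean_space set \<Rightarrow> real \<Rightarrow> ('a \<Rightarrow> real) \<Rightarrow> bool" where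
  "weak_solution s \<Omega> \<mu> \<phi> \<longleftrightarrow>
     \<phi> \<in> fractional_sobolev s \<Omega> \<and>
     (\<forall>\<psi> \<in> fractional_sobolev s \<Omega>.
        fractional_form s \<phi> \<psi> = \<mu> * (LINT x:\<Omega>|lborel. \<phi> x * \<psi> x))"

definition AE_nontrivial :: "('a::euclidean_space \<Rightarrow> real) \<Rightarrow> bool" where
  "AE_nontrivial \<phi> \<longleftrightarrow> \<not> (AE x in lborel. \<phi> x = 0)"

definition AE_independent :: "nat \<Rightarrow> (nat \<Rightarrow> 'a::euclidean_space \<Rightarrow> real) \<Rightarrow> bool" where
  "AE_independent m f \<longleftrightarrow>
     (\<forall>c :: nat \<Rightarrow> real. (AE x in lborel. (\<Sum>i<m. c i * f i x) = 0) \<longrightarrow> (\<forall>i<m. c i = 0))"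

text \<open>
  The dimension of the space of weak solutions modulo equality almost everywhere. It is zero
  exactly if \<open>\<mu>\<close> is not an eigenvalue.
\<close>

definition eigenvalue_multiplicity :: "real \<Rightarrow> 'a::euclidean_space set \<Rightarrow> real \<Rightarrow> enat" where
  "eigenvalue_multiplicity s \<Omega> \<mu> =
     Sup {enat m | m. \<exists>f. AE_independent m f \<and> (\<forall>i<m. weak_solution s \<Omega> \<mu> (f i))}"

text \<open>
  A nondecreasing sequence in which every real number occurs as often as its multiplicity as an
  eigenvalue. Such a sequence is unique, since it is monotone with finite fibres of
  prescribed size.
\<close>

definition eigenvalue_enumeration ::
  "real \<Rightarrow> 'a::euclidean_space set \<Rightarrow> (nat \<Rightarrow> real) \<Rightarrow> bool" where
  "eigenvalue_enumeration s \<Omega> L \<longleftrightarrow>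
     mono L \<and>
     (\<forall>\<mu>. finite {k. L k = \<mu>} \<and> enat (card {k. L k = \<mu>}) = eigenvalue_multiplicity s \<Omega> \<mu>)"

text \<open>The eigenvalues are numbered from $1$, the enumeration from $0$.\<close>

definition dirichlet_eigenvalue :: "nat \<Rightarrow> real \<Rightarrow> 'a::euclidean_space set \<Rightarrow> real" where
  "dirichlet_eigenvalue k s \<Omega> = (THE L. eigenvalue_enumeration s \<Omega> L) (k - 1)"

definition second_eigenfunction ::
  "real \<Rightarrow> 'a::euclidean_space set \<Rightarrow> ('a \<Rightarrow> real) \<Rightarrow> bool" where
  "second_eigenfunction s \<Omega> \<phi> \<longleftrightarrow>
     AE_nontrivial \<phi> \<and> weak_solution s \<Omega> (dirichlet_eigenvalue 2 s \<Omega>) \<phi>"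

definition radial :: "('a::euclidean_space \<Rightarrow> real) \<Rightarrow> bool" where
  "radial \<phi> \<longleftrightarrow> (\<exists>g :: real \<Rightarrow> real. AE x in lborel. \<phi> x = g (norm x))"

end

theory Submission
  imports Defs "HOL-Library.Function_Algebras" "HOL-Real_Asymp.Real_Asymp"
begin

text \<open>
  Let \<open>\<phi>\<close> be a radial eigenfunction for the second eigenvalue \<open>\<lambda>\<close> of an annulus of width \<open>\<delta>\<close>, and
  let \<open>u\<close> and \<open>v\<close> be its positive and negative parts. Disjointly supported nonnegative functions
  have negative mutual energy, so ground states have one sign. Hence the ground state is simple and
  even under reflections, \<open>\<phi>\<close> changes sign, and the odd functions \<open>x\<^sub>i u\<close> have Rayleigh quotient at
  least \<open>\<lambda>\<close>. In the sum of these inequalities over \<open>i\<close> the eigenvalue cancels, which leaves, with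
  \<open>K(x, y) = |x - y|\<close> to the power \<open>- N - 2 s\<close>,
  \<open>\<integral>\<integral> (v(x) u(y) |y|\<^sup>2 + v(y) u(x) |x|\<^sup>2) K \<le> \<integral>\<integral> u(x) u(y) |x - y|\<^sup>2 K\<close>.
  As \<open>u\<close> is radial, every ball of radius \<open>2 \<delta>\<close> centred in the annulus carries a fraction of order
  \<open>\<delta>\<close> to the power \<open>N - 1\<close> of its mass, so the left side is at least of order
  \<open>\<delta>\<close> to the power \<open>- 1 - 2 s\<close> times \<open>\<parallel>u\<parallel>\<^sub>1 \<parallel>v\<parallel>\<^sub>1\<close>. The right side is at most a constant times the
  squared \<open>L\<^sup>2\<close> norm of \<open>u\<close>; by \<open>\<lambda> \<le> C \<delta>\<close> to the power \<open>- 2 s\<close> and a Nash inequality for radial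
  functions this is at most of order \<open>\<parallel>u\<parallel>\<^sub>1\<^sup>2 / \<delta>\<close>. Replacing \<open>\<phi>\<close> by \<open>- \<phi>\<close> one may assume
  \<open>\<parallel>u\<parallel>\<^sub>1 \<le> \<parallel>v\<parallel>\<^sub>1\<close>, and then \<open>\<delta>\<close> is bounded from below.
\<close>

section \<open>Eigenvalues of a pair of quadratic forms\<close>

text \<open>The second eigenvalue is defined by a definite description of an enumeration with
  multiplicities, so it says nothing until spectral theory is in place: completeness of the form
  domain, compactness of the embedding into L^2 and orthogonal families of every length yield
  successive minimizers that realise the enumeration. Besides the weak equation, the argument takes
  from this the lower bound for the energy of functions orthogonal to the ground state.

  Coordinates are the multipliers because \<open>x_i u\<close> is odd under a reflection of the
  annulus, while the equation for \<open>\<phi>\<close> tested with \<open>x_i^2 u\<close> returns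
  exactly the eigenvalue times the squared norm of \<open>x_i u\<close>; hence the cancellation. In
  what remains, \<open>u\<close> meets itself through the kernel weakened by
  \<open>|x - y|^2\<close>, locally integrable since s < 1, but meets \<open>v\<close> through the
  full kernel. A shell of width \<open>\<delta>\<close> therefore favours the second interaction by
  a factor of order \<open>\<delta>\<close> to the power -2s.

  No regularity of eigenfunctions enters. Radiality is used only as invariance almost everywhere
  under hyperplane reflections, which already act transitively on spheres.\<close>

text \<open>The form need not be definite: elements of \<open>V\<close> may be representatives of classes.\<close>

locale semi_inner_form =
  fixes V :: "'v::real_vector set" and B :: "'v \<Rightarrow> 'v \<Rightarrow> real"
  assumes subspace_V: "subspace V"
    and sym: "u \<in> V \<Longrightarrow> v \<in> V \<Longrightarrow> B u v = B v u"
    and add: "u \<in> V \<Longrightarrow> v \<in> V \<Longrightarrow> w \<in> V \<Longrightarrow> B (u + v) w = B u w + B v w"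
    and scale: "u \<in> V \<Longrightarrow> w \<in> V \<Longrightarrow> B (a *\<^sub>R u) w = a * B u w"
    and nonneg: "u \<in> V \<Longrightarrow> 0 \<le> B u u"
begin

lemma in_V [simp, intro]:
  "0 \<in> V" "u \<in> V \<Longrightarrow> v \<in> V \<Longrightarrow> u + v \<in> V" "u \<in> V \<Longrightarrow> v \<in> V \<Longrightarrow> u - v \<in> V"
  "u \<in> V \<Longrightarrow> a *\<^sub>R u \<in> V" "(\<And>i. i \<in> I \<Longrightarrow> f i \<in> V) \<Longrightarrow> (\<Sum>i\<in>I. f i) \<in> V"
  using subspace_V by (auto intro: subspace_0 subspace_add subspace_diff subspace_scale subspace_sum)

lemma diff: "u \<in> V \<Longrightarrow> v \<in> V \<Longrightarrow> w \<in> V \<Longrightarrow> B (u - v) w = B u w - B v w"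
  using add[of "u - v" v w] by simp

lemma add_right: "u \<in> V \<Longrightarrow> v \<in> V \<Longrightarrow> w \<in> V \<Longrightarrow> B w (u + v) = B w u + B w v"
  by (metis add sym in_V(2))

lemma scale_right: "u \<in> V \<Longrightarrow> w \<in> V \<Longrightarrow> B w (a *\<^sub>R u) = a * B w u"
  by (metis scale sym in_V(4))

lemma diff_right: "u \<in> V \<Longrightarrow> v \<in> V \<Longrightarrow> w \<in> V \<Longrightarrow> B w (u - v) = B w u - B w v"
  by (metis diff sym in_V(3))

lemma zero [simp]: "w \<in> V \<Longrightarrow> B 0 w = 0"
  using scale[of 0 w 0] by simp

lemma sum_left: "(\<And>i. i \<in> I \<Longrightarrow> f i \<in> V) \<Longrightarrow> w \<in> V \<Longrightarrow> B (\<Sum>i\<in>I. f i) w = (\<Sum>i\<in>I. B (f i) w)"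
proof (induction I rule: infinite_finite_induct)
  case (insert i I)
  then show ?case by (subst sum.insert) (auto simp: add)
qed auto

lemma lincomb: "(\<And>i. i \<in> I \<Longrightarrow> f i \<in> V) \<Longrightarrow> w \<in> V
    \<Longrightarrow> B (\<Sum>i\<in>I. c i *\<^sub>R f i) w = (\<Sum>i\<in>I. c i * B (f i) w)"
  by (subst sum_left) (auto simp: scale)

lemma square_add: "u \<in> V \<Longrightarrow> v \<in> V \<Longrightarrow> B (u + v) (u + v) = B u u + 2 * B u v + B v v"
  by (simp add: add add_right sym[of v u])

lemma square_diff: "u \<in> V \<Longrightarrow> v \<in> V \<Longrightarrow> B (u - v) (u - v) = B u u - 2 * B u v + B v v"
  by (simp add: diff diff_right sym[of v u])

lemma parallelogram:
  "u \<in> V \<Longrightarrow> v \<in> V \<Longrightarrow> B (u - v) (u - v) + B (u + v) (u + v) = 2 * B u u + 2 * B v v"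
  by (simp add: square_add square_diff)

lemma cauchy_schwarz:
  assumes "u \<in> V" "v \<in> V"
  shows "(B u v)\<^sup>2 \<le> B u u * B v v"
proof -
  have q: "0 \<le> B u u - 2 * t * B u v + t\<^sup>2 * B v v" for t
    using nonneg[of "u - t *\<^sub>R v"] assms
    by (simp add: square_diff scale scale_right power2_eq_square algebra_simps)
  show ?thesis
  proof (cases "B v v = 0")
    case True
    have "B u v = 0"
    proof (rule ccontr)
      assume "B u v \<noteq> 0"
      with q[of "(B u u + 1) / (2 * B u v)"] True show False by simp
    qed
    with True show ?thesis by simp
  next
    case False
    with nonneg[of v] assms have "B v v > 0" by auto
    with q[of "B u v / B v v"] show ?thesis by (simp add: field_simps power2_eq_square)
  qed
qed

lemma tendsto_left:
  assumes "\<And>n. f n \<in> V" "l \<in> V" "w \<in> V" "(\<lambda>n. B (f n - l) (f n - l)) \<longlonglongrightarrow> 0"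
  shows "(\<lambda>n. B (f n) w) \<longlonglongrightarrow> B l w"
proof -
  have "(\<lambda>n. (B (f n - l) w)\<^sup>2) \<longlonglongrightarrow> 0"
  proof (rule tendsto_sandwich[OF _ _ tendsto_const])
    show "\<forall>\<^sub>F n in sequentially. (B (f n - l) w)\<^sup>2 \<le> B (f n - l) (f n - l) * B w w"
      using assms(1-3) by (intro always_eventually allI cauchy_schwarz) auto
    show "(\<lambda>n. B (f n - l) (f n - l) * B w w) \<longlonglongrightarrow> 0"
      using assms(4) by (rule tendsto_mult_left_zero)
  qed simp
  then have "(\<lambda>n. B (f n - l) w) \<longlonglongrightarrow> 0"
    by (simp add: tendsto_null_power)
  then have "(\<lambda>n. B (f n) w - B l w) \<longlonglongrightarrow> 0"
    using assms by (simp add: diff)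
  then show ?thesis by (simp add: LIM_zero_iff)
qed

lemma tendsto_square:
  assumes "\<And>n. f n \<in> V" "l \<in> V" "(\<lambda>n. B (f n - l) (f n - l)) \<longlonglongrightarrow> 0"
  shows "(\<lambda>n. B (f n) (f n)) \<longlonglongrightarrow> B l l"
proof -
  have eq: "B (f n) (f n) = B (f n - l) (f n - l) + 2 * B (f n) l - B l l" for n
    using assms by (simp add: square_diff)
  have "(\<lambda>n. B (f n - l) (f n - l) + 2 * B (f n) l - B l l) \<longlonglongrightarrow> 0 + 2 * B l l - B l l"
    using assms by (intro tendsto_intros tendsto_left) auto
  with eq show ?thesis by simp
qed

end

text \<open>Near \<open>t = 0\<close> the linear term dominates, so nonnegativity for both signs of
  \<open>t\<close> kills it. This is the first variation that turns minimality into the weak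
  equation.\<close>

lemma nonneg_quadratic_linear_coeff:
  fixes a b :: real
  assumes "\<And>t. 0 \<le> 2 * t * a + t\<^sup>2 * b"
  shows "a = 0"
proof (rule ccontr)
  assume a: "a \<noteq> 0"
  define K where "K = \<bar>b\<bar> + 1"
  have "K > 0" "b < K" by (auto simp: K_def)
  have "0 \<le> 2 * (- a / K) * a + (- a / K)\<^sup>2 * b" by (rule assms)
  also have "\<dots> \<le> 2 * (- a / K) * a + (- a / K)\<^sup>2 * K"
    using \<open>b < K\<close> by (intro add_left_mono mult_left_mono) auto
  also have "\<dots> = - (a\<^sup>2 / K)" using \<open>K > 0\<close> by (simp add: power2_eq_square field_simps)
  finally have "a\<^sup>2 / K \<le> 0" by simp
  moreover have "a\<^sup>2 / K > 0" using a \<open>K > 0\<close> by simp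
  ultimately show False by simp
qed

text \<open>Gaussian elimination, one equation per induction step. It serves twice: to find a vector
  orthogonal to finitely many given ones, and to bound the dimension of an eigenspace.\<close>

lemma underdetermined_system:
  fixes a :: "'i \<Rightarrow> 'k \<Rightarrow> real"
  assumes "finite K" "finite I" "card K < card I"
  shows "\<exists>c. (\<exists>i\<in>I. c i \<noteq> 0) \<and> (\<forall>k\<in>K. (\<Sum>i\<in>I. c i * a i k) = 0)"
  using assms
proof (induction K arbitrary: I a rule: finite_induct)
  case empty
  then obtain i where "i \<in> I" by fastforce
  then show ?case by (intro exI[of _ "\<lambda>_. 1"]) auto
next
  case (insert k K)
  show ?case
  proof (cases "\<forall>i\<in>I. a i k = 0")
    case True
    with insert.IH[of I a] insert.prems insert.hyps show ?thesis by auto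
  next
    case False
    then obtain p where p: "p \<in> I" "a p k \<noteq> 0" by auto
    define J where "J = I - {p}"
    have J: "finite J" "p \<notin> J" "I = insert p J" using insert.prems p by (auto simp: J_def)
    have "card K < card J" using insert.prems insert.hyps J by auto
    \<comment> \<open>Row operation: the pivot \<open>p\<close> is eliminated from all remaining
      equations, so that one unknown and one equation disappear together.\<close>
    from insert.IH[OF J(1) this, of "\<lambda>i j. a i j - a i k / a p k * a p j"]
    obtain c where c: "\<exists>i\<in>J. c i \<noteq> 0"
        "\<And>j. j \<in> K \<Longrightarrow> (\<Sum>i\<in>J. c i * (a i j - a i k / a p k * a p j)) = 0" by blast
    define d where "d = c(p := - (\<Sum>i\<in>J. c i * a i k) / a p k)"
    have d: "(\<Sum>i\<in>I. d i * a i j) = d p * a p j + (\<Sum>i\<in>J. c i * a i j)" for j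
    proof -
      have "(\<Sum>i\<in>J. d i * a i j) = (\<Sum>i\<in>J. c i * a i j)"
        using J by (intro sum.cong) (auto simp: d_def)
      with J show ?thesis by simp
    qed
    have "(\<Sum>i\<in>I. d i * a i j) = 0" if "j \<in> insert k K" for j
    proof (cases "j = k")
      case True
      with d[of k] p show ?thesis by (simp add: d_def)
    next
      case False
      with that have "j \<in> K" by auto
      have "(\<Sum>i\<in>J. c i * a i j) = (\<Sum>i\<in>J. c i * a i k) / a p k * a p j"
        using c(2)[OF \<open>j \<in> K\<close>]
        by (simp add: algebra_simps sum_subtractf sum_distrib_left sum_divide_distrib sum_distrib_right)
      with d[of j] show ?thesis by (simp add: d_def)
    qed
    moreover have "\<exists>i\<in>I. d i \<noteq> 0" using c(1) J by (auto simp: d_def)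
    ultimately show ?thesis by blast
  qed
qed

text \<open>Abstracts the energy \<open>E\<close> and the L^2 product \<open>B\<close>. Compactness
  asks only for a \<open>B\<close>-Cauchy subsequence, since limits are produced by completeness of
  \<open>E\<close>. The last assumption guarantees that no finite set of orthogonality constraints
  reduces \<open>V\<close> to \<open>B\<close>-null vectors.\<close>

locale spectral_pair = E: semi_inner_form V E + B: semi_inner_form V B
  for V :: "'v::real_vector set" and E B :: "'v \<Rightarrow> 'v \<Rightarrow> real" +
  fixes C :: real
  assumes poincare: "u \<in> V \<Longrightarrow> B u u \<le> C * E u u"
    and complete: "(\<And>n. f n \<in> V) \<Longrightarrow>
      (\<And>e. 0 < e \<Longrightarrow> \<exists>M. \<forall>m\<ge>M. \<forall>n\<ge>M. E (f m - f n) (f m - f n) < e) \<Longrightarrow>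
      \<exists>l\<in>V. (\<lambda>n. E (f n - l) (f n - l)) \<longlonglongrightarrow> 0"
    and precompact: "(\<And>n. f n \<in> V) \<Longrightarrow> (\<And>n. E (f n) (f n) \<le> D) \<Longrightarrow>
      \<exists>r::nat\<Rightarrow>nat. strict_mono r \<and>
        (\<forall>e>0. \<exists>M. \<forall>m\<ge>M. \<forall>n\<ge>M. B (f (r m) - f (r n)) (f (r m) - f (r n)) < e)"
    and infinite_dimensional: "\<exists>g. (\<forall>i<n::nat. g i \<in> V \<and> 0 < B (g i) (g i)) \<and>
      (\<forall>i<n. \<forall>j<n. i \<noteq> j \<longrightarrow> B (g i) (g j) = 0)"
begin

lemma tendsto_B_zero:
  assumes "\<And>n. f n \<in> V" "l \<in> V" "(\<lambda>n. E (f n - l) (f n - l)) \<longlonglongrightarrow> 0"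
  shows "(\<lambda>n. B (f n - l) (f n - l)) \<longlonglongrightarrow> 0"
proof (rule tendsto_sandwich[OF _ _ tendsto_const])
  show "\<forall>\<^sub>F n in sequentially. 0 \<le> B (f n - l) (f n - l)"
    using assms B.nonneg by auto
  show "\<forall>\<^sub>F n in sequentially. B (f n - l) (f n - l) \<le> C * E (f n - l) (f n - l)"
    using assms poincare by auto
  show "(\<lambda>n. C * E (f n - l) (f n - l)) \<longlonglongrightarrow> 0"
    using assms(3) by (rule tendsto_mult_right_zero)
qed

text \<open>By the parallelogram law a minimizing sequence that is Cauchy for \<open>B\<close> is Cauchy for \<open>E\<close>.\<close>

lemma minimizer:
  assumes X: "X \<subseteq> V" "subspace X"
    and closed: "\<And>f l. (\<And>n. f n \<in> X) \<Longrightarrow> l \<in> V \<Longrightarrow> (\<lambda>n. E (f n - l) (f n - l)) \<longlonglongrightarrow> 0 \<Longrightarrow> l \<in> X"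
    and ex: "\<exists>u\<in>X. 0 < B u u"
  shows "\<exists>u\<in>X. B u u = 1 \<and> (\<forall>v\<in>X. E u u * B v v \<le> E v v) \<and> (\<forall>v\<in>X. E u v = E u u * B u v)"
proof -
  define S where "S = (\<lambda>v. E v v) ` {v\<in>X. B v v = 1}"
  define l where "l = Inf S"
  have normalize: "(1 / sqrt (B v v)) *\<^sub>R v \<in> {v\<in>X. B v v = 1}" if "v \<in> X" "0 < B v v" for v
    using that X by (auto simp: subspace_scale B.scale B.scale_right subset_iff)
  from ex normalize have "S \<noteq> {}" unfolding S_def by blast
  have bdd: "bdd_below S" unfolding S_def using X E.nonneg by (intro bdd_belowI[of _ 0]) auto
  have low: "l * B v v \<le> E v v" if "v \<in> X" for v
  proof (cases "B v v = 0")
    case True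
    with E.nonneg that X show ?thesis by auto
  next
    case False
    with B.nonneg[of v] that X have pos: "0 < B v v" by auto
    have "l \<le> E ((1 / sqrt (B v v)) *\<^sub>R v) ((1 / sqrt (B v v)) *\<^sub>R v)"
      unfolding l_def using normalize[OF that pos] bdd by (intro cInf_lower) (auto simp: S_def)
    also have "\<dots> = E v v / B v v" using that X pos
      by (simp add: E.scale E.scale_right subset_iff)
    finally show ?thesis using pos by (simp add: field_simps)
  qed
  have "\<exists>v. v \<in> X \<and> B v v = 1 \<and> E v v < l + 1 / real (Suc n)" for n
  proof -
    have "l < l + 1 / real (Suc n)" by simp
    then obtain y where "y \<in> S" "y < l + 1 / real (Suc n)"
      unfolding l_def using \<open>S \<noteq> {}\<close> bdd by (metis cInf_less_iff)
    then show ?thesis by (auto simp: S_def)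
  qed
  then obtain f where f: "\<And>n. f n \<in> X" "\<And>n. B (f n) (f n) = 1" "\<And>n. E (f n) (f n) < l + 1 / real (Suc n)"
    by metis
  have fV: "f n \<in> V" for n using f X by auto
  have "E (f n) (f n) \<le> l + 1" for n
    using f(3)[of n] by (smt (verit, ccfv_SIG) divide_le_eq_1 of_nat_Suc of_nat_0_le_iff)
  from precompact[of f, OF fV this] obtain r where r: "strict_mono (r :: nat \<Rightarrow> nat)"
    "\<And>e. 0 < e \<Longrightarrow> \<exists>M. \<forall>m\<ge>M. \<forall>n\<ge>M. B (f (r m) - f (r n)) (f (r m) - f (r n)) < e" by blast
  define g where "g n = f (r n)" for n
  have gX: "g n \<in> X" "g n \<in> V" "B (g n) (g n) = 1" for n using f fV by (auto simp: g_def)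
  have gE: "E (g n) (g n) \<le> l + 1 / real (Suc n)" for n
  proof -
    have "n \<le> r n" by (rule seq_suble[OF r(1)])
    then have "1 / real (Suc (r n)) \<le> 1 / real (Suc n)" by (simp add: frac_le)
    with f(3)[of "r n"] show ?thesis by (simp add: g_def)
  qed
  have key: "E (g m - g n) (g m - g n) \<le> 2 / real (Suc m) + 2 / real (Suc n)
      + l * B (g m - g n) (g m - g n)" for m n
  proof -
    have "g m + g n \<in> X" using gX X by (auto intro: subspace_add)
    from low[OF this] have "l * B (g m + g n) (g m + g n) \<le> E (g m + g n) (g m + g n)" .
    moreover have "B (g m + g n) (g m + g n) = 4 - B (g m - g n) (g m - g n)"
      using B.parallelogram[of "g m" "g n"] gX by simp
    moreover have "E (g m + g n) (g m + g n) = 2 * E (g m) (g m) + 2 * E (g n) (g n) - E (g m - g n) (g m - g n)"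
      using E.parallelogram[of "g m" "g n"] gX by simp
    ultimately show ?thesis using gE[of m] gE[of n] by (simp add: algebra_simps)
  qed
  have "l \<ge> 0" unfolding l_def using \<open>S \<noteq> {}\<close> X E.nonneg
    by (intro cInf_greatest) (auto simp: S_def)
  have "\<exists>M. \<forall>m\<ge>M. \<forall>n\<ge>M. E (g m - g n) (g m - g n) < e" if "0 < e" for e
  proof -
    \<comment> \<open>The three summands of \<open>key\<close> receive \<open>e / 3\<close> each;
      \<open>l + 1\<close> in the denominator admits the value \<open>l = 0\<close>.\<close>
    have "e / (3 * (l + 1)) > 0" using that \<open>l \<ge> 0\<close> by simp
    from r(2)[OF this] obtain M where M: "\<And>m n. m \<ge> M \<Longrightarrow> n \<ge> M \<Longrightarrow> B (g m - g n) (g m - g n) < e / (3 * (l + 1))"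
      unfolding g_def by blast
    obtain K :: nat where K: "6 / e < real K" using reals_Archimedean2 by blast
    have K': "2 / real (Suc m) \<le> e / 3" if "m \<ge> K" for m
    proof -
      have "6 / e < real (Suc m)" using K that by simp
      then show ?thesis using \<open>0 < e\<close> by (simp add: field_simps)
    qed
    have "E (g m - g n) (g m - g n) < e" if "m \<ge> max M K" "n \<ge> max M K" for m n
    proof -
      have "B (g m - g n) (g m - g n) < e / (3 * (l + 1))" using M that by auto
      then have "l * B (g m - g n) (g m - g n) \<le> l * (e / (3 * (l + 1)))"
        using \<open>l \<ge> 0\<close> by (intro mult_left_mono) auto
      also have "\<dots> < e / 3" using \<open>l \<ge> 0\<close> \<open>0 < e\<close> by (simp add: field_simps)
      finally show ?thesis using key[of m n] K'[of m] K'[of n] that by simp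
    qed
    then show ?thesis by blast
  qed
  from complete[of g, OF gX(2) this] obtain u where u: "u \<in> V" "(\<lambda>n. E (g n - u) (g n - u)) \<longlonglongrightarrow> 0" by auto
  have uX: "u \<in> X" by (rule closed[OF gX(1) u])
  have "(\<lambda>n. B (g n) (g n)) \<longlonglongrightarrow> B u u"
    using gX u by (intro B.tendsto_square tendsto_B_zero) auto
  then have B1: "B u u = 1" using gX by (simp add: LIMSEQ_const_iff)
  have lim: "(\<lambda>n. E (g n) (g n)) \<longlonglongrightarrow> E u u"
    using gX u by (intro E.tendsto_square) auto
  have "(\<lambda>n. l + 1 / real (Suc n)) \<longlonglongrightarrow> l + 0"
    by (intro tendsto_intros LIMSEQ_Suc[OF lim_1_over_n])
  with lim gE have "E u u \<le> l + 0" by (intro LIMSEQ_le) auto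
  with low[OF uX] B1 have El: "E u u = l" by simp
  have "E u v = E u u * B u v" if "v \<in> X" for v
  proof -
    have vV: "v \<in> V" using that X by auto
    \<comment> \<open>Minimality along the line \<open>u + t v\<close>; the constant term drops out
      because \<open>E u u = l\<close> and \<open>B u u = 1\<close>.\<close>
    have "0 \<le> 2 * t * (E u v - l * B u v) + t\<^sup>2 * (E v v - l * B v v)" for t
    proof -
      have "u + t *\<^sub>R v \<in> X" using uX that X by (auto intro: subspace_add subspace_scale)
      from low[OF this] show ?thesis using u vV B1 El
        by (simp add: E.square_add B.square_add E.scale E.scale_right B.scale B.scale_right
            power2_eq_square algebra_simps)
    qed
    from nonneg_quadratic_linear_coeff[OF this] El show ?thesis by simp
  qed
  with uX B1 low El show ?thesis by blast
qed

definition eigenpair :: "real \<Rightarrow> 'v \<Rightarrow> bool" where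
  "eigenpair \<mu> u \<longleftrightarrow> u \<in> V \<and> (\<forall>v\<in>V. E u v = \<mu> * B u v)"

lemma eigenpair_orthogonal:
  assumes "eigenpair \<mu> u" "eigenpair \<nu> v" "\<mu> \<noteq> \<nu>"
  shows "B u v = 0"
proof -
  have "E u v = \<mu> * B u v" "E v u = \<nu> * B v u" "u \<in> V" "v \<in> V"
    using assms by (auto simp: eigenpair_def)
  with E.sym[of u v] B.sym[of u v] assms(3) show ?thesis by simp
qed

lemma eigenpair_lincomb:
  assumes "\<And>i. i \<in> I \<Longrightarrow> eigenpair \<mu> (f i)"
  shows "eigenpair \<mu> (\<Sum>i\<in>I. c i *\<^sub>R f i)"
  using assms by (auto simp: eigenpair_def E.lincomb B.lincomb sum_distrib_left intro!: sum.cong)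

lemma eigenpair_diff: "eigenpair \<mu> u \<Longrightarrow> eigenpair \<mu> v \<Longrightarrow> eigenpair \<mu> (u - v)"
  by (auto simp: eigenpair_def E.diff B.diff algebra_simps)

text \<open>Successive minimizers of the Rayleigh quotient: step \<open>n\<close> minimizes over the
  \<open>B\<close>-complement of its predecessors, step 0 over all of \<open>V\<close>. Completeness
  of the system is not a clause; \<open>eigenpair_trivial\<close> derives the instance of it that is
  used.\<close>

definition eigenbasis :: "(nat \<Rightarrow> 'v) \<Rightarrow> bool" where
  "eigenbasis e \<longleftrightarrow> (\<forall>n. eigenpair (E (e n) (e n)) (e n) \<and> B (e n) (e n) = 1 \<and>
     (\<forall>i<n. B (e n) (e i) = 0) \<and>
     (\<forall>v\<in>V. (\<forall>i<n. B v (e i) = 0) \<longrightarrow> E (e n) (e n) * B v v \<le> E v v))"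

text \<open>The minimizer over the complement of the predecessors satisfies the weak equation only
  against that complement. It extends to all test vectors because the predecessors are themselves
  eigenvectors, so neither form couples them to the new one.\<close>

lemma eigenbasis_exists: "\<exists>e. eigenbasis e"
proof -
  define P where "P f n r \<longleftrightarrow> eigenpair (E r r) r \<and> B r r = 1 \<and> (\<forall>i<n. B r (f i) = 0) \<and>
     (\<forall>v\<in>V. (\<forall>i<n. B v (f i) = 0) \<longrightarrow> E r r * B v v \<le> E v v)" for f :: "nat \<Rightarrow> 'v" and n r
  have "\<exists>f. \<forall>x. P f x (f x)"
  proof (rule dependent_wellorder_choice)
    fix n and f :: "nat \<Rightarrow> 'v"
    assume P: "\<And>y. y < n \<Longrightarrow> P f y (f y)"
    have fV: "f i \<in> V" if "i < n" for i using P[OF that] by (simp add: P_def eigenpair_def)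
    have fe: "eigenpair (E (f i) (f i)) (f i)" "B (f i) (f i) = 1" if "i < n" for i
      using P[OF that] by (simp_all add: P_def)
    have orth: "B (f i) (f j) = 0" if "i < n" "j < n" "i \<noteq> j" for i j
    proof (cases "i < j")
      case True
      then show ?thesis using P[OF that(2)] B.sym[OF fV fV, of i j] that by (simp add: P_def)
    next
      case False
      then show ?thesis using P[OF that(1)] that by (simp add: P_def)
    qed
    define X where "X = {v\<in>V. \<forall>i<n. B v (f i) = 0}"
    have X: "X \<subseteq> V" "subspace X"
      using fV by (auto simp: X_def subspace_def B.add B.scale)
    have cl: "l \<in> X" if "\<And>n. g n \<in> X" "l \<in> V" "(\<lambda>n. E (g n - l) (g n - l)) \<longlonglongrightarrow> 0" for g l
    proof -
      have gV: "g n \<in> V" for n using that X by auto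
      have "B l (f i) = 0" if "i < n" for i
      proof -
        have "(\<lambda>k. B (g k) (f i)) \<longlonglongrightarrow> B l (f i)"
          using gV fV[OF \<open>i < n\<close>] \<open>l \<in> V\<close>
            tendsto_B_zero[OF gV \<open>l \<in> V\<close> \<open>(\<lambda>n. E (g n - l) (g n - l)) \<longlonglongrightarrow> 0\<close>]
          by (intro B.tendsto_left) auto
        moreover have "B (g k) (f i) = 0" for k using \<open>\<And>n. g n \<in> X\<close>[of k] \<open>i < n\<close> by (simp add: X_def)
        ultimately show ?thesis by (simp add: LIMSEQ_const_iff)
      qed
      with that show ?thesis by (simp add: X_def)
    qed
    have ex: "\<exists>u\<in>X. 0 < B u u"
    proof -
      obtain g where g: "\<And>i. i < Suc n \<Longrightarrow> g i \<in> V \<and> 0 < B (g i) (g i)"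
        "\<And>i j. i < Suc n \<Longrightarrow> j < Suc n \<Longrightarrow> i \<noteq> j \<Longrightarrow> B (g i) (g j) = 0"
        using infinite_dimensional[of "Suc n"] by blast
      \<comment> \<open>\<open>n + 1\<close> orthogonal vectors against \<open>n\<close> constraints
        leave a nontrivial combination; pairing it with some \<open>g j\<close> shows that it is not
        \<open>B\<close>-null.\<close>
      obtain c where c: "\<exists>i\<in>{..<Suc n}. c i \<noteq> 0"
        "\<And>k. k \<in> {..<n} \<Longrightarrow> (\<Sum>i\<in>{..<Suc n}. c i * B (g i) (f k)) = 0"
        using underdetermined_system[of "{..<n}" "{..<Suc n}" "\<lambda>i k. B (g i) (f k)"] by auto
      define u where "u = (\<Sum>i<Suc n. c i *\<^sub>R g i)"
      have uV: "u \<in> V" unfolding u_def using g by (intro B.in_V(5) B.in_V(4)) auto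
      have "B u (f k) = 0" if "k < n" for k
        unfolding u_def using g fV[OF that] c(2)[of k] that by (subst B.lincomb) auto
      with uV have "u \<in> X" by (simp add: X_def)
      obtain j where j: "j < Suc n" "c j \<noteq> 0" using c(1) by auto
      have "B u (g j) = (\<Sum>i<Suc n. c i * B (g i) (g j))"
        unfolding u_def using g j by (subst B.lincomb) auto
      also have "\<dots> = (\<Sum>i<Suc n. if i = j then c j * B (g j) (g j) else 0)"
        using g j by (intro sum.cong) auto
      also have "\<dots> = c j * B (g j) (g j)" using j by (subst sum.delta) auto
      finally have "B u (g j) \<noteq> 0" using g(1)[OF j(1)] j by auto
      have "B u u \<noteq> 0"
      proof
        assume "B u u = 0"
        with B.cauchy_schwarz[OF uV, of "g j"] g(1)[OF j(1)] \<open>B u (g j) \<noteq> 0\<close> show False by simp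
      qed
      with B.nonneg[OF uV] \<open>u \<in> X\<close> show ?thesis by force
    qed
    obtain u where u: "u \<in> X" "B u u = 1"
      "\<forall>v\<in>X. E u u * B v v \<le> E v v" "\<forall>v\<in>X. E u v = E u u * B u v"
    proof -
      have "\<exists>u\<in>X. B u u = 1 \<and> (\<forall>v\<in>X. E u u * B v v \<le> E v v) \<and> (\<forall>v\<in>X. E u v = E u u * B u v)"
        by (rule minimizer[OF X _ ex]) (rule cl)
      then show thesis by (elim bexE conjE) (rule that)
    qed
    have uV: "u \<in> V" using u(1) X by auto
    have "E u v = E u u * B u v" if "v \<in> V" for v
    proof -
      \<comment> \<open>The \<open>B\<close>-projection of \<open>v\<close> onto the predecessors,
        so that \<open>v - p\<close> is an admissible test vector.\<close>
      define p where "p = (\<Sum>i<n. B v (f i) *\<^sub>R f i)"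
      have pV: "p \<in> V" unfolding p_def using fV by (intro B.in_V(5) B.in_V(4)) auto
      have "B p (f j) = B v (f j)" if "j < n" for j
      proof -
        have "B p (f j) = (\<Sum>i<n. B v (f i) * B (f i) (f j))"
          unfolding p_def using fV that by (subst B.lincomb) auto
        also have "\<dots> = (\<Sum>i<n. if i = j then B v (f j) else 0)"
          using orth fe that by (intro sum.cong) auto
        also have "\<dots> = B v (f j)" using that by (subst sum.delta) auto
        finally show ?thesis .
      qed
      then have "v - p \<in> X" using pV that fV by (auto simp: X_def B.diff)
      then have 1: "E u (v - p) = E u u * B u (v - p)" by (rule u(4)[rule_format])
      have uf: "B (f i) u = 0" if "i < n" for i
        using u(1) B.sym[OF uV fV[OF that]] that by (simp add: X_def)
      have "E (f i) u = 0" if "i < n" for i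
      proof -
        have "E (f i) u = E (f i) (f i) * B (f i) u"
          using fe(1)[OF that] uV unfolding eigenpair_def by blast
        with uf[OF that] show ?thesis by simp
      qed
      then have "E p u = 0" unfolding p_def using fV uV by (subst E.lincomb) auto
      moreover have "B p u = 0" unfolding p_def using fV uV uf by (subst B.lincomb) auto
      ultimately have "E u p = 0" "B u p = 0" using E.sym B.sym uV pV by auto
      moreover from 1 have "E u v - E u p = E u u * (B u v - B u p)"
        unfolding E.diff_right[OF that pV uV] B.diff_right[OF that pV uV] .
      ultimately show ?thesis by (metis diff_zero)
    qed
    with uV have "eigenpair (E u u) u" unfolding eigenpair_def by blast
    with u(1-3) have "P f n u" by (auto simp: P_def X_def)
    then show "\<exists>r. P f n r" ..
  qed (auto simp: P_def)
  then show ?thesis by (auto simp: P_def eigenbasis_def)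
qed

context
  fixes e
  assumes e: "eigenbasis e"
begin

lemma eigenbasis_props:
  "e n \<in> V" "eigenpair (E (e n) (e n)) (e n)" "B (e n) (e n) = 1"
  "i < n \<Longrightarrow> B (e n) (e i) = 0"
  "v \<in> V \<Longrightarrow> (\<And>i. i < n \<Longrightarrow> B v (e i) = 0) \<Longrightarrow> E (e n) (e n) * B v v \<le> E v v"
  using e[unfolded eigenbasis_def, rule_format, of n] unfolding eigenpair_def by blast+

lemma eigenbasis_orthogonal: "i \<noteq> j \<Longrightarrow> B (e i) (e j) = 0"
  using eigenbasis_props(4)[of i j] eigenbasis_props(4)[of j i] B.sym[of "e i" "e j"] eigenbasis_props(1)
  by (cases "i < j") auto

lemma eigenvalues_mono: "mono (\<lambda>n. E (e n) (e n))"
proof (rule monoI)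
  fix m n :: nat
  assume "m \<le> n"
  then have "E (e m) (e m) * B (e n) (e n) \<le> E (e n) (e n)"
    by (intro eigenbasis_props(5) eigenbasis_props(1) eigenbasis_props(4)) auto
  then show "E (e m) (e m) \<le> E (e n) (e n)" using eigenbasis_props(3) by simp
qed

text \<open>Distinct basis vectors are \<open>B\<close>-orthonormal, hence at squared distance 2,
  and no sequence of them is \<open>B\<close>-Cauchy; infinitely many with bounded energy would
  contain such a sequence.\<close>

lemma finite_eigenvalues_below: "finite {k. E (e k) (e k) \<le> D}"
proof (rule ccontr)
  assume inf: "infinite {k. E (e k) (e k) \<le> D}"
  define h where "h = enumerate {k. E (e k) (e k) \<le> D}"
  have h: "strict_mono h" unfolding h_def by (rule strict_mono_enumerate[OF inf])
  have hE: "E (e (h n)) (e (h n)) \<le> D" for n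
    using enumerate_in_set[OF inf, of n] by (simp add: h_def)
  from precompact[of "\<lambda>n. e (h n)", OF eigenbasis_props(1) hE]
  obtain r :: "nat \<Rightarrow> nat" where r: "strict_mono r" "\<forall>d>0. \<exists>M. \<forall>m\<ge>M. \<forall>n\<ge>M.
      B (e (h (r m)) - e (h (r n))) (e (h (r m)) - e (h (r n))) < d" by blast
  from r(2)[rule_format, of 1] obtain M where "\<forall>m\<ge>M. \<forall>n\<ge>M. B (e (h (r m)) - e (h (r n))) (e (h (r m)) - e (h (r n))) < 1"
    by auto
  then have M: "B (e (h (r M)) - e (h (r (Suc M)))) (e (h (r M)) - e (h (r (Suc M)))) < 1"
    by simp
  have "h (r M) \<noteq> h (r (Suc M))"
    using h r(1) by (metis n_not_Suc_n strict_mono_eq)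
  then show False using M eigenbasis_orthogonal[of "h (r M)" "h (r (Suc M))"]
    by (simp add: B.square_diff eigenbasis_props)
qed

text \<open>Eigenvectors of different eigenvalues are orthogonal anyway, so \<open>u\<close> is
  orthogonal to the whole basis. If \<open>u\<close> were not \<open>B\<close>-null, minimality of
  every \<open>e n\<close> would put all eigenvalues below \<open>\<mu>\<close>, against
  \<open>finite_eigenvalues_below\<close>.\<close>

lemma eigenpair_trivial:
  assumes "eigenpair \<mu> u" and "\<And>k. E (e k) (e k) = \<mu> \<Longrightarrow> B u (e k) = 0"
  shows "B u u = 0"
proof (rule ccontr)
  assume "B u u \<noteq> 0"
  have uV: "u \<in> V" using assms(1) by (simp add: eigenpair_def)
  with B.nonneg \<open>B u u \<noteq> 0\<close> have pos: "0 < B u u" by force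
  have orth: "B u (e k) = 0" for k
    using assms eigenpair_orthogonal[OF assms(1) eigenbasis_props(2)[of k]]
    by (cases "E (e k) (e k) = \<mu>") auto
  have "E (e n) (e n) \<le> \<mu>" for n
  proof -
    have "E (e n) (e n) * B u u \<le> E u u" using orth uV by (intro eigenbasis_props(5)) auto
    also have "\<dots> = \<mu> * B u u" using assms(1) uV by (simp add: eigenpair_def)
    finally show ?thesis using pos by simp
  qed
  then have "{k. E (e k) (e k) \<le> \<mu>} = UNIV" by auto
  with finite_eigenvalues_below[of \<mu>] show False by simp
qed

text \<open>With more eigenvectors than basis vectors for \<open>\<mu>\<close>, some nontrivial
  combination is orthogonal to all the latter and is therefore \<open>B\<close>-null. This is the
  upper bound for the multiplicity.\<close>

lemma independent_eigenvectors_bound: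
  assumes f: "\<And>i. i < m \<Longrightarrow> eigenpair \<mu> (f i)"
    and ind: "\<And>c. B (\<Sum>i<m. c i *\<^sub>R f i) (\<Sum>i<m. c i *\<^sub>R f i) = 0 \<Longrightarrow> \<forall>i<m. c i = 0"
  shows "m \<le> card {k. E (e k) (e k) = \<mu>}"
proof (rule ccontr)
  define K where "K = {k. E (e k) (e k) = \<mu>}"
  assume "\<not> m \<le> card {k. E (e k) (e k) = \<mu>}"
  then have "card K < card {..<m}" by (simp add: K_def)
  moreover have "finite K" unfolding K_def
    by (rule finite_subset[OF _ finite_eigenvalues_below[of \<mu>]]) auto
  ultimately obtain c where c: "\<exists>i\<in>{..<m}. c i \<noteq> 0"
    "\<And>k. k \<in> K \<Longrightarrow> (\<Sum>i\<in>{..<m}. c i * B (f i) (e k)) = 0"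
    using underdetermined_system[of K "{..<m}" "\<lambda>i k. B (f i) (e k)"] by auto
  have fV: "f i \<in> V" if "i < m" for i using f[OF that] by (simp add: eigenpair_def)
  have "eigenpair \<mu> (\<Sum>i<m. c i *\<^sub>R f i)" using f by (intro eigenpair_lincomb) auto
  then have "B (\<Sum>i<m. c i *\<^sub>R f i) (\<Sum>i<m. c i *\<^sub>R f i) = 0"
  proof (rule eigenpair_trivial)
    fix k assume "E (e k) (e k) = \<mu>"
    then show "B (\<Sum>i<m. c i *\<^sub>R f i) (e k) = 0"
      using c(2)[of k] fV eigenbasis_props(1) by (subst B.lincomb) (auto simp: K_def)
  qed
  from ind[OF this] c(1) show False by auto
qed

lemma eigenbasis_independent:
  assumes "finite K" "B (\<Sum>k\<in>K. c k *\<^sub>R e k) (\<Sum>k\<in>K. c k *\<^sub>R e k) = 0" "j \<in> K"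
  shows "c j = 0"
proof -
  define u where "u = (\<Sum>k\<in>K. c k *\<^sub>R e k)"
  have uV: "u \<in> V" unfolding u_def using eigenbasis_props(1) by auto
  have "B u (e j) = (\<Sum>k\<in>K. c k * B (e k) (e j))"
    unfolding u_def using eigenbasis_props(1) by (subst B.lincomb) auto
  also have "\<dots> = (\<Sum>k\<in>K. if k = j then c j else 0)"
    using eigenbasis_orthogonal eigenbasis_props(3) by (intro sum.cong) auto
  also have "\<dots> = c j" using assms by (subst sum.delta) auto
  finally have "B u (e j) = c j" .
  moreover have "B u (e j) = 0"
    using B.cauchy_schwarz[OF uV, of "e j"] assms eigenbasis_props(1) by (simp add: u_def)
  ultimately show ?thesis by simp
qed

end

end

text \<open>At the first index \<open>k\<close> of disagreement, say \<open>L k < M k\<close>,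
  monotonicity confines the indices where \<open>M\<close> takes the value \<open>L k\<close> to
  those before \<open>k\<close>, where both sequences agree. This fibre of \<open>M\<close> is a
  proper subset of that of \<open>L\<close>, which also contains \<open>k\<close>. Uniqueness lets
  the definite description of the eigenvalues be evaluated.\<close>

lemma mono_with_fibre_cards_unique:
  fixes L M :: "nat \<Rightarrow> real"
  assumes "mono L" "mono M" and fin: "\<And>\<mu>. finite {k. L k = \<mu>}" "\<And>\<mu>. finite {k. M k = \<mu>}"
    and card: "\<And>\<mu>. card {k. L k = \<mu>} = card {k. M k = \<mu>}"
  shows "L = M"
proof -
  have False if "mono L" "mono M" "\<And>\<mu>. finite {k. L k = \<mu>}" "\<And>\<mu>. finite {k. M k = \<mu>}"
    "\<And>\<mu>. card {k. L k = \<mu>} = card {k. M k = \<mu>}" "\<And>j. j < k \<Longrightarrow> L j = M j" "L k < M k"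
    for L M :: "nat \<Rightarrow> real" and k
  proof -
    have "{j. M j = L k} \<subset> {j. L j = L k}"
    proof -
      have "j < k" if "M j = L k" for j
        using that \<open>mono M\<close> \<open>L k < M k\<close> by (metis leD leI monoD)
      then show ?thesis using that(6,7) by force
    qed
    then have "card {j. M j = L k} < card {j. L j = L k}"
      by (intro psubset_card_mono that)
    with that(5) show False by simp
  qed note less = this
  show ?thesis
  proof (rule ccontr)
    assume "L \<noteq> M"
    then have ex: "\<exists>k. L k \<noteq> M k" by auto
    define k where "k = (LEAST k. L k \<noteq> M k)"
    have k: "L k \<noteq> M k" unfolding k_def using ex by (rule LeastI_ex)
    have lt: "L j = M j" if "j < k" for j
      using not_less_Least[of j "\<lambda>k. L k \<noteq> M k"] that by (auto simp: k_def)
    show False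
    proof (cases "L k < M k")
      case True
      show False by (rule less[OF assms(1,2) fin card lt True])
    next
      case False
      with k have "M k < L k" by simp
      show False by (rule less[OF assms(2,1) fin(2,1) card[symmetric] lt[symmetric] \<open>M k < L k\<close>])
    qed
  qed
qed

text \<open>Functions themselves, not classes modulo null sets, form the vector space to which the
  abstract theory is applied; this is why its forms are only semidefinite.\<close>

instantiation "fun" :: (type, real_vector) real_vector
begin

definition scaleR_fun :: "real \<Rightarrow> ('a \<Rightarrow> 'b) \<Rightarrow> 'a \<Rightarrow> 'b" where
  "scaleR_fun c f = (\<lambda>x. c *\<^sub>R f x)"

instance
  by standard (auto simp: scaleR_fun_def fun_eq_iff algebra_simps)

end

section \<open>The Gagliardo form\<close>

lemma AE_lborel_pairI:
  assumes "AE x in lborel. R x"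
  shows "AE z in lborel \<Otimes>\<^sub>M lborel. R (fst z)" "AE z in lborel \<Otimes>\<^sub>M lborel. R (snd z)"
proof -
  from assms obtain N where N: "N \<in> null_sets lborel" "{x \<in> space lborel. \<not> R x} \<subseteq> N"
    by (auto simp: eventually_ae_filter)
  have "N \<times> UNIV \<in> null_sets (lborel \<Otimes>\<^sub>M lborel)" "UNIV \<times> N \<in> null_sets (lborel \<Otimes>\<^sub>M lborel)"
    using N by auto
  then show "AE z in lborel \<Otimes>\<^sub>M lborel. R (fst z)" "AE z in lborel \<Otimes>\<^sub>M lborel. R (snd z)"
    using N(2) by (auto intro!: AE_I'[of "N \<times> UNIV"] AE_I'[of "UNIV \<times> N"])
qed

lemma difference_kernel_apply:
  "difference_kernel s u v (x, y) =
     (u x - u y) * (v x - v y) / norm (x - y) powr (real DIM('a) + 2 * s)"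
  for x y :: "'a::euclidean_space"
  by (simp add: difference_kernel_def)

lemma difference_kernel_nonneg [simp]: "0 \<le> difference_kernel s u u z"
  by (cases z) (simp add: difference_kernel_def)

lemma borel_measurable_difference_kernel [measurable]:
  assumes [measurable]: "u \<in> borel_measurable borel" "v \<in> borel_measurable borel"
  shows "difference_kernel s u v \<in> borel_measurable (lborel \<Otimes>\<^sub>M lborel)"
  unfolding difference_kernel_def by measurable

text \<open>The bilinear form without its normalising factor, which
  \<open>fractional_form_gagliardo\<close> restores.\<close>

definition gagliardo :: "real \<Rightarrow> ('a::euclidean_space \<Rightarrow> real) \<Rightarrow> ('a \<Rightarrow> real) \<Rightarrow> real" where
  "gagliardo s u v = (LINT z|(lborel \<Otimes>\<^sub>M lborel). difference_kernel s u v z)"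

definition energy_space :: "real \<Rightarrow> ('a::euclidean_space \<Rightarrow> real) set" where
  "energy_space s = {u \<in> borel_measurable borel. finite_energy s u}"

lemma energy_space_measurable: "u \<in> energy_space s \<Longrightarrow> u \<in> borel_measurable borel"
  by (simp add: energy_space_def)

lemma integrable_difference_kernel:
  assumes "u \<in> energy_space s" "v \<in> energy_space s"
  shows "integrable (lborel \<Otimes>\<^sub>M lborel) (difference_kernel s u v)"
proof (rule Bochner_Integration.integrable_bound)
  show "integrable (lborel \<Otimes>\<^sub>M lborel) (\<lambda>z. difference_kernel s u u z + difference_kernel s v v z)"
    using assms by (auto simp: energy_space_def finite_energy_def)
  show "difference_kernel s u v \<in> borel_measurable (lborel \<Otimes>\<^sub>M lborel)"
    using assms by (auto simp: energy_space_def)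
  have "\<bar>a * b\<bar> \<le> a * a + b * b" for a b :: real
  proof -
    have "2 * (\<bar>a\<bar> * \<bar>b\<bar>) \<le> a * a + b * b"
      using sum_squares_bound[of "\<bar>a\<bar>" "\<bar>b\<bar>"] by (simp add: power2_eq_square)
    moreover have "0 \<le> \<bar>a\<bar> * \<bar>b\<bar>" by simp
    ultimately show ?thesis unfolding abs_mult by linarith
  qed
  then have "norm (difference_kernel s u v z) \<le> norm (difference_kernel s u u z + difference_kernel s v v z)" for z
    by (cases z) (simp add: difference_kernel_def abs_mult add_divide_distrib[symmetric] divide_right_mono)
  then show "AE z in lborel \<Otimes>\<^sub>M lborel. norm (difference_kernel s u v z)
      \<le> norm (difference_kernel s u u z + difference_kernel s v v z)" by simp
qed

lemma difference_kernel_sym: "difference_kernel s u v = difference_kernel s v u"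
  by (auto simp: difference_kernel_def fun_eq_iff)

lemma difference_kernel_add:
  "difference_kernel s (u + v) w z = difference_kernel s u w z + difference_kernel s v w z"
  by (cases z) (simp add: difference_kernel_def add_divide_distrib[symmetric] algebra_simps)

lemma difference_kernel_scale: "difference_kernel s (c *\<^sub>R u) w z = c * difference_kernel s u w z"
  by (cases z) (simp add: difference_kernel_def scaleR_fun_def algebra_simps)

lemma subspace_energy_space: "subspace (energy_space s)"
proof (rule subspaceI)
  show "0 \<in> energy_space s"
    by (auto simp: energy_space_def finite_energy_def difference_kernel_def zero_fun_def split_def)
next
  fix u v :: "'a \<Rightarrow> real"
  assume uv: "u \<in> energy_space s" "v \<in> energy_space s"
  have "u + v \<in> borel_measurable borel" using uv by (auto simp: energy_space_def plus_fun_def)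
  moreover have "difference_kernel s (u + v) (u + v) = (\<lambda>z. difference_kernel s u u z
      + difference_kernel s u v z + (difference_kernel s v u z + difference_kernel s v v z))"
    by (auto simp: fun_eq_iff difference_kernel_def field_simps add_divide_distrib[symmetric] split: prod.split)
  ultimately show "u + v \<in> energy_space s"
    using uv by (auto simp: energy_space_def finite_energy_def[of s "u + v"] integrable_difference_kernel
      intro!: Bochner_Integration.integrable_add integrable_difference_kernel)
next
  fix c :: real and u :: "'a \<Rightarrow> real"
  assume u: "u \<in> energy_space s"
  have "c *\<^sub>R u \<in> borel_measurable borel" using u by (auto simp: energy_space_def scaleR_fun_def)
  moreover have "difference_kernel s (c *\<^sub>R u) (c *\<^sub>R u) = (\<lambda>z. c\<^sup>2 * difference_kernel s u u z)"
    by (auto simp: fun_eq_iff difference_kernel_def scaleR_fun_def power2_eq_square field_simps)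
  ultimately show "c *\<^sub>R u \<in> energy_space s"
    using u by (auto simp: energy_space_def finite_energy_def)
qed

lemma semi_inner_form_gagliardo: "semi_inner_form (energy_space s) (gagliardo s)"
proof
  fix u v w :: "'a \<Rightarrow> real" and a
  assume [simp]: "u \<in> energy_space s" "v \<in> energy_space s" "w \<in> energy_space s"
  show "gagliardo s (u + v) w = gagliardo s u w + gagliardo s v w"
    unfolding gagliardo_def difference_kernel_add
    by (intro Bochner_Integration.integral_add integrable_difference_kernel) auto
qed (auto simp: subspace_energy_space gagliardo_def difference_kernel_scale
      intro!: Bochner_Integration.integral_nonneg arg_cong[OF difference_kernel_sym])

lemma nn_integral_energy:
  assumes "u \<in> energy_space s"
  shows "(\<integral>\<^sup>+z. ennreal (difference_kernel s u u z) \<partial>(lborel \<Otimes>\<^sub>M lborel)) = ennreal (gagliardo s u u)"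
  unfolding gagliardo_def using assms
  by (intro nn_integral_eq_integral integrable_difference_kernel) auto

lemma energy_spaceI:
  assumes "u \<in> borel_measurable borel"
    "(\<integral>\<^sup>+z. ennreal (difference_kernel s u u z) \<partial>(lborel \<Otimes>\<^sub>M lborel)) < \<infinity>"
  shows "u \<in> energy_space s"
  using assms by (auto simp: energy_space_def finite_energy_def intro!: integrableI_nonneg)

lemma gagliardo_nonneg: "0 \<le> gagliardo s u u"
  unfolding gagliardo_def by (intro Bochner_Integration.integral_nonneg) auto

lemma energy_spaceI_bound:
  assumes "u \<in> borel_measurable borel" "0 \<le> c"
    "(\<integral>\<^sup>+z. ennreal (difference_kernel s u u z) \<partial>(lborel \<Otimes>\<^sub>M lborel)) \<le> ennreal c"
  shows "u \<in> energy_space s" "gagliardo s u u \<le> c"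
proof -
  show *: "u \<in> energy_space s"
    using assms(1,3) by (intro energy_spaceI) (auto simp: le_less_trans)
  show "gagliardo s u u \<le> c"
    using assms(2,3) nn_integral_energy[OF *] by simp
qed

lemma nn_integral_energy_iterated:
  assumes "u \<in> energy_space s"
  shows "(\<integral>\<^sup>+x. \<integral>\<^sup>+y. ennreal (difference_kernel s u u (x, y)) \<partial>lborel \<partial>lborel) = ennreal (gagliardo s u u)"
proof -
  have [measurable]: "u \<in> borel_measurable borel" using assms by (rule energy_space_measurable)
  show ?thesis
    unfolding nn_integral_energy[OF assms, symmetric] by (rule lborel.nn_integral_fst) measurable
qed

text \<open>The constant that the proof of \<open>poincare\<close> yields: 5 bounds the distance
  from a point of the unit ball to a point of a unit ball whose centre has norm 3, and the latter
  ball contributes its volume.\<close>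

definition poincare_constant :: "'a::euclidean_space itself \<Rightarrow> real \<Rightarrow> real" where
  "poincare_constant _ s = 5 powr (real DIM('a) + 2 * s) / measure lborel (ball (0::'a) 1)"

lemma poincare_constant_pos: "0 < poincare_constant TYPE('a::euclidean_space) s"
  unfolding poincare_constant_def by (simp add: content_ball_pos)

text \<open>On a ball disjoint from the support, \<open>u x\<close> equals \<open>u x - u y\<close>.\<close>

lemma poincare:
  fixes u :: "'a::euclidean_space \<Rightarrow> real"
  assumes u: "u \<in> energy_space s" and s: "0 < s" and zero: "AE x in lborel. x \<notin> ball 0 1 \<longrightarrow> u x = 0"
  shows "integrable lborel (\<lambda>x. (u x)\<^sup>2)"
    "(LINT x|lborel. (u x)\<^sup>2) \<le> poincare_constant TYPE('a) s * gagliardo s u u"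
proof -
  have [measurable]: "u \<in> borel_measurable borel" using u by (rule energy_space_measurable)
  define p where "p = real DIM('a) + 2 * s"
  have p: "0 \<le> p" using s by (simp add: p_def)
  obtain e :: 'a where e: "norm e = 3"
    using vector_choose_size[of 3] by auto
  define D where "D = ball e 1"
  have mD: "emeasure lborel D = ennreal (measure lborel (ball (0::'a) 1))"
    unfolding D_def by (simp add: emeasure_ball content_ball)
  have mpos: "0 < measure lborel (ball (0::'a) 1)" by (simp add: content_ball_pos)
  have "emeasure lborel D * (\<integral>\<^sup>+x. ennreal ((u x)\<^sup>2) \<partial>lborel)
      = (\<integral>\<^sup>+x. \<integral>\<^sup>+y. ennreal ((u x)\<^sup>2) * indicator D y \<partial>lborel \<partial>lborel)"
    by (subst nn_integral_cmult_indicator, simp add: D_def, subst nn_integral_multc, measurable)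
       (simp add: mult.commute)
  also have "\<dots> = (\<integral>\<^sup>+z. ennreal ((u (fst z))\<^sup>2) * indicator D (snd z) \<partial>(lborel \<Otimes>\<^sub>M lborel))"
  proof -
    have [measurable]: "D \<in> sets borel" by (simp add: D_def)
    have "(\<integral>\<^sup>+x. \<integral>\<^sup>+y. (\<lambda>z. ennreal ((u (fst z))\<^sup>2) * indicator D (snd z)) (x, y) \<partial>lborel \<partial>lborel)
        = (\<integral>\<^sup>+z. ennreal ((u (fst z))\<^sup>2) * indicator D (snd z) \<partial>(lborel \<Otimes>\<^sub>M lborel))"
      by (rule lborel.nn_integral_fst) measurable
    then show ?thesis by simp
  qed
  also have "\<dots> \<le> (\<integral>\<^sup>+z. ennreal (5 powr p * difference_kernel s u u z) \<partial>(lborel \<Otimes>\<^sub>M lborel))"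
  proof (rule nn_integral_mono_AE)
    show "AE z in lborel \<Otimes>\<^sub>M lborel. ennreal ((u (fst z))\<^sup>2) * indicator D (snd z)
        \<le> ennreal (5 powr p * difference_kernel s u u z)"
      using AE_lborel_pairI(1)[OF zero] AE_lborel_pairI(2)[OF zero]
    proof eventually_elim
      case (elim z)
      obtain x y where z: "z = (x, y)" by (cases z)
      show ?case
      proof (cases "x \<in> ball 0 1 \<and> y \<in> D")
        case True
        have "norm (y - e) < 1" "norm x < 1" using True by (auto simp: D_def dist_norm norm_minus_commute)
        then have "norm (x - y) \<le> 5" "norm y > 2"
          using e norm_triangle_ineq4[of x y] norm_triangle_ineq[of "y - e" e] norm_triangle_ineq2[of e "e - y"]
          by (auto simp: norm_minus_commute)
        then have "norm (x - y) powr p \<le> 5 powr p" "u y = 0" "norm (x - y) > 0"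
          using p elim z \<open>norm x < 1\<close> by (auto intro: powr_mono2)
        then have "(u x)\<^sup>2 \<le> 5 powr p * ((u x)\<^sup>2 / norm (x - y) powr p)"
          by (simp add: field_simps mult_left_mono)
        then show ?thesis using True \<open>u y = 0\<close>
          by (simp add: z difference_kernel_def p_def power2_eq_square ennreal_leI)
      next
        case False
        then show ?thesis using elim z by (auto simp: indicator_def)
      qed
    qed
  qed
  also have "\<dots> = ennreal (5 powr p) * ennreal (gagliardo s u u)"
    using u by (simp add: ennreal_mult nn_integral_cmult nn_integral_energy)
  finally have *: "ennreal (measure lborel (ball (0::'a) 1)) * (\<integral>\<^sup>+x. ennreal ((u x)\<^sup>2) \<partial>lborel)
      \<le> ennreal (5 powr p * gagliardo s u u)"
    by (simp add: mD ennreal_mult gagliardo_nonneg)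
  have "(\<integral>\<^sup>+x. ennreal ((u x)\<^sup>2) \<partial>lborel)
      = ennreal (1 / measure lborel (ball (0::'a) 1)) *
        (ennreal (measure lborel (ball (0::'a) 1)) * (\<integral>\<^sup>+x. ennreal ((u x)\<^sup>2) \<partial>lborel))"
    using mpos by (simp add: mult.assoc[symmetric] ennreal_mult[symmetric])
  also have "\<dots> \<le> ennreal (1 / measure lborel (ball (0::'a) 1)) * ennreal (5 powr p * gagliardo s u u)"
    by (intro mult_left_mono *) auto
  also have "\<dots> = ennreal (poincare_constant TYPE('a) s * gagliardo s u u)"
    using mpos by (simp add: ennreal_mult[symmetric] gagliardo_nonneg poincare_constant_def p_def)
  finally have fin: "(\<integral>\<^sup>+x. ennreal ((u x)\<^sup>2) \<partial>lborel) \<le> ennreal (poincare_constant TYPE('a) s * gagliardo s u u)" .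
  show int: "integrable lborel (\<lambda>x. (u x)\<^sup>2)"
    using fin by (intro integrableI_nonneg) (auto simp: le_less_trans)
  show "(LINT x|lborel. (u x)\<^sup>2) \<le> poincare_constant TYPE('a) s * gagliardo s u u"
    using fin poincare_constant_pos[where 'a='a, of s] gagliardo_nonneg[of s u]
    by (simp add: nn_integral_eq_integral[OF int])
qed

text \<open>Riesz-Fischer: along a fast subsequence the consecutive differences are summable in L^1,
  so the sequence converges almost everywhere. The pointwise limit is what
  \<open>gagliardo_Fatou\<close> takes as input.\<close>

lemma L2_Cauchy_AE_convergent:
  fixes f :: "nat \<Rightarrow> 'a::euclidean_space \<Rightarrow> real"
  assumes meas [measurable]: "\<And>n. f n \<in> borel_measurable borel"
    and zero: "\<And>n. AE x in lborel. x \<notin> ball 0 1 \<longrightarrow> f n x = 0"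
    and cauchy: "\<And>e. 0 < e \<Longrightarrow>
      \<exists>M. \<forall>m\<ge>M. \<forall>n\<ge>M. (\<integral>\<^sup>+x. ennreal ((f m x - f n x)\<^sup>2) \<partial>lborel) \<le> ennreal e"
  shows "\<exists>(r::nat\<Rightarrow>nat) u. strict_mono r \<and> u \<in> borel_measurable borel \<and>
    (AE x in lborel. (\<lambda>k. f (r k) x) \<longlonglongrightarrow> u x)"
proof -
  have "\<forall>k. \<exists>M. \<forall>m\<ge>M. \<forall>n\<ge>M. (\<integral>\<^sup>+x. ennreal ((f m x - f n x)\<^sup>2) \<partial>lborel) \<le> ennreal ((1/4)^k)"
    using cauchy by simp
  then obtain M where M: "\<And>k m n. m \<ge> M k \<Longrightarrow> n \<ge> M k \<Longrightarrow>
      (\<integral>\<^sup>+x. ennreal ((f m x - f n x)\<^sup>2) \<partial>lborel) \<le> ennreal ((1/4)^k)"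
    by metis
  \<comment> \<open>The partial sums dominate each \<open>M k\<close>, and the summand
    \<open>k\<close> makes the sequence strictly increasing.\<close>
  define r where "r k = (\<Sum>j\<le>k. M j) + k" for k :: nat
  have r: "strict_mono r" by (rule strict_mono_Suc_iff[THEN iffD2]) (simp add: r_def)
  have rM: "r k \<ge> M k" for k
    using member_le_sum[of k "{..k}" M] by (simp add: r_def)
  have [measurable]: "ball (0::'a) 1 \<in> sets borel" by simp
  define d where "d k x = \<bar>f (r (Suc k)) x - f (r k) x\<bar>" for k x
  have [measurable]: "d k \<in> borel_measurable borel" for k unfolding d_def by measurable
  define c where "c = 1 + measure lborel (ball (0::'a) 1)"
  have c0: "0 \<le> c" by (simp add: c_def)
  have dk: "(\<integral>\<^sup>+x. ennreal (d k x) \<partial>lborel) \<le> ennreal (c * (1/2)^k)" for k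
  proof -
    have "(\<integral>\<^sup>+x. ennreal (d k x) \<partial>lborel) \<le>
        (\<integral>\<^sup>+x. ennreal (2^k) * ennreal ((f (r (Suc k)) x - f (r k) x)\<^sup>2) + ennreal ((1/2)^k) * indicator (ball 0 1) x \<partial>lborel)"
    proof (rule nn_integral_mono_AE)
      show "AE x in lborel. ennreal (d k x) \<le> ennreal (2^k) * ennreal ((f (r (Suc k)) x - f (r k) x)\<^sup>2)
          + ennreal ((1/2)^k) * indicator (ball 0 1) x"
        using zero[of "r (Suc k)"] zero[of "r k"]
      proof eventually_elim
        case (elim x)
        show ?case
        proof (cases "x \<in> ball 0 1")
          case True
          define a where "a = d k x"
          \<comment> \<open>Gives \<open>a \<le> 2^k a^2 + 2^-k\<close>. With squared norms below
            \<open>4^-k\<close> the first term integrates to at most \<open>2^-k\<close>; the second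
            is integrated over the unit ball only.\<close>
          have "0 \<le> (2^k * a - 1)\<^sup>2 / 2^k + a" by (simp add: a_def d_def)
          also have "\<dots> = 2^k * a\<^sup>2 + (1/2)^k - a"
            by (simp add: power2_eq_square field_simps power_one_over)
          finally have "a \<le> 2^k * a\<^sup>2 + (1/2)^k" by simp
          moreover have "a\<^sup>2 = (f (r (Suc k)) x - f (r k) x)\<^sup>2" by (simp add: a_def d_def)
          ultimately have "ennreal a \<le> ennreal (2^k * (f (r (Suc k)) x - f (r k) x)\<^sup>2 + (1/2)^k)"
            by (intro ennreal_leI) simp
          then show ?thesis using True by (simp add: a_def ennreal_mult ennreal_plus)
        next
          case False
          with elim show ?thesis by (simp add: d_def)
        qed
      qed
    qed
    also have "\<dots> = ennreal (2^k) * (\<integral>\<^sup>+x. ennreal ((f (r (Suc k)) x - f (r k) x)\<^sup>2) \<partial>lborel)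
        + ennreal ((1/2)^k) * emeasure lborel (ball (0::'a) 1)"
    proof (subst nn_integral_add; (rule arg_cong2[where f = "(+)"])?; measurable?)
      show "(\<integral>\<^sup>+x. ennreal (2^k) * ennreal ((f (r (Suc k)) x - f (r k) x)\<^sup>2) \<partial>lborel)
          = ennreal (2^k) * (\<integral>\<^sup>+x. ennreal ((f (r (Suc k)) x - f (r k) x)\<^sup>2) \<partial>lborel)"
        by (rule nn_integral_cmult) measurable
      show "(\<integral>\<^sup>+x. ennreal ((1/2)^k) * indicator (ball (0::'a) 1) x \<partial>lborel)
          = ennreal ((1/2)^k) * emeasure lborel (ball (0::'a) 1)"
        by (rule nn_integral_cmult_indicator) simp
    qed
    also have "\<dots> \<le> ennreal (2^k) * ennreal ((1/4)^k) + ennreal ((1/2)^k) * ennreal (measure lborel (ball (0::'a) 1))"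
    proof -
      have "M k \<le> r (Suc k)" using rM[of k] r by (meson le_SucI lessI less_imp_le order_trans strict_mono_less_eq)
      with M[OF this rM[of k]] show ?thesis
        by (intro add_mono mult_left_mono) (auto simp: emeasure_ball content_ball)
    qed
    also have "\<dots> = ennreal (c * (1/2)^k)"
      by (simp add: ennreal_mult[symmetric] ennreal_plus[symmetric] c_def power_mult_distrib[symmetric] algebra_simps
          del: ennreal_plus)
    finally show ?thesis .
  qed
  have "(\<integral>\<^sup>+x. (\<Sum>k. ennreal (d k x)) \<partial>lborel) = (\<Sum>k. \<integral>\<^sup>+x. ennreal (d k x) \<partial>lborel)"
    by (rule nn_integral_suminf) measurable
  also have "\<dots> \<le> (\<Sum>k. ennreal (c * (1/2)^k))" by (intro suminf_le dk) auto
  also have "\<dots> = ennreal (\<Sum>k. c * (1/2)^k)"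
    using c0 by (intro suminf_ennreal2) (auto intro!: summable_mult summable_geometric)
  finally have "(\<integral>\<^sup>+x. (\<Sum>k. ennreal (d k x)) \<partial>lborel) \<noteq> \<infinity>"
    using le_less_trans[OF _ ennreal_less_top] by (metis infinity_ennreal_def less_irrefl)
  then have "AE x in lborel. (\<Sum>k. ennreal (d k x)) \<noteq> \<infinity>"
    by (intro nn_integral_PInf_AE) auto
  then have conv: "AE x in lborel. convergent (\<lambda>k. f (r k) x)"
  proof eventually_elim
    case (elim x)
    have "summable (\<lambda>k. d k x)"
      using elim by (intro summable_suminf_not_top) (auto simp: d_def)
    then have "summable (\<lambda>k. f (r (Suc k)) x - f (r k) x)"
      unfolding d_def by (rule summable_rabs_cancel)
    then have "convergent (\<lambda>n. \<Sum>k<n. f (r (Suc k)) x - f (r k) x)"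
      by (simp add: summable_iff_convergent)
    then have "convergent (\<lambda>n. f (r n) x - f (r 0) x)"
      by (simp only: sum_lessThan_telescope[of "\<lambda>k. f (r k) x"])
    then have "convergent (\<lambda>n. (f (r n) x - f (r 0) x) + f (r 0) x)"
      by (intro convergent_add convergent_const)
    then show ?case by simp
  qed
  define u where "u x = lim (\<lambda>k. f (r k) x)" for x
  have "u \<in> borel_measurable borel" unfolding u_def by measurable
  moreover have "AE x in lborel. (\<lambda>k. f (r k) x) \<longlonglongrightarrow> u x"
    using conv by eventually_elim (simp add: u_def convergent_LIMSEQ_iff)
  ultimately show ?thesis using r by blast
qed

text \<open>Fatou's lemma on the product space, where the kernels converge almost everywhere. Finite
  energy of the limit and the bound come out together.\<close>

lemma gagliardo_Fatou:
  fixes f :: "nat \<Rightarrow> 'a::euclidean_space \<Rightarrow> real"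
  assumes f: "\<And>n. f n \<in> energy_space s" and u [measurable]: "u \<in> borel_measurable borel"
    and lim: "AE x in lborel. (\<lambda>k. f k x) \<longlonglongrightarrow> u x"
    and bound: "\<And>n. n \<ge> M \<Longrightarrow> gagliardo s (f n) (f n) \<le> c" and c: "0 \<le> c"
  shows "u \<in> energy_space s" "gagliardo s u u \<le> c"
proof -
  have [measurable]: "f n \<in> borel_measurable borel" for n using f by (rule energy_space_measurable)
  have "(\<integral>\<^sup>+z. ennreal (difference_kernel s u u z) \<partial>(lborel \<Otimes>\<^sub>M lborel))
      = (\<integral>\<^sup>+z. liminf (\<lambda>n. ennreal (difference_kernel s (f n) (f n) z)) \<partial>(lborel \<Otimes>\<^sub>M lborel))"
  proof (rule nn_integral_cong_AE)
    show "AE z in lborel \<Otimes>\<^sub>M lborel. ennreal (difference_kernel s u u z)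
        = liminf (\<lambda>n. ennreal (difference_kernel s (f n) (f n) z))"
      using AE_lborel_pairI(1)[OF lim] AE_lborel_pairI(2)[OF lim]
    proof eventually_elim
      case (elim z)
      have "(\<lambda>n. ennreal (difference_kernel s (f n) (f n) z)) \<longlonglongrightarrow> ennreal (difference_kernel s u u z)"
        using elim by (cases z) (auto simp: difference_kernel_def divide_inverse intro!: tendsto_intros)
      then show ?case by (rule lim_imp_Liminf[OF sequentially_bot, symmetric])
    qed
  qed
  also have "\<dots> \<le> liminf (\<lambda>n. \<integral>\<^sup>+z. ennreal (difference_kernel s (f n) (f n) z) \<partial>(lborel \<Otimes>\<^sub>M lborel))"
    by (rule nn_integral_liminf) measurable
  also have "\<dots> = liminf (\<lambda>n. ennreal (gagliardo s (f n) (f n)))"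
    using f by (simp add: nn_integral_energy)
  also have "\<dots> \<le> ennreal c"
  proof -
    have "liminf (\<lambda>n. ennreal (gagliardo s (f n) (f n))) \<le> limsup (\<lambda>n. ennreal (gagliardo s (f n) (f n)))"
      by (rule Liminf_le_Limsup) simp
    also have "\<dots> \<le> ennreal c"
      using bound by (intro Limsup_bounded) (auto simp: eventually_sequentially intro!: ennreal_leI exI[of _ M])
    finally show ?thesis .
  qed
  finally have *: "(\<integral>\<^sup>+z. ennreal (difference_kernel s u u z) \<partial>(lborel \<Otimes>\<^sub>M lborel)) \<le> ennreal c" .
  from energy_spaceI_bound[OF u c *] show "u \<in> energy_space s" "gagliardo s u u \<le> c" by auto
qed


section \<open>Compactness of the embedding into L^2\<close>

lemma grid_cells:
  fixes h :: real
  assumes h: "0 < h"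
  shows "\<exists>(R :: 'a::euclidean_space set) (A :: 'a \<Rightarrow> 'a set). finite R \<and> R \<noteq> {} \<and> (\<forall>k. A k \<in> sets borel) \<and>
    (\<forall>k\<in>R. emeasure lborel (A k) = ennreal (h ^ DIM('a))) \<and>
    (\<forall>k l x. x \<in> A k \<longrightarrow> x \<in> A l \<longrightarrow> k = l) \<and> ball 0 1 \<subseteq> (\<Union>k\<in>R. A k) \<and>
    (\<forall>k x y. x \<in> A k \<longrightarrow> y \<in> A k \<longrightarrow> norm (x - y) \<le> real DIM('a) * h)"
proof -
  \<comment> \<open>Rounding down to the lattice of mesh \<open>h\<close>: the cells are the fibres
    of \<open>G\<close>, half-open cubes, so their disjointness is automatic.\<close>
  define G :: "'a \<Rightarrow> 'a" where "G x = (\<Sum>i\<in>Basis. real_of_int \<lfloor>(x \<bullet> i) / h\<rfloor> *\<^sub>R i)" for x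
  have G: "G x \<bullet> i = real_of_int \<lfloor>(x \<bullet> i) / h\<rfloor>" if "i \<in> Basis" for x i
    using that by (simp add: G_def inner_sum_left inner_Basis if_distrib cong: if_cong)
  have [measurable]: "G \<in> borel_measurable borel" unfolding G_def by measurable
  define A where "A k = {x. G x = k}" for k
  define R where "R = G ` ball 0 1"
  have fl: "h * (G x \<bullet> i) \<le> x \<bullet> i" "x \<bullet> i < h * (G x \<bullet> i + 1)" if "i \<in> Basis" for x i
  proof -
    define t where "t = (x \<bullet> i) / h"
    have "h * real_of_int \<lfloor>t\<rfloor> \<le> h * t" using h by (intro mult_left_mono) auto
    moreover have "h * t < h * (real_of_int \<lfloor>t\<rfloor> + 1)" using h by (intro mult_strict_left_mono) auto
    moreover have "h * t = x \<bullet> i" using h by (simp add: t_def)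
    ultimately show "h * (G x \<bullet> i) \<le> x \<bullet> i" "x \<bullet> i < h * (G x \<bullet> i + 1)"
      unfolding G[OF that] t_def[symmetric] by simp_all
  qed
  have c1: "A k \<in> sets borel" for k
    unfolding A_def by measurable
  have c2: "finite R"
  proof -
    define m :: int where "m = \<lceil>1 / h\<rceil> + 1"
    have "R \<subseteq> (\<lambda>f. \<Sum>i\<in>Basis. f i *\<^sub>R i) ` (PiE Basis (\<lambda>_. real_of_int ` {-m..m}))"
    proof
      fix k assume "k \<in> R"
      then obtain x where x: "norm x < 1" "k = G x" by (auto simp: R_def)
      have b: "\<lfloor>(x \<bullet> i) / h\<rfloor> \<in> {-m..m}" if "i \<in> Basis" for i
      proof -
        have "\<bar>x \<bullet> i\<bar> \<le> 1" using Basis_le_norm[OF that, of x] x by simp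
        then have "\<bar>(x \<bullet> i) / h\<bar> \<le> 1 / h" using h by (simp add: field_simps abs_le_iff)
        then show ?thesis unfolding m_def by (simp, linarith)
      qed
      have "k = (\<Sum>i\<in>Basis. restrict (\<lambda>i. real_of_int \<lfloor>(x \<bullet> i) / h\<rfloor>) Basis i *\<^sub>R i)"
        unfolding x(2) G_def by (intro sum.cong) auto
      moreover have "restrict (\<lambda>i. real_of_int \<lfloor>(x \<bullet> i) / h\<rfloor>) Basis \<in> PiE Basis (\<lambda>_. real_of_int ` {-m..m})"
        using b by auto
      ultimately show "k \<in> (\<lambda>f. \<Sum>i\<in>Basis. f i *\<^sub>R i) ` (PiE Basis (\<lambda>_. real_of_int ` {-m..m}))"
        by (rule image_eqI)
    qed
    moreover have "finite (PiE (Basis::'a set) (\<lambda>_. real_of_int ` {-m..m}))" by (intro finite_PiE) auto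
    ultimately show ?thesis by (meson finite_imageI finite_subset)
  qed
  have c3: "emeasure lborel (A k) = ennreal (h ^ DIM('a))" if "k \<in> R" for k
  proof -
    from that obtain x0 where x0: "k = G x0" by (auto simp: R_def)
    define l u where "l = h *\<^sub>R k" and "u = h *\<^sub>R (k + One)"
    have lu: "l \<bullet> i \<le> u \<bullet> i" "(u - l) \<bullet> i = h" if "i \<in> Basis" for i
      using that h by (auto simp: l_def u_def inner_add_left algebra_simps)
    have "box l u \<subseteq> A k"
    proof
      fix x assume x: "x \<in> box l u"
      have "G x \<bullet> i = k \<bullet> i" if "i \<in> Basis" for i
      proof -
        have "h * (k \<bullet> i) < x \<bullet> i" "x \<bullet> i < h * (k \<bullet> i + 1)"
          using x that by (auto simp: box_def l_def u_def inner_add_left)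
        then have "k \<bullet> i \<le> (x \<bullet> i) / h" "(x \<bullet> i) / h < k \<bullet> i + 1" using h by (simp_all add: field_simps)
        then have "\<lfloor>(x \<bullet> i) / h\<rfloor> = \<lfloor>(x0 \<bullet> i) / h\<rfloor>"
          unfolding x0 G[OF that] by linarith
        then show ?thesis by (simp add: x0 G that)
      qed
      then show "x \<in> A k" by (auto simp: A_def intro: euclidean_eqI)
    qed
    moreover have "A k \<subseteq> cbox l u"
    proof
      fix x assume "x \<in> A k"
      then have "G x = k" by (simp add: A_def)
      with fl[of _ x] show "x \<in> cbox l u"
        by (auto simp: mem_box l_def u_def inner_add_left intro: less_imp_le)
    qed
    ultimately have "emeasure lborel (box l u) \<le> emeasure lborel (A k)" "emeasure lborel (A k) \<le> emeasure lborel (cbox l u)"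
      using c1 by (auto intro!: emeasure_mono)
    moreover have "emeasure lborel (box l u) = ennreal (h ^ DIM('a))" "emeasure lborel (cbox l u) = ennreal (h ^ DIM('a))"
      using lu by (auto simp: emeasure_lborel_box emeasure_lborel_cbox)
    ultimately show ?thesis by (intro antisym) auto
  qed
  have c4: "norm (x - y) \<le> real DIM('a) * h" if "x \<in> A k" "y \<in> A k" for k x y
  proof -
    have "\<bar>(x - y) \<bullet> i\<bar> \<le> h" if i: "i \<in> Basis" for i
    proof -
      have "G x \<bullet> i = G y \<bullet> i" using \<open>x \<in> A k\<close> \<open>y \<in> A k\<close> by (simp add: A_def)
      with fl[OF i, of x] fl[OF i, of y] show ?thesis
        by (simp add: inner_diff_left algebra_simps abs_le_iff)
    qed
    then have "(\<Sum>i\<in>Basis. \<bar>(x - y) \<bullet> i\<bar>) \<le> (\<Sum>i\<in>(Basis::'a set). h)" by (intro sum_mono)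
    with norm_le_l1[of "x - y"] show ?thesis by simp
  qed
  have c5: "R \<noteq> {}" "ball 0 1 \<subseteq> (\<Union>k\<in>R. A k)" by (auto simp: R_def A_def)
  have c6: "k = l" if "x \<in> A k" "x \<in> A l" for k l x using that by (auto simp: A_def)
  show ?thesis
    by (rule exI[of _ R], rule exI[of _ A]) (use c1 c2 c3 c4 c5 c6 in \<open>intro conjI allI ballI impI; fast\<close>)
qed

text \<open>The Poincare inequality on each cell, which follows by integrating \<open>(u x - u y)\<^sup>2\<close> over pairs of its points.\<close>

lemma rellich_inequality:
  fixes u :: "'a::euclidean_space \<Rightarrow> real"
  assumes u: "u \<in> energy_space s" and s: "0 < s" and zero: "AE x in lborel. x \<notin> ball 0 1 \<longrightarrow> u x = 0"
    and int: "integrable lborel (\<lambda>x. (u x)\<^sup>2)" and h: "0 < h"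
    and R: "finite R" and A: "\<And>k. A k \<in> sets borel"
      "\<And>k. k \<in> R \<Longrightarrow> emeasure lborel (A k) = ennreal (h ^ DIM('a))"
      "\<And>k l x. x \<in> A k \<Longrightarrow> x \<in> A l \<Longrightarrow> k = l" "ball 0 1 \<subseteq> (\<Union>k\<in>R. A k)"
      "\<And>k x y. x \<in> A k \<Longrightarrow> y \<in> A k \<Longrightarrow> norm (x - y) \<le> real DIM('a) * h"
  shows "2 * h ^ DIM('a) * (LINT x|lborel. (u x)\<^sup>2)
      \<le> (real DIM('a) * h) powr (real DIM('a) + 2 * s) * gagliardo s u u
        + 2 * (\<Sum>k\<in>R. (LINT x|lborel. indicator (A k) x * u x)\<^sup>2)"
    and "k \<in> R \<Longrightarrow> (LINT x|lborel. indicator (A k) x * u x)\<^sup>2 \<le> h ^ DIM('a) * (LINT x|lborel. (u x)\<^sup>2)"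
    and "k \<in> R \<Longrightarrow> integrable lborel (\<lambda>x. indicator (A k) x * u x)"
proof -
  have [measurable]: "u \<in> borel_measurable borel" using u by (rule energy_space_measurable)
  have [measurable]: "A k \<in> sets borel" for k by (rule A(1))
  define p where "p = real DIM('a) + 2 * s"
  define a where "a = h ^ DIM('a)"
  define c where "c = real DIM('a) * h"
  have c: "0 < c" using h by (simp add: c_def)
  have a: "0 < a" using h by (simp add: a_def)
  define m where "m k = (LINT x|lborel. indicator (A k) x * u x)" for k
  define q where "q k = (LINT x|lborel. indicator (A k) x * (u x)\<^sup>2)" for k
  have intA: "integrable lborel (indicator (A k) :: 'a \<Rightarrow> real)" "(LINT x|lborel. (indicator (A k) x :: real)) = a"
    if "k \<in> R" for k
  proof -
    show "integrable lborel (indicator (A k) :: 'a \<Rightarrow> real)"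
      using A(2)[OF that] by (intro integrable_real_indicator) auto
    show "(LINT x|lborel. (indicator (A k) x :: real)) = a"
      using A(2)[OF that] a by (simp add: measure_def a_def)
  qed
  have intq: "integrable lborel (\<lambda>x. indicator (A k) x * (u x)\<^sup>2)" for k
    by (rule Bochner_Integration.integrable_bound[OF int]) (auto simp: indicator_def)
  have intm: "integrable lborel (\<lambda>x. indicator (A k) x * u x)" if "k \<in> R" for k
  proof (rule Bochner_Integration.integrable_bound[OF Bochner_Integration.integrable_add[OF intA(1)[OF that] intq[of k]]])
    have "\<bar>t\<bar> \<le> 1 + t\<^sup>2" for t :: real
      using sum_squares_bound[of "\<bar>t\<bar>" 1] by (simp add: power2_eq_square)
    then show "AE x in lborel. norm (indicator (A k) x * u x) \<le> norm (indicator (A k) x + indicator (A k) x * (u x)\<^sup>2)"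
      by (auto simp: indicator_def)
  qed measurable
  \<comment> \<open>Expanding the square over a cell of volume \<open>a\<close> gives
    \<open>2 a q - 2 m^2\<close>, with \<open>m\<close> and \<open>q\<close> the integrals of
    \<open>u\<close> and \<open>u^2\<close> over it. Its nonnegativity is Cauchy-Schwarz and yields
    the second claim.\<close>
  have cell: "(\<integral>\<^sup>+x. \<integral>\<^sup>+y. ennreal (indicator (A k) x * indicator (A k) y * (u x - u y)\<^sup>2) \<partial>lborel \<partial>lborel)
      = ennreal (2 * a * q k - 2 * (m k)\<^sup>2)" "0 \<le> 2 * a * q k - 2 * (m k)\<^sup>2" if k: "k \<in> R" for k
  proof -
    note ik = intA[OF k] intm[OF k] intq[of k]
    have in1: "integrable lborel (\<lambda>y. indicator (A k) x * ((u x)\<^sup>2 * indicator (A k) y - 2 * u x * (indicator (A k) y * u y) + indicator (A k) y * (u y)\<^sup>2))" for x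
      using ik by (intro integrable_mult_right Bochner_Integration.integrable_add Bochner_Integration.integrable_diff) auto
    have eq1: "indicator (A k) x * indicator (A k) y * (u x - u y)\<^sup>2
        = indicator (A k) x * ((u x)\<^sup>2 * indicator (A k) y - 2 * u x * (indicator (A k) y * u y) + indicator (A k) y * (u y)\<^sup>2)" for x y
      by (simp add: indicator_def power2_eq_square algebra_simps)
    have val: "(LINT y|lborel. indicator (A k) x * indicator (A k) y * (u x - u y)\<^sup>2)
        = indicator (A k) x * ((u x)\<^sup>2 * a - 2 * u x * m k + q k)" for x
    proof -
      have "(LINT y|lborel. (u x)\<^sup>2 * indicator (A k) y - 2 * u x * (indicator (A k) y * u y) + indicator (A k) y * (u y)\<^sup>2)
        = (u x)\<^sup>2 * a - 2 * u x * m k + q k"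
        using ik by (simp add: m_def q_def)
      then show ?thesis unfolding eq1 by simp
    qed
    have nn: "0 \<le> indicator (A k) x * ((u x)\<^sup>2 * a - 2 * u x * m k + q k)" for x
      unfolding val[symmetric] by (intro Bochner_Integration.integral_nonneg) (auto simp: indicator_def)
    have eq2: "indicator (A k) x * ((u x)\<^sup>2 * a - 2 * u x * m k + q k)
        = a * (indicator (A k) x * (u x)\<^sup>2) - 2 * m k * (indicator (A k) x * u x) + q k * indicator (A k) x" for x
      by (simp add: algebra_simps)
    have in2: "integrable lborel (\<lambda>x. indicator (A k) x * ((u x)\<^sup>2 * a - 2 * u x * m k + q k))"
      unfolding eq2 using ik
      by (intro Bochner_Integration.integrable_add Bochner_Integration.integrable_diff integrable_mult_right)
    have val2: "(LINT x|lborel. indicator (A k) x * ((u x)\<^sup>2 * a - 2 * u x * m k + q k)) = 2 * a * q k - 2 * (m k)\<^sup>2"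
    proof -
      have "(LINT x|lborel. a * (indicator (A k) x * (u x)\<^sup>2) - 2 * m k * (indicator (A k) x * u x) + q k * indicator (A k) x)
        = a * q k - 2 * m k * m k + q k * a"
        using ik by (simp add: m_def q_def)
      then show ?thesis unfolding eq2 by (simp add: power2_eq_square algebra_simps)
    qed
    have "(\<integral>\<^sup>+y. ennreal (indicator (A k) x * indicator (A k) y * (u x - u y)\<^sup>2) \<partial>lborel)
        = ennreal (indicator (A k) x * ((u x)\<^sup>2 * a - 2 * u x * m k + q k))" for x
      unfolding val[symmetric]
      by (rule nn_integral_eq_integral) (use in1[of x] in \<open>auto simp: eq1[symmetric]\<close>)
    moreover have "(\<integral>\<^sup>+x. ennreal (indicator (A k) x * ((u x)\<^sup>2 * a - 2 * u x * m k + q k)) \<partial>lborel)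
        = ennreal (2 * a * q k - 2 * (m k)\<^sup>2)"
      unfolding val2[symmetric] by (rule nn_integral_eq_integral[OF in2]) (use nn in auto)
    ultimately show "(\<integral>\<^sup>+x. \<integral>\<^sup>+y. ennreal (indicator (A k) x * indicator (A k) y * (u x - u y)\<^sup>2) \<partial>lborel \<partial>lborel)
        = ennreal (2 * a * q k - 2 * (m k)\<^sup>2)" by simp
    show "0 \<le> 2 * a * q k - 2 * (m k)\<^sup>2"
      unfolding val2[symmetric] by (rule Bochner_Integration.integral_nonneg) (rule nn)
  qed
  have ind_sum: "(\<Sum>k\<in>R. indicator (A k) x * indicator (A k) y * t) = (if \<exists>k\<in>R. x \<in> A k \<and> y \<in> A k then t else 0)"
    for x y and t :: real
  proof (cases "\<exists>k\<in>R. x \<in> A k \<and> y \<in> A k")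
    case True
    then obtain k0 where k0: "k0 \<in> R" "x \<in> A k0" "y \<in> A k0" by auto
    then have "(\<Sum>k\<in>R. indicator (A k) x * indicator (A k) y * t) = (\<Sum>k\<in>R. if k = k0 then t else 0)"
      using A(3) by (intro sum.cong) (auto simp: indicator_def)
    with True k0 R show ?thesis by simp
  next
    case False
    then have "(\<Sum>k\<in>R. indicator (A k) x * indicator (A k) y * t) = 0"
      by (intro sum.neutral) (auto simp: indicator_def)
    with False show ?thesis by auto
  qed
  \<comment> \<open>Points of one cell are at distance at most \<open>c\<close>, so inserting the
    kernel costs the factor \<open>c powr p\<close>; pairs from different cells contribute nothing
    to the left side.\<close>
  have pw: "(\<Sum>k\<in>R. indicator (A k) x * indicator (A k) y * (u x - u y)\<^sup>2) \<le> c powr p * difference_kernel s u u (x, y)" for x y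
  proof -
    have "(u x - u y)\<^sup>2 \<le> c powr p * difference_kernel s u u (x, y)" if "k \<in> R" "x \<in> A k" "y \<in> A k" for k
    proof (cases "x = y")
      case False
      have "norm (x - y) powr p \<le> c powr p"
        using A(5)[OF that(2,3)] s by (intro powr_mono2) (auto simp: c_def p_def)
      then have "(u x - u y)\<^sup>2 * norm (x - y) powr p \<le> (u x - u y)\<^sup>2 * c powr p"
        by (intro mult_left_mono) auto
      then have "(u x - u y)\<^sup>2 \<le> (u x - u y)\<^sup>2 * c powr p / norm (x - y) powr p"
        using False by (simp add: pos_le_divide_eq)
      then show ?thesis by (simp add: difference_kernel_apply p_def power2_eq_square mult.commute)
    qed (simp add: difference_kernel_apply)
    moreover have "0 \<le> c powr p * difference_kernel s u u (x, y)" by simp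
    ultimately show ?thesis unfolding ind_sum by auto
  qed
  have "ennreal (\<Sum>k\<in>R. 2 * a * q k - 2 * (m k)\<^sup>2) = (\<Sum>k\<in>R. ennreal (2 * a * q k - 2 * (m k)\<^sup>2))"
    using cell(2) by (intro sum_ennreal[symmetric]) auto
  also have "\<dots> = (\<Sum>k\<in>R. (\<integral>\<^sup>+x. \<integral>\<^sup>+y. ennreal (indicator (A k) x * indicator (A k) y * (u x - u y)\<^sup>2) \<partial>lborel \<partial>lborel))"
    using cell(1) by (intro sum.cong) auto
  also have "\<dots> = (\<integral>\<^sup>+x. \<integral>\<^sup>+y. (\<Sum>k\<in>R. ennreal (indicator (A k) x * indicator (A k) y * (u x - u y)\<^sup>2)) \<partial>lborel \<partial>lborel)"
    by (subst nn_integral_sum, measurable, subst nn_integral_sum, measurable)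
  also have "\<dots> \<le> (\<integral>\<^sup>+x. \<integral>\<^sup>+y. ennreal (c powr p) * ennreal (difference_kernel s u u (x, y)) \<partial>lborel \<partial>lborel)"
  proof (intro nn_integral_mono)
    fix x y
    have "(\<Sum>k\<in>R. ennreal (indicator (A k) x * indicator (A k) y * (u x - u y)\<^sup>2))
        = ennreal (\<Sum>k\<in>R. indicator (A k) x * indicator (A k) y * (u x - u y)\<^sup>2)"
      by (intro sum_ennreal) (auto simp: indicator_def)
    also have "\<dots> \<le> ennreal (c powr p * difference_kernel s u u (x, y))" by (intro ennreal_leI pw)
    finally show "(\<Sum>k\<in>R. ennreal (indicator (A k) x * indicator (A k) y * (u x - u y)\<^sup>2))
        \<le> ennreal (c powr p) * ennreal (difference_kernel s u u (x, y))" by (simp add: ennreal_mult)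
  qed
  also have "\<dots> = ennreal (c powr p) * ennreal (gagliardo s u u)"
  proof -
    have 1: "(\<lambda>y. ennreal (difference_kernel s u u (x, y))) \<in> borel_measurable lborel" for x by measurable
    show ?thesis unfolding nn_integral_energy_iterated[OF u, symmetric]
      using 1 by (subst nn_integral_cmult, measurable)+
  qed
  also have "\<dots> = ennreal (c powr p * gagliardo s u u)" by (simp add: ennreal_mult gagliardo_nonneg)
  finally have main: "(\<Sum>k\<in>R. 2 * a * q k - 2 * (m k)\<^sup>2) \<le> c powr p * gagliardo s u u"
    by (subst (asm) ennreal_le_iff) (auto simp: gagliardo_nonneg)
  have "(\<Sum>k\<in>R. q k) = (LINT x|lborel. (\<Sum>k\<in>R. indicator (A k) x * (u x)\<^sup>2))"
    unfolding q_def using intq by (intro Bochner_Integration.integral_sum[symmetric])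
  also have "\<dots> = (LINT x|lborel. (u x)\<^sup>2)"
  proof (rule integral_cong_AE)
    show "AE x in lborel. (\<Sum>k\<in>R. indicator (A k) x * (u x)\<^sup>2) = (u x)\<^sup>2"
      using zero
    proof eventually_elim
      case (elim x)
      show ?case
      proof (cases "x \<in> ball 0 1")
        case True
        then have "\<exists>k\<in>R. x \<in> A k" using A(4) by auto
        with ind_sum[of x x "(u x)\<^sup>2"] show ?thesis by (simp add: indicator_inter_arith[symmetric])
      qed (use elim in simp)
    qed
  qed measurable
  finally have qsum: "(\<Sum>k\<in>R. q k) = (LINT x|lborel. (u x)\<^sup>2)" .
  show "2 * h ^ DIM('a) * (LINT x|lborel. (u x)\<^sup>2)
      \<le> (real DIM('a) * h) powr (real DIM('a) + 2 * s) * gagliardo s u u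
        + 2 * (\<Sum>k\<in>R. (LINT x|lborel. indicator (A k) x * u x)\<^sup>2)"
    using main unfolding qsum[symmetric] a_def[symmetric] c_def[symmetric] p_def[symmetric] m_def[symmetric]
    by (simp add: sum_subtractf sum_distrib_left)
  show "(LINT x|lborel. indicator (A k) x * u x)\<^sup>2 \<le> h ^ DIM('a) * (LINT x|lborel. (u x)\<^sup>2)" if "k \<in> R"
  proof -
    have "q k \<le> (LINT x|lborel. (u x)\<^sup>2)"
      unfolding q_def by (intro integral_mono intq int) (auto simp: indicator_def)
    then have "a * q k \<le> a * (LINT x|lborel. (u x)\<^sup>2)" using a by simp
    with cell(2)[OF that] show ?thesis by (simp add: m_def a_def)
  qed
  show "integrable lborel (\<lambda>x. indicator (A k) x * u x)" if "k \<in> R" by (rule intm[OF that])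
qed

interpretation gagliardo: semi_inner_form "energy_space s" "gagliardo s"
  by (rule semi_inner_form_gagliardo)

lemma compact_PiE_UNIV:
  fixes S :: "'i \<Rightarrow> 'b::topological_space set"
  assumes "\<And>i. compact (S i)"
  shows "compact (PiE UNIV S)"
proof -
  have "compactin (product_topology (\<lambda>i::'i. euclidean :: 'b topology) UNIV) (PiE UNIV S)"
    using assms by (simp add: compactin_PiE)
  then show ?thesis by (simp add: euclidean_product_topology)
qed

lemma tendsto_fun_coordinate:
  fixes f :: "nat \<Rightarrow> 'i \<Rightarrow> 'b::topological_space"
  assumes "f \<longlonglongrightarrow> l"
  shows "(\<lambda>n. f n i) \<longlonglongrightarrow> l i"
  using continuous_on_tendsto_compose[OF continuous_on_product_coordinates[of i] assms] by simp

text \<open>A subsequence is chosen along which the integrals over all cells of all grids converge.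
  For a given accuracy a fine grid makes the energy term of \<open>rellich_inequality\<close> small,
  and on that grid the finitely many cell integrals are Cauchy.\<close>

lemma rellich_sequence:
  fixes f :: "nat \<Rightarrow> 'a::euclidean_space \<Rightarrow> real"
  assumes f: "\<And>n. f n \<in> energy_space s" and s: "0 < s"
    and zero: "\<And>n. AE x in lborel. x \<notin> ball 0 1 \<longrightarrow> f n x = 0"
    and bound: "\<And>n. gagliardo s (f n) (f n) \<le> D"
  shows "\<exists>r::nat\<Rightarrow>nat. strict_mono r \<and>
    (\<forall>e>0. \<exists>M. \<forall>m\<ge>M. \<forall>n\<ge>M. (LINT x|lborel. (f (r m) x - f (r n) x)\<^sup>2) < e)"
proof -
  define N where "N = DIM('a)"
  define h where "h j = 1 / real (Suc j)" for j
  have h: "0 < h j" "h j \<le> 1" for j by (auto simp: h_def)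
  have "\<exists>(R :: 'a set) (A :: 'a \<Rightarrow> 'a set). finite R \<and> R \<noteq> {} \<and> (\<forall>k. A k \<in> sets borel) \<and>
    (\<forall>k\<in>R. emeasure lborel (A k) = ennreal (h j ^ N)) \<and>
    (\<forall>k l x. x \<in> A k \<longrightarrow> x \<in> A l \<longrightarrow> k = l) \<and> ball 0 1 \<subseteq> (\<Union>k\<in>R. A k) \<and>
    (\<forall>k x y. x \<in> A k \<longrightarrow> y \<in> A k \<longrightarrow> norm (x - y) \<le> real N * h j)" for j
    unfolding N_def by (rule grid_cells[OF h(1)])
  then obtain R :: "nat \<Rightarrow> 'a set" and A :: "nat \<Rightarrow> 'a \<Rightarrow> 'a set" where
    R: "\<And>j. finite (R j)" "\<And>j. R j \<noteq> {}" and A: "\<And>j k. A j k \<in> sets borel"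
      "\<And>j k. k \<in> R j \<Longrightarrow> emeasure lborel (A j k) = ennreal (h j ^ N)"
      "\<And>j k l x. x \<in> A j k \<Longrightarrow> x \<in> A j l \<Longrightarrow> k = l" "\<And>j. ball 0 1 \<subseteq> (\<Union>k\<in>R j. A j k)"
      "\<And>j k x y. x \<in> A j k \<Longrightarrow> y \<in> A j k \<Longrightarrow> norm (x - y) \<le> real N * h j"
    by metis
  have rel1: "2 * h j ^ N * (LINT x|lborel. (u x)\<^sup>2)
      \<le> (real N * h j) powr (real N + 2 * s) * gagliardo s u u
        + 2 * (\<Sum>k\<in>R j. (LINT x|lborel. indicator (A j k) x * u x)\<^sup>2)"
    if "u \<in> energy_space s" "AE x in lborel. x \<notin> ball 0 1 \<longrightarrow> u x = 0" "integrable lborel (\<lambda>x. (u x)\<^sup>2)" for u j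
    unfolding N_def by (rule rellich_inequality(1)[where h = "h j" and R = "R j" and A = "A j"])
      (fact that s h R A(1) A(2)[unfolded N_def] A(3) A(4) A(5)[unfolded N_def])+
  have rel2: "(LINT x|lborel. indicator (A j k) x * u x)\<^sup>2 \<le> h j ^ N * (LINT x|lborel. (u x)\<^sup>2)"
    if "u \<in> energy_space s" "AE x in lborel. x \<notin> ball 0 1 \<longrightarrow> u x = 0" "integrable lborel (\<lambda>x. (u x)\<^sup>2)" "k \<in> R j" for u j k
    unfolding N_def by (rule rellich_inequality(2)[where h = "h j" and R = "R j" and A = "A j"])
      (fact that s h R A(1) A(2)[unfolded N_def] A(3) A(4) A(5)[unfolded N_def])+
  have rel3: "integrable lborel (\<lambda>x. indicator (A j k) x * u x)"
    if "u \<in> energy_space s" "AE x in lborel. x \<notin> ball 0 1 \<longrightarrow> u x = 0" "integrable lborel (\<lambda>x. (u x)\<^sup>2)" "k \<in> R j" for u j k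
    by (rule rellich_inequality(3)[where h = "h j" and R = "R j" and A = "A j"])
      (fact that s h R A(1) A(2)[unfolded N_def] A(3) A(4) A(5)[unfolded N_def])+
  define c where "c = poincare_constant TYPE('a) s"
  have c: "0 < c" unfolding c_def by (rule poincare_constant_pos)
  have "0 \<le> D" using gagliardo_nonneg[of s "f 0"] bound[of 0] by simp
  note int = poincare(1)[OF f s zero]
  have L2: "(LINT x|lborel. (f n x)\<^sup>2) \<le> c * D" for n
  proof -
    have "(LINT x|lborel. (f n x)\<^sup>2) \<le> c * gagliardo s (f n) (f n)"
      unfolding c_def by (rule poincare(2)[OF f s zero])
    also have "\<dots> \<le> c * D" using c bound by (intro mult_left_mono) auto
    finally show ?thesis .
  qed
  define b where "b = sqrt (c * D)"
  \<comment> \<open>All cell integrals of all grids form one point of a product of intervals over a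
    countable index set; compactness of the product replaces a diagonal argument.\<close>
  define \<phi> where "\<phi> n = (\<lambda>(j, i). LINT x|lborel. indicator (A j (from_nat_into (R j) i)) x * f n x)" for n
  have "\<phi> n \<in> PiE UNIV (\<lambda>_. {-b..b})" for n
  proof -
    have "\<phi> n (j, i) \<in> {-b..b}" for j i
    proof -
      have "(\<phi> n (j, i))\<^sup>2 \<le> h j ^ N * (LINT x|lborel. (f n x)\<^sup>2)"
        using rel2[OF f zero int from_nat_into[OF R(2)]] by (simp add: \<phi>_def N_def)
      also have "\<dots> \<le> 1 * (c * D)"
        using h[of j] L2 by (intro mult_mono power_le_one) auto
      finally have "\<bar>\<phi> n (j, i)\<bar> \<le> b" unfolding b_def by (intro real_le_rsqrt) simp
      then show ?thesis by auto
    qed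
    then show ?thesis by auto
  qed
  moreover have "seq_compact (PiE (UNIV :: (nat \<times> nat) set) (\<lambda>_. {-b..b}))"
    by (intro compact_imp_seq_compact compact_PiE_UNIV) simp
  ultimately obtain l r where r: "strict_mono (r :: nat \<Rightarrow> nat)" "(\<phi> \<circ> r) \<longlonglongrightarrow> l"
    by (metis seq_compactE)
  have lim: "(\<lambda>n. LINT x|lborel. indicator (A j k) x * f (r n) x) \<longlonglongrightarrow> l (j, to_nat_on (R j) k)"
    if "k \<in> R j" for j k
    using tendsto_fun_coordinate[OF r(2), of "(j, to_nat_on (R j) k)"] that R(1)[of j]
    by (simp add: \<phi>_def countable_finite)
  have "\<exists>M. \<forall>m\<ge>M. \<forall>n\<ge>M. (LINT x|lborel. (f (r m) x - f (r n) x)\<^sup>2) < e" if e: "0 < e" for e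
  proof -
    define p where "p = real DIM('a) + 2 * s"
    \<comment> \<open>A bound for the energy term after division by \<open>2 h^N\<close>:
      differences have energy at most \<open>4 D\<close>, and \<open>p - N = 2 s\<close>.\<close>
    have "(\<lambda>j. 2 * D * real N powr p * h j powr (2 * s)) \<longlonglongrightarrow> 2 * D * real N powr p * 0"
    proof (intro tendsto_mult tendsto_const)
      have "h \<longlonglongrightarrow> 0" unfolding h_def by (intro LIMSEQ_Suc[OF lim_1_over_n])
      then show "(\<lambda>j. h j powr (2 * s)) \<longlonglongrightarrow> 0"
        using s h by (intro tendsto_zero_powrI[where b = "2 * s"]) (auto intro!: always_eventually less_imp_le)
    qed
    then have "\<forall>\<^sub>F j in sequentially. 2 * D * real N powr p * h j powr (2 * s) < e / 2"
      using e by (intro order_tendstoD(2)[where a = "e / 2"]) auto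
    then obtain j where j: "2 * D * real N powr p * h j powr (2 * s) < e / 2"
      by (auto simp: eventually_sequentially)
    \<comment> \<open>Chosen so that the squares of \<open>card (R j)\<close> cell errors of this
      size add up to less than \<open>e / 2\<close> times the cell volume.\<close>
    define \<delta> where "\<delta> = sqrt (e / 2 * h j ^ N / (real (card (R j)) + 1))"
    have \<delta>: "0 < \<delta>" using e h[of j] by (simp add: \<delta>_def)
    have "\<forall>\<^sub>F n in sequentially. \<forall>k\<in>R j.
        \<bar>(LINT x|lborel. indicator (A j k) x * f (r n) x) - l (j, to_nat_on (R j) k)\<bar> < \<delta> / 2"
      using R(1) \<delta> by (intro eventually_ball_finite ballI) (auto dest: tendstoD[OF lim, where e="\<delta>/2"] simp: dist_real_def)
    then obtain M where M: "\<And>n k. n \<ge> M \<Longrightarrow> k \<in> R j \<Longrightarrow>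
        \<bar>(LINT x|lborel. indicator (A j k) x * f (r n) x) - l (j, to_nat_on (R j) k)\<bar> < \<delta> / 2"
      by (auto simp: eventually_sequentially)
    have "(LINT x|lborel. (f (r m) x - f (r n) x)\<^sup>2) < e" if mn: "m \<ge> M" "n \<ge> M" for m n
    proof -
      define g where "g = f (r m) - f (r n)"
      have g: "g \<in> energy_space s" unfolding g_def using f by (intro gagliardo.in_V)
      have gz: "AE x in lborel. x \<notin> ball 0 1 \<longrightarrow> g x = 0"
        using zero[of "r m"] zero[of "r n"] by eventually_elim (simp add: g_def)
      have gE: "gagliardo s g g \<le> 4 * D"
        using gagliardo.parallelogram[OF f f, of "r m" "r n"] bound[of "r m"] bound[of "r n"]
          gagliardo_nonneg[of s "f (r m) + f (r n)"] by (simp add: g_def)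
      have gi: "(LINT x|lborel. indicator (A j k) x * g x)\<^sup>2 \<le> \<delta>\<^sup>2" if "k \<in> R j" for k
      proof -
        have "(LINT x|lborel. indicator (A j k) x * g x) =
          (LINT x|lborel. indicator (A j k) x * f (r m) x) - (LINT x|lborel. indicator (A j k) x * f (r n) x)"
          using rel3[OF f zero int that] by (simp add: g_def right_diff_distrib)
        with M[OF mn(1) that] M[OF mn(2) that]
        have "\<bar>LINT x|lborel. indicator (A j k) x * g x\<bar> \<le> \<bar>\<delta>\<bar>" by linarith
        then show ?thesis by (simp only: abs_le_square_iff)
      qed
      have "2 * h j ^ N * (LINT x|lborel. (g x)\<^sup>2)
          \<le> (real N * h j) powr p * gagliardo s g g + 2 * (\<Sum>k\<in>R j. (LINT x|lborel. indicator (A j k) x * g x)\<^sup>2)"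
        unfolding p_def N_def[symmetric] by (rule rel1[OF g gz poincare(1)[OF g s gz]])
      also have "\<dots> \<le> (real N * h j) powr p * (4 * D) + 2 * (\<Sum>k\<in>R j. \<delta>\<^sup>2)"
        using gE gi by (intro add_mono mult_left_mono sum_mono) auto
      also have "(real N * h j) powr p = real N powr p * h j powr (2 * s) * h j ^ N"
        using h(1)[of j] by (simp add: powr_mult p_def powr_add N_def powr_realpow)
      also have "(\<Sum>k\<in>R j. \<delta>\<^sup>2) < e / 2 * h j ^ N"
        using e h(1)[of j] by (simp add: \<delta>_def field_simps)
      finally have "2 * h j ^ N * (LINT x|lborel. (g x)\<^sup>2)
          < 2 * h j ^ N * (2 * D * real N powr p * h j powr (2 * s) + e / 2)"
        by (simp add: algebra_simps)
      then have "(LINT x|lborel. (g x)\<^sup>2) < 2 * D * real N powr p * h j powr (2 * s) + e / 2"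
        using h(1)[of j] by (simp add: mult_less_cancel_left)
      with j show ?thesis by (simp add: g_def)
    qed
    then show ?thesis by blast
  qed
  with r(1) show ?thesis by blast
qed

section \<open>Smooth functions\<close>

lemma Ck_function_SucI:
  assumes "\<And>x. (f has_derivative f' x) (at x)" "\<And>v. Ck_function k (\<lambda>x. f' x v)"
  shows "Ck_function (Suc k) f"
proof -
  have "frechet_derivative f (at x) = f' x" for x
    using frechet_derivative_at[OF assms(1)[of x]] by simp
  with assms show ?thesis by (auto simp: differentiable_def)
qed

lemma Ck_function_SucE:
  assumes "Ck_function (Suc k) f"
  obtains f' where "\<And>x. (f has_derivative f' x) (at x)" "\<And>v. Ck_function k (\<lambda>x. f' x v)"
  using assms that[of "\<lambda>x. frechet_derivative f (at x)"] by (simp add: frechet_derivative_works)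

lemma Ck_function_Suc_imp: "Ck_function (Suc k) f \<Longrightarrow> Ck_function k f"
proof (induction k arbitrary: f)
  case 0
  then show ?case by (auto intro!: differentiable_imp_continuous_on simp: differentiable_on_def differentiable_at_withinI)
next
  case (Suc k)
  from Suc.prems obtain f' where "\<And>x. (f has_derivative f' x) (at x)" "\<And>v. Ck_function (Suc k) (\<lambda>x. f' x v)"
    by (rule Ck_function_SucE) blast
  with Suc.IH show ?case by (intro Ck_function_SucI) auto
qed

lemma Ck_function_const [simp]: "Ck_function k (\<lambda>_. c)"
proof (induction k arbitrary: c)
  case (Suc k)
  then show ?case by (intro Ck_function_SucI[where f' = "\<lambda>x v. 0"]) (auto intro: derivative_eq_intros)
qed simp

lemma Ck_function_add: "Ck_function k f \<Longrightarrow> Ck_function k g \<Longrightarrow> Ck_function k (\<lambda>x. f x + g x)"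
proof (induction k arbitrary: f g)
  case (Suc k)
  from Suc.prems(1) obtain f' where f': "\<And>x. (f has_derivative f' x) (at x)" "\<And>v. Ck_function k (\<lambda>x. f' x v)"
    by (rule Ck_function_SucE) blast
  from Suc.prems(2) obtain g' where g': "\<And>x. (g has_derivative g' x) (at x)" "\<And>v. Ck_function k (\<lambda>x. g' x v)"
    by (rule Ck_function_SucE) blast
  show ?case
    by (rule Ck_function_SucI[where f' = "\<lambda>x v. f' x v + g' x v"])
       (use f' g' Suc.IH in \<open>auto intro: has_derivative_add\<close>)
qed (auto intro: continuous_intros)

lemma Ck_function_mult: "Ck_function k f \<Longrightarrow> Ck_function k g \<Longrightarrow> Ck_function k (\<lambda>x. f x * g x)"
proof (induction k arbitrary: f g)
  case (Suc k)
  from Suc.prems(1) obtain f' where f': "\<And>x. (f has_derivative f' x) (at x)" "\<And>v. Ck_function k (\<lambda>x. f' x v)"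
    by (rule Ck_function_SucE) blast
  from Suc.prems(2) obtain g' where g': "\<And>x. (g has_derivative g' x) (at x)" "\<And>v. Ck_function k (\<lambda>x. g' x v)"
    by (rule Ck_function_SucE) blast
  note fg = Suc.prems[THEN Ck_function_Suc_imp]
  show ?case
    by (rule Ck_function_SucI[where f' = "\<lambda>x v. f x * g' x v + f' x v * g x"])
       (use f' g' fg Suc.IH in \<open>auto intro: has_derivative_mult Ck_function_add\<close>)
qed (auto intro: continuous_intros)

lemma Ck_function_linear: "bounded_linear f \<Longrightarrow> Ck_function k f"
proof (cases k)
  case 0
  then show "bounded_linear f \<Longrightarrow> Ck_function k f" by (simp add: linear_continuous_on)
next
  case (Suc n)
  then show "bounded_linear f \<Longrightarrow> Ck_function k f"
    by (auto intro!: Ck_function_SucI[where f' = "\<lambda>x. f"] bounded_linear_imp_has_derivative simp del: Ck_function.simps)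
qed

lemma Ck_function_compose:
  fixes g :: "real \<Rightarrow> real"
  shows "Ck_function k g \<Longrightarrow> Ck_function k f \<Longrightarrow> Ck_function k (\<lambda>x. g (f x))"
proof (induction k arbitrary: f g)
  case 0
  then show ?case by (auto intro: continuous_on_compose2)
next
  case (Suc k)
  from Suc.prems(1) obtain g' where g': "\<And>x. (g has_derivative g' x) (at x)" "\<And>v. Ck_function k (\<lambda>x. g' x v)"
    by (rule Ck_function_SucE) blast
  from Suc.prems(2) obtain f' where f': "\<And>x. (f has_derivative f' x) (at x)" "\<And>v. Ck_function k (\<lambda>x. f' x v)"
    by (rule Ck_function_SucE) blast
  \<comment> \<open>A derivative on the line is determined by its value in direction 1, so the
    derivative of the composite is a product to which the induction hypothesis applies.\<close>
  have lin: "g' y t = t * g' y 1" for y t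
    using linear_scale[OF has_derivative_linear[OF g'(1)[of y]], of t 1] by simp
  show ?case
  proof (rule Ck_function_SucI[where f' = "\<lambda>x v. f' x v * g' (f x) 1"])
    show "((\<lambda>x. g (f x)) has_derivative (\<lambda>v. f' x v * g' (f x) 1)) (at x)" for x
      using has_derivative_compose[OF f'(1) g'(1), of x] by (subst lin[symmetric])
    show "Ck_function k (\<lambda>x. f' x v * g' (f x) 1)" for v
      using f'(2) Suc.IH[OF g'(2) Ck_function_Suc_imp[OF Suc.prems(2)]] by (intro Ck_function_mult)
  qed
qed

lemma Ck_function_compose_affine:
  assumes T: "bounded_linear T"
  shows "Ck_function k f \<Longrightarrow> Ck_function k (\<lambda>x. f (a + T x))"
proof (induction k arbitrary: f)
  case 0
  have "continuous_on UNIV (\<lambda>x. a + T x)" by (intro continuous_intros linear_continuous_on T)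
  with 0 show ?case by (auto intro: continuous_on_compose2)
next
  case (Suc k)
  from Suc.prems obtain f' where f': "\<And>x. (f has_derivative f' x) (at x)" "\<And>v. Ck_function k (\<lambda>x. f' x v)"
    by (rule Ck_function_SucE) blast
  have D: "((\<lambda>x. a + T x) has_derivative T) (at x)" for x
    using has_derivative_add[OF has_derivative_const[of a] bounded_linear_imp_has_derivative[OF T]] by simp
  show ?case
    by (rule Ck_function_SucI[where f' = "\<lambda>x v. f' (a + T x) (T v)"])
       (use has_derivative_compose[OF D f'(1)] Suc.IH[OF f'(2)] in auto)
qed

text \<open>Differentiation stays inside the span of this family, so the induction on
  \<open>k\<close> closes when \<open>i\<close> and \<open>p\<close> are kept general. The case
  \<open>i = 0\<close>, \<open>p = 1/2\<close> is \<open>smooth_abs\<close> up to a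
  constant.\<close>

lemma Ck_function_sqrt_family:
  fixes c :: real
  assumes "0 < c"
  shows "Ck_function k (\<lambda>t::real. t ^ i * (t\<^sup>2 + c) powr p)"
proof (induction k arbitrary: i p)
  case 0
  have "t\<^sup>2 + c \<noteq> 0" for t :: real using assms by (smt (verit) zero_le_power2)
  then show ?case by (auto intro!: continuous_intros)
next
  case (Suc k)
  have pos: "0 < t\<^sup>2 + c" for t :: real using assms by (smt (verit) zero_le_power2)
  show ?case
  proof (rule Ck_function_SucI)
    show "((\<lambda>t. t ^ i * (t\<^sup>2 + c) powr p) has_derivative
        (\<lambda>v. v * (real i * (t ^ (i - 1) * (t\<^sup>2 + c) powr p) + 2 * p * (t ^ Suc i * (t\<^sup>2 + c) powr (p - 1))))) (at t)" for t :: real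
    proof -
      have "((\<lambda>t. t ^ i * (t\<^sup>2 + c) powr p) has_real_derivative
        (real i * (t ^ (i - 1) * (t\<^sup>2 + c) powr p) + 2 * p * (t ^ Suc i * (t\<^sup>2 + c) powr (p - 1)))) (at t)"
        using pos[of t] by (auto intro!: derivative_eq_intros simp: algebra_simps)
      then show ?thesis unfolding has_field_derivative_def by (rule has_derivative_eq_rhs) (simp add: fun_eq_iff)
    qed
    show "Ck_function k (\<lambda>t::real. v * (real i * (t ^ (i - 1) * (t\<^sup>2 + c) powr p) + 2 * p * (t ^ Suc i * (t\<^sup>2 + c) powr (p - 1))))" for v
      by (intro Ck_function_mult Ck_function_add Ck_function_const Suc.IH)
  qed
qed

text \<open>A smooth absolute value that vanishes at zero: composing with it preserves the support, so
  truncations of smooth functions need not be mollified.\<close>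

definition smooth_abs :: "real \<Rightarrow> real \<Rightarrow> real" where
  "smooth_abs c t = sqrt (t\<^sup>2 + c\<^sup>2) - c"

lemma Ck_function_smooth_abs: "0 < c \<Longrightarrow> Ck_function k (smooth_abs c)"
proof -
  assume c: "0 < c"
  have "smooth_abs c = (\<lambda>t. t ^ 0 * (t\<^sup>2 + c\<^sup>2) powr (1/2) + (- c))"
    by (auto simp: smooth_abs_def fun_eq_iff powr_half_sqrt)
  then show ?thesis
    using Ck_function_add[OF Ck_function_sqrt_family[of "c\<^sup>2" k 0 "1/2"] Ck_function_const[of k "- c"]] c by simp
qed

lemma smooth_abs_0 [simp]: "0 < c \<Longrightarrow> smooth_abs c 0 = 0"
  by (simp add: smooth_abs_def)

lemma smooth_abs_Lipschitz: "\<bar>smooth_abs c a - smooth_abs c b\<bar> \<le> \<bar>a - b\<bar>"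
  using norm_triangle_ineq3[of "Complex a c" "Complex b c"]
  by (simp add: smooth_abs_def cmod_def)

lemma smooth_abs_diff: "0 \<le> c \<Longrightarrow> \<bar>smooth_abs c t - \<bar>t\<bar>\<bar> \<le> c"
proof -
  assume c: "0 \<le> c"
  have "\<bar>t\<bar> \<le> sqrt (t\<^sup>2 + c\<^sup>2)" by simp
  moreover have "sqrt (t\<^sup>2 + c\<^sup>2) \<le> \<bar>t\<bar> + c" using sqrt_sum_squares_le_sum_abs[of t c] c by simp
  ultimately show ?thesis by (auto simp: smooth_abs_def abs_le_iff)
qed

text \<open>For \<open>m = 0\<close> the classical smooth function that vanishes on a half line. The
  powers in the denominator make the family stable under differentiation: the derivative combines
  the members \<open>m + 1\<close> and \<open>m + 2\<close>.\<close>

definition flat_exp :: "nat \<Rightarrow> real \<Rightarrow> real" where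
  "flat_exp m t = (if 0 < t then exp (- (1 / t)) / t ^ m else 0)"

lemma flat_exp_tendsto: "(flat_exp m \<longlongrightarrow> 0) (at 0)"
proof -
  have "((\<lambda>t. exp (- (1 / t)) / t ^ m) \<longlongrightarrow> 0) (at_right (0::real))"
    by real_asymp
  then have "(flat_exp m \<longlongrightarrow> 0) (at_right 0)"
    by (rule Lim_transform_eventually) (auto simp: flat_exp_def eventually_at_filter)
  moreover have "(flat_exp m \<longlongrightarrow> 0) (at_left 0)"
    by (rule Lim_transform_eventually[OF tendsto_const]) (auto simp: flat_exp_def eventually_at_filter)
  ultimately show ?thesis by (simp add: filterlim_split_at)
qed

lemma flat_exp_has_derivative:
  "(flat_exp m has_real_derivative (flat_exp (m + 2) t - real m * flat_exp (m + 1) t)) (at t)"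
proof (cases t "0::real" rule: linorder_cases)
  case less
  have "((\<lambda>t. 0) has_real_derivative 0) (at t)" by simp
  then have "(flat_exp m has_real_derivative 0) (at t)"
    by (rule has_field_derivative_transform_within_open[where S = "{..<0}"]) (use less in \<open>auto simp: flat_exp_def\<close>)
  with less show ?thesis by (simp add: flat_exp_def)
next
  case equal
  \<comment> \<open>The difference quotient at 0 is \<open>flat_exp (Suc m)\<close>, which tends to
    0.\<close>
  have "((\<lambda>h. flat_exp m h / h) \<longlongrightarrow> 0) (at 0)"
    using flat_exp_tendsto[of "Suc m"]
    by (rule Lim_transform_eventually) (auto simp: flat_exp_def eventually_at_filter)
  with equal show ?thesis by (simp add: DERIV_def flat_exp_def)
next
  case greater
  have "((\<lambda>t. exp (- (1 / t)) / t ^ m) has_real_derivative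
      (flat_exp (m + 2) t - real m * flat_exp (m + 1) t)) (at t)"
  proof -
    have 1: "((\<lambda>t. exp (- (1 / t))) has_real_derivative exp (- (1 / t)) / t\<^sup>2) (at t)"
      using greater by (auto intro!: derivative_eq_intros simp: power2_eq_square)
    have 2: "((\<lambda>t. t ^ m) has_real_derivative real m * t ^ (m - Suc 0)) (at t)" by (rule DERIV_pow)
    have "(exp (- (1 / t)) / t\<^sup>2 * t ^ m - exp (- (1 / t)) * (real m * t ^ (m - Suc 0))) / (t ^ m * t ^ m)
        = flat_exp (m + 2) t - real m * flat_exp (m + 1) t"
      using greater by (cases m) (simp_all add: flat_exp_def power2_eq_square field_simps)
    with DERIV_divide[OF 1 2] greater show ?thesis by simp
  qed
  then show ?thesis
    by (rule has_field_derivative_transform_within_open[where S = "{0<..}"]) (use greater in \<open>auto simp: flat_exp_def\<close>)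
qed

lemma Ck_function_flat_exp: "Ck_function k (flat_exp m)"
proof (induction k arbitrary: m)
  case 0
  then show ?case
    using flat_exp_has_derivative by (auto intro!: continuous_at_imp_continuous_on DERIV_isCont)
next
  case (Suc k)
  show ?case
  proof (rule Ck_function_SucI)
    show "(flat_exp m has_derivative (\<lambda>v. v * (flat_exp (m + 2) t + (- real m) * flat_exp (m + 1) t))) (at t)" for t
      using flat_exp_has_derivative[of m t] unfolding has_field_derivative_def
      by (rule has_derivative_eq_rhs) (simp add: fun_eq_iff)
    show "Ck_function k (\<lambda>t. v * (flat_exp (m + 2) t + (- real m) * flat_exp (m + 1) t))" for v
      by (intro Ck_function_mult Ck_function_add Ck_function_const Suc.IH)
  qed
qed

text \<open>The squared norm keeps the argument polynomial, hence smooth at the centre. For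
  \<open>r > 0\<close> the function is positive exactly on the open ball.\<close>

definition bump :: "'a::euclidean_space \<Rightarrow> real \<Rightarrow> 'a \<Rightarrow> real" where
  "bump a r x = flat_exp 0 (r\<^sup>2 - (norm (x - a))\<^sup>2)"

lemma bump_nonneg: "0 \<le> bump a r x"
  by (simp add: bump_def flat_exp_def)

lemma bump_pos_iff: "0 < r \<Longrightarrow> 0 < bump a r x \<longleftrightarrow> x \<in> ball a r"
  by (auto simp: bump_def flat_exp_def dist_norm norm_minus_commute power_strict_mono dest: power_less_imp_less_base)

lemma bump_eq_0_iff: "0 < r \<Longrightarrow> bump a r x = 0 \<longleftrightarrow> x \<notin> ball a r"
  using bump_pos_iff[of r a x] bump_nonneg[of a r x] by auto

lemma Ck_function_bump: "Ck_function k (bump a r)"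
proof -
  have lin: "Ck_function k (\<lambda>x. (x - a) \<bullet> i)" for i :: 'a
    using Ck_function_add[OF Ck_function_linear[OF bounded_linear_inner_left[of i]] Ck_function_const[of k "- (a \<bullet> i)"]]
    by (simp add: inner_diff_left)
  have sum: "Ck_function k (\<lambda>x. \<Sum>i\<in>I. (- 1) * (((x - a) \<bullet> i) * ((x - a) \<bullet> i)))" for I :: "'a set"
  proof (induction I rule: infinite_finite_induct)
    case (insert i I)
    show ?case unfolding sum.insert[OF insert.hyps] by (intro insert.IH Ck_function_add Ck_function_mult lin Ck_function_const)
  qed auto
  have eq: "r\<^sup>2 - (norm (x - a))\<^sup>2 = r\<^sup>2 + (\<Sum>i\<in>Basis. (- 1) * (((x - a) \<bullet> i) * ((x - a) \<bullet> i)))" for x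
    by (simp add: sum_negf power2_norm_eq_inner euclidean_inner[of "x - a" "x - a"])
  have "Ck_function k (\<lambda>x. r\<^sup>2 - (norm (x - a))\<^sup>2)"
    unfolding eq using Ck_function_add[OF Ck_function_const[of k "r\<^sup>2"] sum[of Basis]] .
  from Ck_function_compose[OF Ck_function_flat_exp[of k 0] this] show ?thesis
    by (simp add: bump_def[abs_def])
qed

lemma bump_smooth:
  assumes "0 < r" "cball a r \<subseteq> \<Omega>"
  shows "bump a r \<in> smooth_compact_support \<Omega>"
proof -
  have "{x. bump a r x \<noteq> 0} = ball a r"
    by (rule set_eqI) (unfold mem_Collect_eq bump_eq_0_iff[OF assms(1)], simp)
  then have "closure {x. bump a r x \<noteq> 0} = cball a r" by (simp only: closure_ball[OF assms(1)])
  then show ?thesis using assms(2)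
    unfolding smooth_compact_support_def by (intro CollectI conjI allI Ck_function_bump) simp_all
qed

lemma ball_in_sets_borel [measurable]: "ball (x::'a::metric_space) r \<in> sets borel"
  by simp

text \<open>The derivative in each basis direction is continuous and vanishes off the compact
  support, hence is bounded; the mean value inequality does the rest. This is what gives test
  functions finite energy.\<close>

lemma smooth_compact_support_Lipschitz:
  assumes f: "f \<in> smooth_compact_support \<Omega>"
  shows "\<exists>L\<ge>0. \<forall>x y. \<bar>f x - f y\<bar> \<le> L * norm (x - y)"
proof -
  define K where "K = closure {x. f x \<noteq> 0}"
  have K: "compact K" using f by (simp add: smooth_compact_support_def K_def)
  have "Ck_function (Suc 0) f" using f unfolding smooth_compact_support_def by blast
  then obtain f' where f': "\<And>x. (f has_derivative f' x) (at x)" "\<And>v. Ck_function 0 (\<lambda>x. f' x v)"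
    by (rule Ck_function_SucE) blast
  have zero: "f' x = (\<lambda>_. 0)" if "x \<notin> K" for x
  proof -
    have "(f has_derivative (\<lambda>_. 0)) (at x)"
    proof (rule has_derivative_transform_within_open[where f = "\<lambda>_. 0" and s = "- K"])
      show "open (- K)" by (simp add: K_def open_Compl)
      show "0 = f y" if "y \<in> - K" for y
        using that closure_subset[of "{x. f x \<noteq> 0}"] by (auto simp: K_def)
    qed (use that in auto)
    with f'(1)[of x] show ?thesis by (rule has_derivative_unique)
  qed
  have "\<exists>M. \<forall>x. \<bar>f' x i\<bar> \<le> M" for i
  proof -
    have "compact ((\<lambda>x. f' x i) ` K)"
      using f'(2)[of i] K by (intro compact_continuous_image) (auto intro: continuous_on_subset)
    then have "bounded ((\<lambda>x. f' x i) ` K)" by (rule compact_imp_bounded)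
    then obtain M where M: "\<forall>x\<in>K. \<bar>f' x i\<bar> \<le> M" unfolding bounded_iff by auto
    have "\<bar>f' x i\<bar> \<le> max M 0" for x
      using M zero[of x] by (cases "x \<in> K") (auto simp: le_max_iff_disj)
    then show ?thesis by blast
  qed
  then obtain M where M: "\<And>i x. \<bar>f' x i\<bar> \<le> M i" by metis
  define L where "L = (\<Sum>i\<in>Basis. M i)"
  have M0: "0 \<le> M i" for i using M[of undefined i] by linarith
  have L0: "0 \<le> L" unfolding L_def by (intro sum_nonneg M0)
  have "norm (f' x v) \<le> L * norm v" for x v
  proof -
    have lin: "linear (f' x)" using f'(1) by (rule has_derivative_linear)
    have "f' x v = f' x (\<Sum>i\<in>Basis. (v \<bullet> i) *\<^sub>R i)" by (simp add: euclidean_representation)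
    also have "\<dots> = (\<Sum>i\<in>Basis. (v \<bullet> i) * f' x i)"
      using lin by (simp add: linear_sum linear_scale)
    also have "\<bar>\<dots>\<bar> \<le> (\<Sum>i\<in>Basis. \<bar>(v \<bullet> i) * f' x i\<bar>)" by (rule sum_abs)
    also have "\<dots> \<le> (\<Sum>i\<in>Basis. norm v * M i)"
      unfolding abs_mult by (intro sum_mono mult_mono M) (auto simp: Basis_le_norm)
    also have "\<dots> = L * norm v" by (simp add: L_def sum_distrib_left mult.commute)
    finally show ?thesis by simp
  qed
  then have on: "onorm (f' x) \<le> L" for x by (intro onorm_bound L0)
  have "\<bar>f x - f y\<bar> \<le> L * norm (x - y)" for x y
    using differentiable_bound[of UNIV f f' L x y] f'(1) on by auto
  with L0 show ?thesis by blast
qed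

lemma smooth_compact_support_bounded:
  assumes f: "f \<in> smooth_compact_support \<Omega>"
  shows "\<exists>M\<ge>0. \<forall>x. \<bar>f x\<bar> \<le> M"
proof -
  define K where "K = closure {x. f x \<noteq> 0}"
  have K: "compact K" and c: "continuous_on UNIV f"
    using f unfolding smooth_compact_support_def K_def using Ck_function.simps(1) by blast+
  then have "compact (f ` K)" by (intro compact_continuous_image) (auto intro: continuous_on_subset)
  then have "bounded (f ` K)" by (rule compact_imp_bounded)
  then obtain M where M: "\<forall>x\<in>K. \<bar>f x\<bar> \<le> M" unfolding bounded_iff by auto
  have "\<bar>f x\<bar> \<le> max M 0" for x
  proof (cases "x \<in> K")
    case False
    then have "f x = 0" using closure_subset[of "{x. f x \<noteq> 0}"] by (auto simp: K_def)
    then show ?thesis by simp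
  qed (use M in \<open>auto simp: le_max_iff_disj\<close>)
  then show ?thesis by (intro exI[of _ "max M 0"]) auto
qed

lemma smooth_compact_support_measurable:
  "f \<in> smooth_compact_support \<Omega> \<Longrightarrow> f \<in> borel_measurable borel"
  unfolding smooth_compact_support_def using Ck_function.simps(1)
  by (blast intro: borel_measurable_continuous_onI)

section \<open>Riesz kernels\<close>

text \<open>Comparison with a geometric series: where \<open>c^n\<close> is the bound, the point
  lies in a ball of volume of order \<open>b^(n N)\<close>. With \<open>b = 1/2\<close> this
  controls a singularity at the origin, with \<open>b = 2\<close> decay at infinity.\<close>

lemma nn_integral_dyadic_bound:
  fixes \<phi> :: "'a::euclidean_space \<Rightarrow> ennreal"
  assumes le: "\<And>z. \<phi> z \<noteq> 0 \<Longrightarrow> \<exists>n. \<phi> z \<le> ennreal (c ^ n) \<and> norm z < 2 * b ^ n"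
    and cb: "0 < c" "0 < b" "c * b ^ DIM('a) < 1"
  shows "(\<integral>\<^sup>+z. \<phi> z \<partial>lborel) < \<infinity>"
proof -
  define N where "N = DIM('a)"
  define g :: "nat \<Rightarrow> 'a \<Rightarrow> ennreal" where "g n z = ennreal (c ^ n) * indicator (ball 0 (2 * b ^ n)) z" for n z
  have "\<phi> z \<le> (\<Sum>n. g n z)" for z
  proof (cases "\<phi> z = 0")
    case False
    then obtain n where n: "\<phi> z \<le> ennreal (c ^ n)" "norm z < 2 * b ^ n" using le by blast
    then have "\<phi> z \<le> g n z" by (simp add: g_def)
    also have "\<dots> \<le> (\<Sum>n. g n z)" using sum_le_suminf[of "\<lambda>n. g n z" "{n}"] by simp
    finally show ?thesis .
  qed simp
  then have "(\<integral>\<^sup>+z. \<phi> z \<partial>lborel) \<le> (\<integral>\<^sup>+z. (\<Sum>n. g n z) \<partial>lborel)" by (intro nn_integral_mono)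
  also have "\<dots> = (\<Sum>n. \<integral>\<^sup>+z. g n z \<partial>lborel)"
    unfolding g_def by (rule nn_integral_suminf) measurable
  also have "\<dots> = (\<Sum>n. ennreal (unit_ball_vol (real N) * 2 ^ N * (c * b ^ N) ^ n))"
  proof (rule suminf_cong)
    fix n
    have "(\<integral>\<^sup>+z. g n z \<partial>lborel) = ennreal (c ^ n) * emeasure lborel (ball (0::'a) (2 * b ^ n))"
      unfolding g_def by (rule nn_integral_cmult_indicator) simp
    also have "\<dots> = ennreal (c ^ n) * ennreal (unit_ball_vol (real N) * (2 * b ^ n) ^ N)"
      using cb by (simp add: emeasure_ball N_def)
    also have "\<dots> = ennreal (unit_ball_vol (real N) * 2 ^ N * (c * b ^ N) ^ n)"
      using cb by (simp add: ennreal_mult[symmetric] power_mult_distrib power_mult[symmetric] mult_ac)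
    finally show "(\<integral>\<^sup>+z. g n z \<partial>lborel) = ennreal (unit_ball_vol (real N) * 2 ^ N * (c * b ^ N) ^ n)" .
  qed
  also have "\<dots> = ennreal (\<Sum>n. unit_ball_vol (real N) * 2 ^ N * (c * b ^ N) ^ n)"
    using cb by (intro suminf_ennreal2) (auto intro!: summable_mult summable_geometric simp: N_def)
  finally show ?thesis by (simp add: le_less_trans)
qed

lemma two_powr_power: "((2::real) ^ n) powr q = (2 powr q) ^ n"
  by (simp add: powr_realpow[symmetric] powr_powr mult.commute)

lemma nn_integral_norm_powr_near:
  assumes q: "0 \<le> q" "q < real DIM('a::euclidean_space)"
  shows "(\<integral>\<^sup>+(z::'a). ennreal (norm z powr - q) * indicator (ball 0 2) z \<partial>lborel) < \<infinity>"
proof (rule nn_integral_dyadic_bound[where c = "2 powr q" and b = "1/2"])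
  show "2 powr q * (1/2) ^ DIM('a) < 1"
  proof -
    have "2 powr q < 2 powr (real DIM('a))" using q by (intro powr_less_mono) auto
    then show ?thesis by (simp add: powr_realpow power_one_over field_simps)
  qed
  fix z :: 'a
  assume nz: "ennreal (norm z powr - q) * indicator (ball 0 2) z \<noteq> 0"
  then have z: "norm z < 2" "0 < norm z" by (auto simp: indicator_def split: if_splits)
  obtain m where "(1/2) ^ m < norm z" using real_arch_pow_inv[of "norm z" "1/2"] z by auto
  then have ex: "\<exists>m. (1/2) ^ m \<le> norm z" by (auto intro: less_imp_le)
  define n where "n = (LEAST m. (1/2) ^ m \<le> norm z)"
  have n: "(1/2) ^ n \<le> norm z" unfolding n_def using ex by (rule LeastI_ex)
  have n2: "norm z < 2 * (1/2) ^ n"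
  proof (cases n)
    case (Suc k)
    then have "\<not> (1/2) ^ k \<le> norm z" using not_less_Least[of k "\<lambda>m. (1/2) ^ m \<le> norm z"] by (simp add: n_def)
    then show ?thesis by (simp add: Suc)
  qed (use z in simp)
  have "norm z powr - q \<le> ((1/2) ^ n) powr - q" using q n z by (intro powr_mono2') auto
  also have "\<dots> = (2 ^ n) powr q"
    by (simp add: power_one_over powr_minus powr_divide)
  finally have "norm z powr - q \<le> (2 powr q) ^ n" by (simp only: two_powr_power)
  with z n2 show "\<exists>n. ennreal (norm z powr - q) * indicator (ball 0 2) z \<le> ennreal ((2 powr q) ^ n)
      \<and> norm z < 2 * (1/2) ^ n"
    by (intro exI[of _ n]) (auto simp: indicator_def intro: ennreal_leI)
qed auto

lemma nn_integral_norm_powr_far: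
  assumes q: "real DIM('a::euclidean_space) < q"
  shows "(\<integral>\<^sup>+(z::'a). ennreal (norm z powr - q) * indicator (- ball 0 1) z \<partial>lborel) < \<infinity>"
proof (rule nn_integral_dyadic_bound[where c = "2 powr - q" and b = 2])
  show "2 powr - q * 2 ^ DIM('a) < 1"
  proof -
    have "2 powr (real DIM('a)) < 2 powr q" using q by (intro powr_less_mono) auto
    then show ?thesis by (simp add: powr_realpow powr_minus field_simps)
  qed
  fix z :: 'a
  assume "ennreal (norm z powr - q) * indicator (- ball 0 1) z \<noteq> 0"
  then have z: "1 \<le> norm z" by (auto simp: indicator_def split: if_splits)
  obtain m where "norm z < 2 ^ m" using real_arch_pow[of 2 "norm z"] by auto
  then have ex: "\<exists>m. norm z < 2 * 2 ^ m" by (intro exI[of _ m]) (smt (verit) zero_less_power)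
  define n where "n = (LEAST m. norm z < 2 * 2 ^ m)"
  have n2: "norm z < 2 * 2 ^ n" unfolding n_def using ex by (rule LeastI_ex)
  have n: "2 ^ n \<le> norm z"
  proof (cases n)
    case (Suc k)
    then have "\<not> norm z < 2 * 2 ^ k" using not_less_Least[of k "\<lambda>m. norm z < 2 * 2 ^ m"] by (simp add: n_def)
    then show ?thesis by (simp add: Suc)
  qed (use z in simp)
  have "norm z powr - q \<le> (2 ^ n) powr - q" using q n z by (intro powr_mono2') auto
  also have "\<dots> = (2 powr - q) ^ n" by (rule two_powr_power)
  finally show "\<exists>n. ennreal (norm z powr - q) * indicator (- ball 0 1) z \<le> ennreal ((2 powr - q) ^ n)
      \<and> norm z < 2 * 2 ^ n"
    using z n2 by (intro exI[of _ n]) (auto simp: indicator_def intro: ennreal_leI)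
qed auto

lemma nn_integral_lborel_translate:
  fixes \<phi> :: "'a::euclidean_space \<Rightarrow> ennreal"
  assumes [measurable]: "\<phi> \<in> borel_measurable borel"
  shows "(\<integral>\<^sup>+y. \<phi> (y - x) \<partial>lborel) = (\<integral>\<^sup>+z. \<phi> z \<partial>lborel)"
proof -
  have "(\<integral>\<^sup>+z. \<phi> z \<partial>lborel) = (\<integral>\<^sup>+z. \<phi> z \<partial>(distr lborel borel ((+) (- x))))"
    by (simp only: lborel_distr_plus)
  also have "\<dots> = (\<integral>\<^sup>+y. \<phi> (- x + y) \<partial>lborel)"
    by (rule nn_integral_distr) measurable
  finally show ?thesis by simp
qed

text \<open>Near the diagonal the Lipschitz bound improves the exponent by 2, which is integrable as
  \<open>s < 1\<close>; away from it boundedness suffices, as \<open>s > 0\<close>. One of the two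
  points may be taken in \<open>K\<close>, so the remaining integration is over a set of finite
  measure. The dimension bound keeps the near exponent nonnegative.\<close>

lemma Lipschitz_compact_support_energy:
  fixes f :: "'a::euclidean_space \<Rightarrow> real"
  assumes [measurable]: "f \<in> borel_measurable borel" and L: "\<And>x y. \<bar>f x - f y\<bar> \<le> L * norm (x - y)"
    and M: "\<And>x. \<bar>f x\<bar> \<le> M" and K [measurable]: "K \<in> sets borel" and Kfin: "emeasure lborel K < \<infinity>"
    and zero: "\<And>x. x \<notin> K \<Longrightarrow> f x = 0" and s: "0 < s" "s < 1" and dim: "2 \<le> DIM('a)"
  shows "f \<in> energy_space s"
proof (rule energy_spaceI)
  define p where "p = real DIM('a) + 2 * s"
  define \<phi> :: "'a \<Rightarrow> ennreal" where "\<phi> z = ennreal (L\<^sup>2) * (ennreal (norm z powr - (p - 2)) * indicator (ball 0 2) z)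
      + ennreal (4 * M\<^sup>2) * (ennreal (norm z powr - p) * indicator (- ball 0 1) z)" for z
  have [measurable]: "ball (0::'a) 1 \<in> sets borel" "ball (0::'a) 2 \<in> sets borel" by auto
  have [measurable]: "\<phi> \<in> borel_measurable borel" unfolding \<phi>_def by measurable
  have \<phi>fin: "(\<integral>\<^sup>+z. \<phi> z \<partial>lborel) < \<infinity>"
  proof -
    have "(\<integral>\<^sup>+z. \<phi> z \<partial>lborel) = ennreal (L\<^sup>2) * (\<integral>\<^sup>+(z::'a). ennreal (norm z powr - (p - 2)) * indicator (ball 0 2) z \<partial>lborel)
      + ennreal (4 * M\<^sup>2) * (\<integral>\<^sup>+(z::'a). ennreal (norm z powr - p) * indicator (- ball 0 1) z \<partial>lborel)"
    proof -
      have "(\<integral>\<^sup>+z. \<phi> z \<partial>lborel) = (\<integral>\<^sup>+(z::'a). ennreal (L\<^sup>2) * (ennreal (norm z powr - (p - 2)) * indicator (ball 0 2) z) \<partial>lborel)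
        + (\<integral>\<^sup>+(z::'a). ennreal (4 * M\<^sup>2) * (ennreal (norm z powr - p) * indicator (- ball 0 1) z) \<partial>lborel)"
        unfolding \<phi>_def by (intro nn_integral_add; measurable)
      also have "(\<integral>\<^sup>+(z::'a). ennreal (L\<^sup>2) * (ennreal (norm z powr - (p - 2)) * indicator (ball 0 2) z) \<partial>lborel)
        = ennreal (L\<^sup>2) * (\<integral>\<^sup>+(z::'a). ennreal (norm z powr - (p - 2)) * indicator (ball 0 2) z \<partial>lborel)"
        by (rule nn_integral_cmult) measurable
      also have "(\<integral>\<^sup>+(z::'a). ennreal (4 * M\<^sup>2) * (ennreal (norm z powr - p) * indicator (- ball 0 1) z) \<partial>lborel)
        = ennreal (4 * M\<^sup>2) * (\<integral>\<^sup>+(z::'a). ennreal (norm z powr - p) * indicator (- ball 0 1) z \<partial>lborel)"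
        by (rule nn_integral_cmult) measurable
      finally show ?thesis .
    qed
    moreover have "(\<integral>\<^sup>+(z::'a). ennreal (norm z powr - (p - 2)) * indicator (ball 0 2) z \<partial>lborel) < \<infinity>"
      using s dim by (intro nn_integral_norm_powr_near) (auto simp: p_def)
    moreover have "(\<integral>\<^sup>+(z::'a). ennreal (norm z powr - p) * indicator (- ball 0 1) z \<partial>lborel) < \<infinity>"
      using s by (intro nn_integral_norm_powr_far) (auto simp: p_def)
    ultimately show ?thesis by (simp add: ennreal_mult_less_top)
  qed
  have le: "ennreal (difference_kernel s f f (x, y)) \<le> \<phi> (y - x)" for x y
  proof (cases "norm (y - x) < 1")
    case True
    have "difference_kernel s f f (x, y) \<le> L\<^sup>2 * norm (y - x) powr - (p - 2)"
    proof (cases "x = y")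
      case False
      have "(f x - f y)\<^sup>2 \<le> (L * norm (x - y))\<^sup>2"
        using L[of x y] by (subst abs_le_square_iff[symmetric]) (metis abs_ge_self order_trans)
      then have "difference_kernel s f f (x, y) \<le> (L * norm (x - y))\<^sup>2 / norm (x - y) powr p"
        by (simp add: difference_kernel_apply p_def power2_eq_square divide_right_mono)
      also have "\<dots> = L\<^sup>2 * (norm (x - y) powr 2 / norm (x - y) powr p)"
        using False by (simp add: power_mult_distrib powr_numeral)
      also have "\<dots> = L\<^sup>2 * norm (y - x) powr - (p - 2)"
        using False by (simp add: powr_diff norm_minus_commute)
      finally show ?thesis .
    qed (simp add: difference_kernel_apply)
    then have "ennreal (difference_kernel s f f (x, y)) \<le> ennreal (L\<^sup>2) * ennreal (norm (y - x) powr - (p - 2))"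
      by (subst ennreal_mult[symmetric]) (auto intro: ennreal_leI)
    then show ?thesis using True by (simp add: \<phi>_def)
  next
    case False
    have "\<bar>f x - f y\<bar> \<le> \<bar>2 * M\<bar>" using M[of x] M[of y] by linarith
    then have "(f x - f y)\<^sup>2 \<le> (2 * M)\<^sup>2" by (simp only: abs_le_square_iff)
    then have "difference_kernel s f f (x, y) \<le> (2 * M)\<^sup>2 / norm (x - y) powr p"
      by (simp add: difference_kernel_apply p_def power2_eq_square divide_right_mono)
    also have "\<dots> = 4 * M\<^sup>2 * norm (y - x) powr - p"
      by (simp add: powr_minus norm_minus_commute divide_inverse)
    finally have "ennreal (difference_kernel s f f (x, y)) \<le> ennreal (4 * M\<^sup>2) * ennreal (norm (y - x) powr - p)"
      by (subst ennreal_mult[symmetric]) (auto intro: ennreal_leI)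
    also have "\<dots> \<le> \<phi> (y - x)" using False by (simp add: \<phi>_def)
    finally show ?thesis .
  qed
  have \<phi>sym: "\<phi> (x - y) = \<phi> (y - x)" for x y
    by (simp add: \<phi>_def norm_minus_commute indicator_def)
  have *: "(\<integral>\<^sup>+x. \<integral>\<^sup>+y. indicator K x * \<phi> (y - x) \<partial>lborel \<partial>lborel) < \<infinity>"
  proof -
    have "(\<integral>\<^sup>+y. indicator K x * \<phi> (y - x) \<partial>lborel) = (\<integral>\<^sup>+z. \<phi> z \<partial>lborel) * indicator K x" for x
      by (subst nn_integral_cmult) (auto simp: nn_integral_lborel_translate mult.commute)
    then have "(\<integral>\<^sup>+x. \<integral>\<^sup>+y. indicator K x * \<phi> (y - x) \<partial>lborel \<partial>lborel) = (\<integral>\<^sup>+z. \<phi> z \<partial>lborel) * emeasure lborel K"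
      by (simp add: nn_integral_cmult_indicator)
    then show ?thesis using \<phi>fin Kfin by (simp add: ennreal_mult_less_top)
  qed
  have "(\<integral>\<^sup>+x. \<integral>\<^sup>+y. indicator K y * \<phi> (y - x) \<partial>lborel \<partial>lborel)
      = (\<integral>\<^sup>+y. \<integral>\<^sup>+x. indicator K y * \<phi> (y - x) \<partial>lborel \<partial>lborel)"
    by (rule lborel_pair.Fubini'[symmetric]) measurable
  also have "\<dots> = (\<integral>\<^sup>+x. \<integral>\<^sup>+y. indicator K x * \<phi> (y - x) \<partial>lborel \<partial>lborel)"
    by (simp only: \<phi>sym)
  finally have **: "(\<integral>\<^sup>+x. \<integral>\<^sup>+y. indicator K y * \<phi> (y - x) \<partial>lborel \<partial>lborel) < \<infinity>" using * by simp
  have "(\<integral>\<^sup>+z. ennreal (difference_kernel s f f z) \<partial>(lborel \<Otimes>\<^sub>M lborel))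
      = (\<integral>\<^sup>+x. \<integral>\<^sup>+y. ennreal (difference_kernel s f f (x, y)) \<partial>lborel \<partial>lborel)"
    by (rule lborel.nn_integral_fst[symmetric]) measurable
  also have "\<dots> \<le> (\<integral>\<^sup>+x. \<integral>\<^sup>+y. indicator K x * \<phi> (y - x) + indicator K y * \<phi> (y - x) \<partial>lborel \<partial>lborel)"
  proof (intro nn_integral_mono)
    fix x y
    show "ennreal (difference_kernel s f f (x, y)) \<le> indicator K x * \<phi> (y - x) + indicator K y * \<phi> (y - x)"
    proof (cases "x \<in> K \<or> y \<in> K")
      case True
      then have "\<phi> (y - x) \<le> indicator K x * \<phi> (y - x) + indicator K y * \<phi> (y - x)"
        by (auto simp: indicator_def)
      with le[of x y] show ?thesis by (rule order_trans)
    next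
      case False
      then show ?thesis by (simp add: difference_kernel_apply zero)
    qed
  qed
  also have "\<dots> = (\<integral>\<^sup>+x. \<integral>\<^sup>+y. indicator K x * \<phi> (y - x) \<partial>lborel \<partial>lborel)
      + (\<integral>\<^sup>+x. \<integral>\<^sup>+y. indicator K y * \<phi> (y - x) \<partial>lborel \<partial>lborel)"
    by (subst nn_integral_add; (subst nn_integral_add)?; measurable?)
  finally show "(\<integral>\<^sup>+z. ennreal (difference_kernel s f f z) \<partial>(lborel \<Otimes>\<^sub>M lborel)) < \<infinity>"
    using * ** by (simp add: le_less_trans)
qed fact

lemma smooth_compact_support_energy:
  fixes f :: "'a::euclidean_space \<Rightarrow> real"
  assumes f: "f \<in> smooth_compact_support \<Omega>" and s: "0 < s" "s < 1" and dim: "2 \<le> DIM('a)"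
  shows "f \<in> energy_space s"
proof -
  obtain L where L: "\<And>x y. \<bar>f x - f y\<bar> \<le> L * norm (x - y)" using smooth_compact_support_Lipschitz[OF f] by blast
  obtain M where M: "\<And>x. \<bar>f x\<bar> \<le> M" using smooth_compact_support_bounded[OF f] by blast
  have K: "compact (closure {x. f x \<noteq> 0})" using f by (simp add: smooth_compact_support_def)
  show ?thesis
  proof (rule Lipschitz_compact_support_energy[OF smooth_compact_support_measurable[OF f] L M _ _ _ s dim])
    show "closure {x. f x \<noteq> 0} \<in> sets borel" by simp
    show "emeasure lborel (closure {x. f x \<noteq> 0}) < \<infinity>"
      using emeasure_bounded_finite[OF compact_imp_bounded[OF K]] by simp
    show "f x = 0" if "x \<notin> closure {x. f x \<noteq> 0}" for x
      using that closure_subset[of "{x. f x \<noteq> 0}"] by auto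
  qed
qed

text \<open>Integral of the kernel multiplied by \<open>|z|^2\<close>, over a ball that contains all
  differences of points of the unit ball. It is finite for \<open>0 < s < 1\<close> in dimension at
  least 2 and does not depend on the annulus.\<close>

definition near_constant :: "'a::euclidean_space itself \<Rightarrow> real \<Rightarrow> real" where
  "near_constant _ s = enn2real (\<integral>\<^sup>+(z::'a). ennreal (norm z powr - (real DIM('a) + 2 * s - 2)) * indicator (ball 0 2) z \<partial>lborel)"

text \<open>Translation invariance bounds the integral of the kernel in one variable uniformly in
  the other. Both placements of the weight occur, because a product \<open>u x * u y\<close> is
  later split symmetrically.\<close>

lemma near_bound:
  fixes u :: "'a::euclidean_space \<Rightarrow> real"
  assumes [measurable]: "u \<in> borel_measurable borel" and s: "0 < s" "s < 1" and dim: "2 \<le> DIM('a)"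
  shows "(\<integral>\<^sup>+x. \<integral>\<^sup>+y. ennreal (u x ^ 2) * (indicator (ball 0 1) x * indicator (ball 0 1) y *
      ennreal (norm (x - y) powr - (real DIM('a) + 2 * s - 2))) \<partial>lborel \<partial>lborel)
    \<le> ennreal (near_constant TYPE('a) s) * (\<integral>\<^sup>+x. ennreal (u x ^ 2) \<partial>lborel)" (is ?fst)
    "(\<integral>\<^sup>+x. \<integral>\<^sup>+y. ennreal (u y ^ 2) * (indicator (ball 0 1) x * indicator (ball 0 1) y *
      ennreal (norm (x - y) powr - (real DIM('a) + 2 * s - 2))) \<partial>lborel \<partial>lborel)
    \<le> ennreal (near_constant TYPE('a) s) * (\<integral>\<^sup>+x. ennreal (u x ^ 2) \<partial>lborel)" (is ?snd)
proof -
  define q where "q = real DIM('a) + 2 * s - 2"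
  have [measurable]: "ball (0::'a) 1 \<in> sets borel" "ball (0::'a) 2 \<in> sets borel" by auto
  define \<phi> :: "'a \<Rightarrow> ennreal" where "\<phi> z = ennreal (norm z powr - q) * indicator (ball 0 2) z" for z
  have [measurable]: "\<phi> \<in> borel_measurable borel" unfolding \<phi>_def by measurable
  have "(\<integral>\<^sup>+z. \<phi> z \<partial>lborel) < \<infinity>"
    unfolding \<phi>_def using s dim by (intro nn_integral_norm_powr_near) (auto simp: q_def)
  then have c: "(\<integral>\<^sup>+z. \<phi> z \<partial>lborel) = ennreal (near_constant TYPE('a) s)"
    unfolding near_constant_def \<phi>_def q_def by simp
  have "(\<integral>\<^sup>+x. \<integral>\<^sup>+y. ennreal (u x ^ 2) * (indicator (ball 0 1) x * indicator (ball 0 1) y * ennreal (norm (x - y) powr - q)) \<partial>lborel \<partial>lborel)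
      \<le> (\<integral>\<^sup>+x. \<integral>\<^sup>+y. ennreal (u x ^ 2) * \<phi> (y - x) \<partial>lborel \<partial>lborel)"
  proof (intro nn_integral_mono mult_left_mono)
    fix x y :: 'a
    have "norm (y - x) < 2" if "norm x < 1" "norm y < 1"
      using norm_triangle_ineq4[of y x] that by linarith
    then show "indicator (ball 0 1) x * indicator (ball 0 1) y * ennreal (norm (x - y) powr - q) \<le> \<phi> (y - x)"
      by (auto simp: \<phi>_def indicator_def norm_minus_commute)
  qed auto
  also have "\<dots> = (\<integral>\<^sup>+x. ennreal (near_constant TYPE('a) s) * ennreal (u x ^ 2) \<partial>lborel)"
    by (subst nn_integral_cmult) (auto simp: nn_integral_lborel_translate c mult.commute)
  also have "\<dots> = ennreal (near_constant TYPE('a) s) * (\<integral>\<^sup>+x. ennreal (u x ^ 2) \<partial>lborel)"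
    by (rule nn_integral_cmult) measurable
  finally show *: ?fst by (simp add: q_def)
  have "(\<integral>\<^sup>+x. \<integral>\<^sup>+y. ennreal (u y ^ 2) * (indicator (ball 0 1) x * indicator (ball 0 1) y * ennreal (norm (x - y) powr - q)) \<partial>lborel \<partial>lborel)
     = (\<integral>\<^sup>+y. \<integral>\<^sup>+x. ennreal (u y ^ 2) * (indicator (ball 0 1) x * indicator (ball 0 1) y * ennreal (norm (x - y) powr - q)) \<partial>lborel \<partial>lborel)"
    by (rule lborel_pair.Fubini'[symmetric]) measurable
  also have "\<dots> = (\<integral>\<^sup>+x. \<integral>\<^sup>+y. ennreal (u x ^ 2) * (indicator (ball 0 1) x * indicator (ball 0 1) y * ennreal (norm (x - y) powr - q)) \<partial>lborel \<partial>lborel)"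
    by (simp add: norm_minus_commute mult_ac)
  finally show ?snd using * by (simp add: q_def)
qed

section \<open>The fractional Sobolev space\<close>

lemma fractional_constant_pos: "0 < s \<Longrightarrow> s < 1 \<Longrightarrow> 0 < fractional_constant N s"
  unfolding fractional_constant_def
  by (intro divide_pos_pos mult_pos_pos Gamma_real_pos) auto

lemma fractional_form_gagliardo:
  "fractional_form s u v = fractional_constant DIM('a) s / 2 * gagliardo s u v"
  for u v :: "'a::euclidean_space \<Rightarrow> real"
  by (simp add: fractional_form_def gagliardo_def)

lemma sum_fun_apply: "(\<Sum>i\<in>I. f i) x = (\<Sum>i\<in>I. f i x)" for f :: "'i \<Rightarrow> 'a \<Rightarrow> 'b::comm_monoid_add"
  by (induction I rule: infinite_finite_induct) auto

lemma energy_add_le: "u \<in> energy_space s \<Longrightarrow> v \<in> energy_space s \<Longrightarrow>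
    gagliardo s (u + v) (u + v) \<le> 2 * gagliardo s u u + 2 * gagliardo s v v"
  using gagliardo.parallelogram[of u s v] gagliardo_nonneg[of s "u - v"] by simp

text \<open>Meant for the absolute value and its smooth substitutes, which are 1-Lipschitz functions
  of \<open>u\<close>.\<close>

lemma energy_contraction:
  assumes u: "u \<in> energy_space s" and [measurable]: "w \<in> borel_measurable borel"
    and le: "\<And>x y. \<bar>w x - w y\<bar> \<le> \<bar>u x - u y\<bar>"
  shows "w \<in> energy_space s" "difference_kernel s w w z \<le> difference_kernel s u u z"
proof -
  have *: "difference_kernel s w w z \<le> difference_kernel s u u z" for z
    using le by (cases z) (auto simp: difference_kernel_def abs_le_square_iff power2_eq_square intro!: divide_right_mono)
  then show "difference_kernel s w w z \<le> difference_kernel s u u z" .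
  have "(\<integral>\<^sup>+z. ennreal (difference_kernel s w w z) \<partial>(lborel \<Otimes>\<^sub>M lborel)) \<le> ennreal (gagliardo s u u)"
    unfolding nn_integral_energy[OF u, symmetric] using * by (intro nn_integral_mono ennreal_leI)
  then show "w \<in> energy_space s" by (intro energy_spaceI) (auto simp: le_less_trans)
qed

text \<open>Pratt's form of dominated convergence: the integrands are dominated by a convergent sequence of
  integrable functions instead of a single one.\<close>

lemma gagliardo_contraction_limit:
  fixes f g :: "nat \<Rightarrow> 'a::euclidean_space \<Rightarrow> real"
  assumes f: "\<And>n. f n \<in> energy_space s" and u: "u \<in> energy_space s"
    and lim: "(\<lambda>n. gagliardo s (f n - u) (f n - u)) \<longlonglongrightarrow> 0"
    and ae: "AE x in lborel. (\<lambda>n. f n x) \<longlonglongrightarrow> u x"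
    and g [measurable]: "\<And>n. g n \<in> borel_measurable borel" and w [measurable]: "w \<in> borel_measurable borel"
    and gf: "\<And>n x y. \<bar>g n x - g n y\<bar> \<le> \<bar>f n x - f n y\<bar>" and wu: "\<And>x y. \<bar>w x - w y\<bar> \<le> \<bar>u x - u y\<bar>"
    and aeg: "AE x in lborel. (\<lambda>n. g n x) \<longlonglongrightarrow> w x"
  shows "(\<lambda>n. gagliardo s (g n - w) (g n - w)) \<longlonglongrightarrow> 0"
proof -
  have ge: "g n \<in> energy_space s" for n by (rule energy_contraction(1)[OF f g gf])
  have we: "w \<in> energy_space s" by (rule energy_contraction(1)[OF u w wu])
  have [measurable]: "f n \<in> borel_measurable borel" "u \<in> borel_measurable borel" for n
    using f u energy_space_measurable by auto
  define d where "d n = g n - w" for n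
  have de: "d n \<in> energy_space s" for n unfolding d_def using ge we by auto
  have [measurable]: "d n \<in> borel_measurable borel" for n using de energy_space_measurable by auto
  \<comment> \<open>The dominating kernels minus the kernel of \<open>g n - w\<close>, nonnegative
    by \<open>(a - b)^2 \<le> 2 a^2 + 2 b^2\<close>. Fatou applied to \<open>H\<close> compares
    \<open>C\<close> with \<open>c n - D n\<close>; as \<open>c n\<close> tends to \<open>C\<close>,
    \<open>D n\<close> tends to 0.\<close>
  define H where "H n z = 2 * difference_kernel s (f n) (f n) z + 2 * difference_kernel s u u z
      - difference_kernel s (d n) (d n) z" for n z
  have [measurable]: "H n \<in> borel_measurable (lborel \<Otimes>\<^sub>M lborel)" for n unfolding H_def by measurable
  have H0: "0 \<le> H n z" for n z
  proof -
    obtain x y where z: "z = (x, y)" by (cases z)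
    have "((g n x - g n y) - (w x - w y))\<^sup>2 \<le> 2 * (g n x - g n y)\<^sup>2 + 2 * (w x - w y)\<^sup>2"
      using zero_le_power2[of "(g n x - g n y) + (w x - w y)"] by (simp add: power2_eq_square algebra_simps)
    then have "difference_kernel s (d n) (d n) z \<le> 2 * difference_kernel s (g n) (g n) z + 2 * difference_kernel s w w z"
      by (simp add: z difference_kernel_def d_def power2_eq_square add_divide_distrib[symmetric] algebra_simps divide_right_mono)
    with energy_contraction(2)[OF f g gf, of n z] energy_contraction(2)[OF u w wu, of z]
    show ?thesis by (simp add: H_def)
  qed
  define c where "c n = 2 * gagliardo s (f n) (f n) + 2 * gagliardo s u u" for n
  define D where "D n = gagliardo s (d n) (d n)" for n
  define C where "C = 4 * gagliardo s u u"
  have intH: "(\<integral>\<^sup>+z. ennreal (H n z) \<partial>(lborel \<Otimes>\<^sub>M lborel)) = ennreal (c n - D n)"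
    and cD: "0 \<le> c n - D n" for n
  proof -
    have i: "integrable (lborel \<Otimes>\<^sub>M lborel) (H n)"
      unfolding H_def using f u de
      by (intro Bochner_Integration.integrable_add Bochner_Integration.integrable_diff integrable_mult_right integrable_difference_kernel) auto
    have v: "(LINT z|(lborel \<Otimes>\<^sub>M lborel). H n z) = c n - D n"
      unfolding H_def c_def D_def gagliardo_def
      using integrable_difference_kernel[OF f f] integrable_difference_kernel[OF u u] integrable_difference_kernel[OF de de] by simp
    show "(\<integral>\<^sup>+z. ennreal (H n z) \<partial>(lborel \<Otimes>\<^sub>M lborel)) = ennreal (c n - D n)"
      unfolding v[symmetric] using H0 by (intro nn_integral_eq_integral i) auto
    show "0 \<le> c n - D n" unfolding v[symmetric] using H0 by (intro Bochner_Integration.integral_nonneg) auto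
  qed
  have clim: "c \<longlonglongrightarrow> C"
  proof -
    have "(\<lambda>n. gagliardo s (f n) (f n)) \<longlonglongrightarrow> gagliardo s u u"
      by (rule gagliardo.tendsto_square[OF f u lim])
    then have "(\<lambda>n. 2 * gagliardo s (f n) (f n) + 2 * gagliardo s u u) \<longlonglongrightarrow> 2 * gagliardo s u u + 2 * gagliardo s u u"
      by (intro tendsto_intros)
    then show ?thesis by (simp add: c_def[abs_def] C_def)
  qed
  have "ennreal C = (\<integral>\<^sup>+z. ennreal (4 * difference_kernel s u u z) \<partial>(lborel \<Otimes>\<^sub>M lborel))"
    using u by (simp add: C_def ennreal_mult nn_integral_cmult nn_integral_energy gagliardo_nonneg)
  also have "\<dots> = (\<integral>\<^sup>+z. liminf (\<lambda>n. ennreal (H n z)) \<partial>(lborel \<Otimes>\<^sub>M lborel))"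
  proof (rule nn_integral_cong_AE)
    show "AE z in lborel \<Otimes>\<^sub>M lborel. ennreal (4 * difference_kernel s u u z) = liminf (\<lambda>n. ennreal (H n z))"
      using AE_lborel_pairI(1)[OF ae] AE_lborel_pairI(2)[OF ae] AE_lborel_pairI(1)[OF aeg] AE_lborel_pairI(2)[OF aeg]
    proof eventually_elim
      case (elim z)
      obtain x y where z: "z = (x, y)" by (cases z)
      have "(\<lambda>n. difference_kernel s (f n) (f n) z) \<longlonglongrightarrow> difference_kernel s u u z"
        using elim by (auto simp: z difference_kernel_def divide_inverse intro!: tendsto_intros)
      moreover have "(\<lambda>n. difference_kernel s (d n) (d n) z)
          \<longlonglongrightarrow> ((w x - w x) - (w y - w y)) * ((w x - w x) - (w y - w y)) * inverse (norm (x - y) powr (real DIM('a) + 2 * s))"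
        using elim unfolding z difference_kernel_def d_def divide_inverse prod.case minus_apply by (intro tendsto_intros) auto
      ultimately have "(\<lambda>n. H n z) \<longlonglongrightarrow> 2 * difference_kernel s u u z + 2 * difference_kernel s u u z - 0"
        unfolding H_def by (intro tendsto_intros) auto
      then have "(\<lambda>n. ennreal (H n z)) \<longlonglongrightarrow> ennreal (4 * difference_kernel s u u z)"
        by (intro tendsto_ennrealI) simp
      then show ?case by (rule lim_imp_Liminf[OF sequentially_bot, symmetric])
    qed
  qed
  also have "\<dots> \<le> liminf (\<lambda>n. \<integral>\<^sup>+z. ennreal (H n z) \<partial>(lborel \<Otimes>\<^sub>M lborel))"
    by (rule nn_integral_liminf) measurable
  also have "\<dots> = liminf (\<lambda>n. ennreal (c n - D n))" by (simp add: intH)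
  finally have Fatou: "ennreal C \<le> liminf (\<lambda>n. ennreal (c n - D n))" .
  have "D \<longlonglongrightarrow> 0"
  proof (rule tendstoI)
    fix e :: real assume e: "0 < e"
    have ev: "\<forall>\<^sub>F n in sequentially. c n < C + e / 2"
      using clim e by (intro order_tendstoD(2)[OF clim]) auto
    have "\<forall>\<^sub>F n in sequentially. D n < e"
    \<comment> \<open>If \<open>e / 2\<close> exceeds \<open>C\<close>, then
      \<open>C - e / 2\<close> is negative and useless as an \<open>ennreal\<close>, but
      \<open>D n \<le> c n\<close> already suffices.\<close>
    proof (cases "e / 2 \<le> C")
      case True
      then have "ennreal (C - e / 2) < ennreal C" using e by (intro ennreal_lessI) auto
      then have "\<forall>\<^sub>F n in sequentially. ennreal (C - e / 2) < ennreal (c n - D n)"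
        using Fatou by (simp add: le_Liminf_iff)
      with ev show ?thesis
      proof eventually_elim
        case (elim n)
        then have "C - e / 2 < c n - D n" using True by (simp add: ennreal_less_iff)
        with elim show ?case by simp
      qed
    next
      case False
      from ev show ?thesis by eventually_elim (use cD False in \<open>smt (verit) field_sum_of_halves\<close>)
    qed
    moreover have "0 \<le> D n" for n unfolding D_def by (rule gagliardo_nonneg)
    ultimately show "\<forall>\<^sub>F n in sequentially. dist (D n) 0 < e" by simp
  qed
  then show ?thesis by (simp add: D_def[abs_def] d_def)
qed

lemma compact_closure_subset: "compact K \<Longrightarrow> closure S \<subseteq> K \<Longrightarrow> compact (closure S)"
  for K :: "'a::t2_space set"
  using compact_Int_closed[of K "closure S"] by (simp add: Int_absorb1)

text \<open>Placing all domains inside the unit ball makes the Poincare and kernel constants the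
  same for all annuli; the latter enters \<open>thin_constant\<close>.\<close>

locale fractional_domain =
  fixes s :: real and \<Omega> :: "'a::euclidean_space set"
  assumes s: "0 < s" "s < 1" and dim: "2 \<le> DIM('a)"
    and open_\<Omega>: "open \<Omega>" and nonempty: "\<Omega> \<noteq> {}" and unit: "\<Omega> \<subseteq> ball 0 1"
begin

abbreviation H :: "('a \<Rightarrow> real) set" where "H \<equiv> fractional_sobolev s \<Omega>"

lemma ks_pos: "0 < fractional_constant DIM('a) s" using fractional_constant_pos[OF s] by simp

lemma smooth_energy: "f \<in> smooth_compact_support \<Omega> \<Longrightarrow> f \<in> energy_space s"
  using smooth_compact_support_energy s dim by blast

lemma smooth_zero: "f \<in> smooth_compact_support \<Omega> \<Longrightarrow> x \<notin> \<Omega> \<Longrightarrow> f x = 0"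
  using closure_subset[of "{x. f x \<noteq> 0}"] by (auto simp: smooth_compact_support_def)

lemma H_iff: "u \<in> H \<longleftrightarrow> u \<in> energy_space s \<and> (AE x in lborel. x \<notin> \<Omega> \<longrightarrow> u x = 0) \<and>
    (\<exists>f. (\<forall>n. f n \<in> smooth_compact_support \<Omega>) \<and> (\<lambda>n. gagliardo s (f n - u) (f n - u)) \<longlonglongrightarrow> 0)"
proof -
  have "(\<lambda>n. sqrt (fractional_form s (\<lambda>x. f n x - u x) (\<lambda>x. f n x - u x))) \<longlonglongrightarrow> 0
      \<longleftrightarrow> (\<lambda>n. gagliardo s (f n - u) (f n - u)) \<longlonglongrightarrow> 0" for f :: "nat \<Rightarrow> 'a \<Rightarrow> real"
  proof -
    have eq: "(\<lambda>x. f n x - u x) = f n - u" for n by (simp add: fun_eq_iff)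
    show ?thesis unfolding eq fractional_form_gagliardo
    proof
      assume "(\<lambda>n. sqrt ((fractional_constant DIM('a) s / 2) * gagliardo s (f n - u) (f n - u))) \<longlonglongrightarrow> 0"
      then have "(\<lambda>n. (sqrt ((fractional_constant DIM('a) s / 2) * gagliardo s (f n - u) (f n - u)))\<^sup>2 * (1 / (fractional_constant DIM('a) s / 2))) \<longlonglongrightarrow> 0\<^sup>2 * (1 / (fractional_constant DIM('a) s / 2))"
        by (intro tendsto_intros)
      then show "(\<lambda>n. gagliardo s (f n - u) (f n - u)) \<longlonglongrightarrow> 0"
        using ks_pos by (simp add: gagliardo_nonneg)
    next
      assume "(\<lambda>n. gagliardo s (f n - u) (f n - u)) \<longlonglongrightarrow> 0"
      then have "(\<lambda>n. sqrt ((fractional_constant DIM('a) s / 2) * gagliardo s (f n - u) (f n - u))) \<longlonglongrightarrow> sqrt ((fractional_constant DIM('a) s / 2) * 0)"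
        by (intro tendsto_intros)
      then show "(\<lambda>n. sqrt ((fractional_constant DIM('a) s / 2) * gagliardo s (f n - u) (f n - u))) \<longlonglongrightarrow> 0" by simp
    qed
  qed
  then show ?thesis by (auto simp: fractional_sobolev_def energy_space_def)
qed

lemma H_energy: "u \<in> H \<Longrightarrow> u \<in> energy_space s" and H_zero: "u \<in> H \<Longrightarrow> AE x in lborel. x \<notin> \<Omega> \<longrightarrow> u x = 0"
  by (simp_all add: H_iff)

lemma H_measurable: "u \<in> H \<Longrightarrow> u \<in> borel_measurable borel"
  using H_energy energy_space_measurable by blast

lemma H_zero_ball: "u \<in> H \<Longrightarrow> AE x in lborel. x \<notin> ball 0 1 \<longrightarrow> u x = 0"
  by (drule H_zero, erule eventually_mono) (use unit in auto)

lemma smooth_in_H: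
  assumes "f \<in> smooth_compact_support \<Omega>"
  shows "f \<in> H"
proof -
  have "gagliardo s (f - f) (f - f) = 0"
    using gagliardo.zero[of 0 s] by simp
  then have "(\<lambda>n::nat. gagliardo s (f - f) (f - f)) \<longlonglongrightarrow> 0" by simp
  with assms show ?thesis by (auto simp: H_iff smooth_energy smooth_zero intro!: exI[of _ "\<lambda>_. f"])
qed

text \<open>Each \<open>f n\<close> is replaced by a test function within \<open>1 / (n + 1)\<close>
  in energy, so a limit of elements of \<open>H\<close> is again a limit of test functions.\<close>

lemma H_closed:
  assumes u: "u \<in> energy_space s" and zero: "AE x in lborel. x \<notin> \<Omega> \<longrightarrow> u x = 0"
    and f: "\<And>n. f n \<in> H" and lim: "(\<lambda>n. gagliardo s (f n - u) (f n - u)) \<longlonglongrightarrow> 0"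
  shows "u \<in> H"
proof -
  have "\<exists>h \<in> smooth_compact_support \<Omega>. gagliardo s (h - f n) (h - f n) < 1 / real (Suc n)" for n
  proof -
    obtain g where g: "\<And>k. g k \<in> smooth_compact_support \<Omega>" "(\<lambda>k. gagliardo s (g k - f n) (g k - f n)) \<longlonglongrightarrow> 0"
      using f[of n] by (auto simp: H_iff)
    have "\<forall>\<^sub>F k in sequentially. gagliardo s (g k - f n) (g k - f n) < 1 / real (Suc n)"
      by (rule order_tendstoD(2)[OF g(2)]) simp
    then obtain k where "gagliardo s (g k - f n) (g k - f n) < 1 / real (Suc n)"
      by (auto simp: eventually_sequentially)
    with g(1) show ?thesis by blast
  qed
  then obtain h where h: "\<And>n. h n \<in> smooth_compact_support \<Omega>"
    "\<And>n. gagliardo s (h n - f n) (h n - f n) < 1 / real (Suc n)" by metis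
  have "(\<lambda>n. gagliardo s (h n - u) (h n - u)) \<longlonglongrightarrow> 0"
  proof (rule tendsto_sandwich[OF _ _ tendsto_const])
    show "\<forall>\<^sub>F n in sequentially. gagliardo s (h n - u) (h n - u)
        \<le> 2 * (1 / real (Suc n)) + 2 * gagliardo s (f n - u) (f n - u)"
    proof (intro always_eventually allI)
      fix n
      have "gagliardo s (h n - u) (h n - u) \<le> 2 * gagliardo s (h n - f n) (h n - f n) + 2 * gagliardo s (f n - u) (f n - u)"
        using energy_add_le[of "h n - f n" s "f n - u"] smooth_energy[OF h(1)] H_energy[OF f] u
        by (simp add: gagliardo.in_V)
      with h(2)[of n] show "gagliardo s (h n - u) (h n - u)
        \<le> 2 * (1 / real (Suc n)) + 2 * gagliardo s (f n - u) (f n - u)" by simp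
    qed
    have "(\<lambda>n. 2 * (1 / real (Suc n)) + 2 * gagliardo s (f n - u) (f n - u)) \<longlonglongrightarrow> 2 * 0 + 2 * 0"
      by (intro tendsto_intros lim LIMSEQ_Suc[OF lim_1_over_n])
    then show "(\<lambda>n. 2 * (1 / real (Suc n)) + 2 * gagliardo s (f n - u) (f n - u)) \<longlonglongrightarrow> 0" by simp
  qed (simp add: gagliardo_nonneg)
  with u zero h show ?thesis by (auto simp: H_iff)
qed

lemma smooth_add: "f \<in> smooth_compact_support \<Omega> \<Longrightarrow> g \<in> smooth_compact_support \<Omega> \<Longrightarrow> f + g \<in> smooth_compact_support \<Omega>"
proof -
  assume f: "f \<in> smooth_compact_support \<Omega>" and g: "g \<in> smooth_compact_support \<Omega>"
  have "{x. (f + g) x \<noteq> 0} \<subseteq> {x. f x \<noteq> 0} \<union> {x. g x \<noteq> 0}" by auto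
  then have sub: "closure {x. (f + g) x \<noteq> 0} \<subseteq> closure {x. f x \<noteq> 0} \<union> closure {x. g x \<noteq> 0}"
    by (metis closure_Un closure_mono)
  have "compact (closure {x. f x \<noteq> 0} \<union> closure {x. g x \<noteq> 0})"
    using f g by (intro compact_Un) (auto simp: smooth_compact_support_def)
  from compact_closure_subset[OF this sub] have c: "compact (closure {x. (f + g) x \<noteq> 0})" .
  have "Ck_function k (f + g)" for k
    using f g unfolding smooth_compact_support_def plus_fun_def by (blast intro: Ck_function_add)
  moreover have "closure {x. (f + g) x \<noteq> 0} \<subseteq> \<Omega>"
    using sub f g unfolding smooth_compact_support_def by blast
  ultimately show ?thesis using c unfolding smooth_compact_support_def by blast
qed

lemma smooth_vanishing:
  assumes f: "f \<in> smooth_compact_support \<Omega>" and g: "\<And>k. Ck_function k g" and sub: "\<And>x. f x = 0 \<Longrightarrow> g x = 0"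
  shows "g \<in> smooth_compact_support \<Omega>"
proof -
  have cl: "closure {x. g x \<noteq> 0} \<subseteq> closure {x. f x \<noteq> 0}" using sub by (intro closure_mono) auto
  have f': "compact (closure {x. f x \<noteq> 0})" "closure {x. f x \<noteq> 0} \<subseteq> \<Omega>"
    using f unfolding smooth_compact_support_def by blast+
  show ?thesis using g cl f'(2) compact_closure_subset[OF f'(1) cl] unfolding smooth_compact_support_def by blast
qed

lemma smooth_mult: "f \<in> smooth_compact_support \<Omega> \<Longrightarrow> (\<And>k. Ck_function k \<eta>) \<Longrightarrow> (\<lambda>x. \<eta> x * f x) \<in> smooth_compact_support \<Omega>"
  by (rule smooth_vanishing) (auto intro!: Ck_function_mult simp: smooth_compact_support_def simp del: Ck_function.simps)

lemma subspace_H: "subspace H"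
proof (rule subspaceI)
  show "0 \<in> H"
  proof (rule smooth_in_H)
    show "0 \<in> smooth_compact_support \<Omega>" by (simp add: smooth_compact_support_def zero_fun_def)
  qed
next
  fix u v assume uv: "u \<in> H" "v \<in> H"
  then obtain f g where f: "\<And>n::nat. f n \<in> smooth_compact_support \<Omega>" "(\<lambda>n. gagliardo s (f n - u) (f n - u)) \<longlonglongrightarrow> 0"
    and g: "\<And>n::nat. g n \<in> smooth_compact_support \<Omega>" "(\<lambda>n. gagliardo s (g n - v) (g n - v)) \<longlonglongrightarrow> 0"
    by (auto simp: H_iff)
  show "u + v \<in> H"
  proof (rule H_closed)
    show "u + v \<in> energy_space s" using uv by (intro gagliardo.in_V H_energy)
    show "AE x in lborel. x \<notin> \<Omega> \<longrightarrow> (u + v) x = 0"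
      using H_zero[OF uv(1)] H_zero[OF uv(2)] by eventually_elim simp
    show "f n + g n \<in> H" for n by (intro smooth_in_H smooth_add f g)
    show "(\<lambda>n. gagliardo s (f n + g n - (u + v)) (f n + g n - (u + v))) \<longlonglongrightarrow> 0"
    proof (rule tendsto_sandwich[OF _ _ tendsto_const])
      have "gagliardo s (f n + g n - (u + v)) (f n + g n - (u + v))
          \<le> 2 * gagliardo s (f n - u) (f n - u) + 2 * gagliardo s (g n - v) (g n - v)" for n
      proof -
        have "f n + g n - (u + v) = (f n - u) + (g n - v)" by simp
        then show ?thesis
          using energy_add_le[of "f n - u" s "g n - v"] smooth_energy[OF f(1)] smooth_energy[OF g(1)] H_energy[OF uv(1)] H_energy[OF uv(2)]
          by (simp only: gagliardo.in_V)
      qed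
      then show "\<forall>\<^sub>F n in sequentially. gagliardo s (f n + g n - (u + v)) (f n + g n - (u + v))
          \<le> 2 * gagliardo s (f n - u) (f n - u) + 2 * gagliardo s (g n - v) (g n - v)" by simp
      have "(\<lambda>n. 2 * gagliardo s (f n - u) (f n - u) + 2 * gagliardo s (g n - v) (g n - v)) \<longlonglongrightarrow> 2 * 0 + 2 * 0"
        by (intro tendsto_intros f g)
      then show "(\<lambda>n. 2 * gagliardo s (f n - u) (f n - u) + 2 * gagliardo s (g n - v) (g n - v)) \<longlonglongrightarrow> 0" by simp
    qed (simp add: gagliardo_nonneg)
  qed
next
  fix c u assume u: "u \<in> H"
  then obtain f where f: "\<And>n::nat. f n \<in> smooth_compact_support \<Omega>" "(\<lambda>n. gagliardo s (f n - u) (f n - u)) \<longlonglongrightarrow> 0"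
    by (auto simp: H_iff)
  show "c *\<^sub>R u \<in> H"
  proof (rule H_closed)
    show "c *\<^sub>R u \<in> energy_space s" using u by (intro gagliardo.in_V H_energy)
    show "AE x in lborel. x \<notin> \<Omega> \<longrightarrow> (c *\<^sub>R u) x = 0"
      using H_zero[OF u] by eventually_elim (simp add: scaleR_fun_def)
    show "c *\<^sub>R f n \<in> H" for n
      using smooth_in_H[OF smooth_mult[OF f(1)[of n], of "\<lambda>_. c"]] by (simp add: scaleR_fun_def)
    have "gagliardo s (c *\<^sub>R f n - c *\<^sub>R u) (c *\<^sub>R f n - c *\<^sub>R u) = c\<^sup>2 * gagliardo s (f n - u) (f n - u)" for n
      using smooth_energy[OF f(1)[of n]] H_energy[OF u]
      by (simp add: scaleR_diff_right[symmetric] gagliardo.scale gagliardo.scale_right power2_eq_square gagliardo.in_V del: scaleR_diff_right)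
    moreover have "(\<lambda>n. c\<^sup>2 * gagliardo s (f n - u) (f n - u)) \<longlonglongrightarrow> 0"
      using f(2) by (rule tendsto_mult_right_zero)
    ultimately show "(\<lambda>n. gagliardo s (c *\<^sub>R f n - c *\<^sub>R u) (c *\<^sub>R f n - c *\<^sub>R u)) \<longlonglongrightarrow> 0" by simp
  qed
qed

lemma H_lin [simp, intro]: "0 \<in> H" "u \<in> H \<Longrightarrow> v \<in> H \<Longrightarrow> u + v \<in> H" "u \<in> H \<Longrightarrow> v \<in> H \<Longrightarrow> u - v \<in> H"
   "u \<in> H \<Longrightarrow> a *\<^sub>R u \<in> H"
  using subspace_H by (auto intro: subspace_0 subspace_add subspace_diff subspace_scale)

lemma square_integrable: "u \<in> H \<Longrightarrow> integrable lborel (\<lambda>x. (u x)\<^sup>2)"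
  using poincare(1)[OF H_energy s(1) H_zero_ball] .

lemma product_integrable:
  assumes u: "u \<in> H" and v: "v \<in> H"
  shows "integrable lborel (\<lambda>x. u x * v x)"
proof (rule Bochner_Integration.integrable_bound)
  show "integrable lborel (\<lambda>x. (u x)\<^sup>2 + (v x)\<^sup>2)" using square_integrable u v by auto
  show "(\<lambda>x. u x * v x) \<in> borel_measurable lborel" using H_measurable[OF u] H_measurable[OF v] by simp
  have "\<bar>a * b\<bar> \<le> \<bar>a\<^sup>2 + b\<^sup>2\<bar>" for a b :: real
  proof -
    have "2 * (\<bar>a\<bar> * \<bar>b\<bar>) \<le> a\<^sup>2 + b\<^sup>2" using sum_squares_bound[of "\<bar>a\<bar>" "\<bar>b\<bar>"] by simp
    moreover have "0 \<le> \<bar>a\<bar> * \<bar>b\<bar>" by simp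
    ultimately show ?thesis unfolding abs_mult by linarith
  qed
  then show "AE x in lborel. norm (u x * v x) \<le> norm ((u x)\<^sup>2 + (v x)\<^sup>2)" by simp
qed

definition "l2 u v = (LINT x|lborel. u x * v x)" for u v :: "'a \<Rightarrow> real"

lemma set_integral_l2:
  assumes u: "u \<in> H" and v: "v \<in> H"
  shows "(LINT x:\<Omega>|lborel. u x * v x) = l2 u v"
  unfolding set_lebesgue_integral_def l2_def
proof (rule integral_cong_AE)
  show "AE x in lborel. indicator \<Omega> x *\<^sub>R (u x * v x) = u x * v x"
    using H_zero[OF u] by eventually_elim (auto simp: indicator_def)
qed (use open_\<Omega> H_measurable[OF u] H_measurable[OF v] in auto)

lemma semi_inner_l2: "semi_inner_form H l2"
proof
  fix u v w a
  assume uvw: "u \<in> H" "v \<in> H" "w \<in> H"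
  show "l2 (u + v) w = l2 u w + l2 v w"
    using product_integrable[OF uvw(1,3)] product_integrable[OF uvw(2,3)] by (simp add: l2_def algebra_simps)
qed (auto simp: subspace_H l2_def scaleR_fun_def mult.commute mult.left_commute intro!: Bochner_Integration.integral_nonneg)

lemma semi_inner_form_form: "semi_inner_form H (fractional_form s)"
proof
  fix u v w :: "'a \<Rightarrow> real" and a
  assume uvw: "u \<in> H" "v \<in> H" "w \<in> H"
  note e = uvw[THEN H_energy]
  show "fractional_form s (u + v) w = fractional_form s u w + fractional_form s v w"
    using e by (simp add: fractional_form_gagliardo gagliardo.add distrib_left)
next
  fix u v :: "'a \<Rightarrow> real" and a
  assume uv: "u \<in> H" "v \<in> H"
  note e = uv[THEN H_energy]
  show "fractional_form s u v = fractional_form s v u"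
    unfolding fractional_form_gagliardo using gagliardo.sym[OF e] by simp
next
  fix u v :: "'a \<Rightarrow> real" and a
  assume uv: "u \<in> H" "v \<in> H"
  note e = uv[THEN H_energy]
  show "fractional_form s (a *\<^sub>R u) v = a * fractional_form s u v"
    unfolding fractional_form_gagliardo using gagliardo.scale[OF e] by simp
next
  show "0 \<le> fractional_form s u u" for u :: "'a \<Rightarrow> real"
    unfolding fractional_form_gagliardo using ks_pos gagliardo_nonneg by (intro mult_nonneg_nonneg) auto
qed (rule subspace_H)

lemma l2_square: "l2 u u = (LINT x|lborel. (u x)\<^sup>2)"
  by (simp add: l2_def power2_eq_square)

lemma l2_poincare: "u \<in> H \<Longrightarrow> l2 u u \<le> poincare_constant TYPE('a) s * gagliardo s u u"
  unfolding l2_square by (rule poincare(2)[OF H_energy s(1) H_zero_ball])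

lemma l2_eq_0_iff: "u \<in> H \<Longrightarrow> l2 u u = 0 \<longleftrightarrow> (AE x in lborel. u x = 0)"
  unfolding l2_square using integral_nonneg_eq_0_iff_AE[OF square_integrable, of u] by simp

text \<open>The Poincare inequality turns an energy Cauchy sequence into one in L^2, of which a
  subsequence converges almost everywhere to some \<open>u\<close>. Fatou applied to
  \<open>f m - f (r k)\<close> in \<open>k\<close> then bounds the energy of
  \<open>f m - u\<close>.\<close>

lemma H_complete:
  assumes f: "\<And>n. f n \<in> H"
    and cauchy: "\<And>e. 0 < e \<Longrightarrow> \<exists>M. \<forall>m\<ge>M. \<forall>n\<ge>M. gagliardo s (f m - f n) (f m - f n) < e"
  shows "\<exists>u\<in>H. (\<lambda>n. gagliardo s (f n - u) (f n - u)) \<longlonglongrightarrow> 0"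
proof -
  define C where "C = poincare_constant TYPE('a) s"
  have C: "0 < C" unfolding C_def by (rule poincare_constant_pos)
  have "\<exists>M. \<forall>m\<ge>M. \<forall>n\<ge>M. (\<integral>\<^sup>+x. ennreal ((f m x - f n x)\<^sup>2) \<partial>lborel) \<le> ennreal e" if "0 < e" for e
  proof -
    from cauchy[of "e / C"] that C obtain M where M: "\<And>m n. m \<ge> M \<Longrightarrow> n \<ge> M \<Longrightarrow> gagliardo s (f m - f n) (f m - f n) < e / C"
      by auto
    have "(\<integral>\<^sup>+x. ennreal ((f m x - f n x)\<^sup>2) \<partial>lborel) \<le> ennreal e" if "m \<ge> M" "n \<ge> M" for m n
    proof -
      have d: "f m - f n \<in> H" using f by auto
      have "(\<integral>\<^sup>+x. ennreal ((f m x - f n x)\<^sup>2) \<partial>lborel) = ennreal (l2 (f m - f n) (f m - f n))"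
        unfolding l2_square using nn_integral_eq_integral[OF square_integrable[OF d]] by simp
      also have "\<dots> \<le> ennreal (C * (e / C))"
        using l2_poincare[OF d] M[OF that] C
        by (intro ennreal_leI) (smt (verit) C_def mult_left_mono)
      finally show ?thesis using C by simp
    qed
    then show ?thesis by blast
  qed
  from L2_Cauchy_AE_convergent[OF H_measurable[OF f] H_zero_ball[OF f] this]
  obtain r u where r: "strict_mono (r :: nat \<Rightarrow> nat)" and [measurable]: "u \<in> borel_measurable borel"
    and ae: "AE x in lborel. (\<lambda>k. f (r k) x) \<longlonglongrightarrow> u x" by blast
  have est: "f m - u \<in> energy_space s \<and> gagliardo s (f m - u) (f m - u) \<le> e"
    if M: "\<forall>m\<ge>M. \<forall>n\<ge>M. gagliardo s (f m - f n) (f m - f n) < e" and "m \<ge> M" and "0 < e" for m M e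
  proof -
    have "f m - f (r k) \<in> energy_space s" for k using f by (intro gagliardo.in_V H_energy)
    moreover have "f m - u \<in> borel_measurable borel"
      using H_measurable[OF f] by (simp add: fun_diff_def)
    moreover have "AE x in lborel. (\<lambda>k. (f m - f (r k)) x) \<longlonglongrightarrow> (f m - u) x"
      using ae by eventually_elim (auto intro: tendsto_intros)
    moreover have "gagliardo s (f m - f (r k)) (f m - f (r k)) \<le> e" if "k \<ge> M" for k
      using M \<open>m \<ge> M\<close> that seq_suble[OF r, of k] by (meson less_imp_le order_trans)
    ultimately show ?thesis using gagliardo_Fatou[of "\<lambda>k. f m - f (r k)" s "f m - u" M e] \<open>0 < e\<close> by auto
  qed
  from cauchy[of 1] obtain M1 where "\<forall>m\<ge>M1. \<forall>n\<ge>M1. gagliardo s (f m - f n) (f m - f n) < 1" by auto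
  from est[OF this order_refl] have d: "f M1 - u \<in> energy_space s" by simp
  \<comment> \<open>Fatou controls only differences; \<open>u\<close> itself has finite energy as a
    difference of two functions that do.\<close>
  have "f M1 - (f M1 - u) \<in> energy_space s" by (rule gagliardo.in_V(3)[OF H_energy[OF f] d])
  moreover have "f M1 - (f M1 - u) = u" by (simp add: fun_eq_iff)
  ultimately have u: "u \<in> energy_space s" by simp
  have lim: "(\<lambda>n. gagliardo s (f n - u) (f n - u)) \<longlonglongrightarrow> 0"
  proof (rule tendstoI)
    fix e :: real assume e: "0 < e"
    then obtain M where M: "\<forall>m\<ge>M. \<forall>n\<ge>M. gagliardo s (f m - f n) (f m - f n) < e / 2" using cauchy[of "e / 2"] by auto
    have "dist (gagliardo s (f n - u) (f n - u)) 0 < e" if "n \<ge> M" for n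
      using est[OF M that] e gagliardo_nonneg[of s "f n - u"] by auto
    then show "\<forall>\<^sub>F n in sequentially. dist (gagliardo s (f n - u) (f n - u)) 0 < e"
      by (auto simp: eventually_sequentially)
  qed
  have "AE x in lborel. \<forall>n. x \<notin> \<Omega> \<longrightarrow> f n x = 0"
    using H_zero[OF f] by (subst AE_all_countable) blast
  then have "AE x in lborel. x \<notin> \<Omega> \<longrightarrow> u x = 0"
    using ae
  proof eventually_elim
    case (elim x)
    show ?case
    proof
      assume "x \<notin> \<Omega>"
      with elim have "(\<lambda>k. 0) \<longlonglongrightarrow> u x" by simp
      then show "u x = 0" by (simp add: LIMSEQ_const_iff)
    qed
  qed
  from H_closed[OF u this f lim] lim show ?thesis by blast
qed

end

section \<open>Spectral theory on the domain and evaluation of the eigenvalues\<close>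

context fractional_domain
begin

lemma l2_bump_pos:
  assumes "0 < r" "cball a r \<subseteq> \<Omega>"
  shows "0 < l2 (bump a r) (bump a r)"
proof (rule ccontr)
  assume "\<not> 0 < l2 (bump a r) (bump a r)"
  moreover have "0 \<le> l2 (bump a r) (bump a r)"
    unfolding l2_def by (intro Bochner_Integration.integral_nonneg) simp
  ultimately have "l2 (bump a r) (bump a r) = 0" by simp
  then have "AE x in lborel. bump a r x = 0"
    using l2_eq_0_iff[OF smooth_in_H[OF bump_smooth[OF assms]]] by simp
  then have "AE x in lborel. x \<notin> ball a r"
    by (rule eventually_mono) (simp add: bump_eq_0_iff[OF assms(1)])
  then have "ball a r \<in> null_sets lborel" by (subst AE_iff_null_sets) auto
  then have "measure lborel (ball a r) = 0" by (simp add: measure_eq_0_null_sets)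
  with content_ball_pos[OF assms(1), of a] show False by simp
qed

lemma l2_disjoint_support: "(\<And>x. u x = 0 \<or> v x = 0) \<Longrightarrow> l2 u v = 0"
  unfolding l2_def by (subst Bochner_Integration.integral_cong[where g = "\<lambda>_. 0"]) auto

lemma infinitely_many_orthogonal:
  "\<exists>g. (\<forall>i<n::nat. g i \<in> H \<and> 0 < l2 (g i) (g i)) \<and> (\<forall>i<n. \<forall>j<n. i \<noteq> j \<longrightarrow> l2 (g i) (g j) = 0)"
proof -
  obtain a where "a \<in> \<Omega>" using nonempty by auto
  then obtain \<rho> where \<rho>: "0 < \<rho>" "cball a \<rho> \<subseteq> \<Omega>" using open_\<Omega> by (meson open_contains_cball)
  obtain e :: 'a where e: "norm e = 1" using vector_choose_size[of 1] by auto
  \<comment> \<open>Centres on a segment with spacing \<open>\<rho> / (2 n) = 2 r\<close>, so the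
    open balls of radius \<open>r\<close> are disjoint and lie in the ball of radius
    \<open>\<rho>\<close>.\<close>
  define t where "t i = \<rho> / 2 * (real i / real n)" for i
  define r where "r = \<rho> / (4 * real n)"
  define g where "g i = bump (a + t i *\<^sub>R e) r" for i
  show ?thesis
  proof (cases "n = 0")
    case False
    then have r: "0 < r" using \<rho> by (simp add: r_def)
    have sub: "cball (a + t i *\<^sub>R e) r \<subseteq> \<Omega>" if "i < n" for i
    proof -
      have "0 \<le> t i" "t i \<le> \<rho> / 2" using that \<rho> by (auto simp: t_def field_simps)
      moreover have "r \<le> \<rho> / 2" using False \<rho> by (simp add: r_def field_simps)
      ultimately have "dist a x \<le> \<rho>" if "dist (a + t i *\<^sub>R e) x \<le> r" for x
        using that dist_triangle[of a x "a + t i *\<^sub>R e"] e by (simp add: dist_norm)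
      then have "cball (a + t i *\<^sub>R e) r \<subseteq> cball a \<rho>" by auto
      with \<rho>(2) show ?thesis by auto
    qed
    have "l2 (g i) (g j) = 0" if "i \<noteq> j" for i j
    proof (rule l2_disjoint_support)
      fix x
      show "g i x = 0 \<or> g j x = 0"
      proof (rule ccontr)
        assume "\<not> (g i x = 0 \<or> g j x = 0)"
        then have "dist (a + t i *\<^sub>R e) x < r" "dist (a + t j *\<^sub>R e) x < r"
          unfolding g_def bump_eq_0_iff[OF r] by auto
        then have "dist (a + t i *\<^sub>R e) (a + t j *\<^sub>R e) < 2 * r"
          using dist_triangle2[of "a + t i *\<^sub>R e" "a + t j *\<^sub>R e" x] by linarith
        then have "\<bar>t i - t j\<bar> < 2 * r"
          using e by (simp add: dist_norm scaleR_diff_left[symmetric])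
        moreover have "\<bar>t i - t j\<bar> = \<rho> / (2 * real n) * \<bar>real i - real j\<bar>"
          using \<rho> False by (simp add: t_def right_diff_distrib[symmetric] diff_divide_distrib[symmetric] abs_mult)
        moreover have "\<bar>real i - real j\<bar> \<ge> 1" using that by linarith
        moreover have "\<rho> / (2 * real n) * 1 \<le> \<rho> / (2 * real n) * \<bar>real i - real j\<bar>"
          using \<rho> False \<open>\<bar>real i - real j\<bar> \<ge> 1\<close> by (intro mult_left_mono) auto
        ultimately show False by (simp add: r_def)
      qed
    qed
    moreover have "g i \<in> H \<and> 0 < l2 (g i) (g i)" if "i < n" for i
      unfolding g_def using smooth_in_H[OF bump_smooth[OF r sub[OF that]]] l2_bump_pos[OF r sub[OF that]] by simp
    ultimately show ?thesis by blast
  qed auto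
qed

sublocale spectral: spectral_pair H "fractional_form s" l2
  "poincare_constant TYPE('a) s * 2 / fractional_constant DIM('a) s"
proof (intro spectral_pair.intro spectral_pair_axioms.intro)
  show "semi_inner_form H (fractional_form s)" by (rule semi_inner_form_form)
  show "semi_inner_form H l2" by (rule semi_inner_l2)
  show "l2 u u \<le> poincare_constant TYPE('a) s * 2 / fractional_constant DIM('a) s * fractional_form s u u"
    if "u \<in> H" for u
    using l2_poincare[OF that] ks_pos by (simp add: fractional_form_gagliardo)
next
  fix f :: "nat \<Rightarrow> 'a \<Rightarrow> real"
  assume f: "\<And>n. f n \<in> H"
    and c: "\<And>e. 0 < e \<Longrightarrow> \<exists>M. \<forall>m\<ge>M. \<forall>n\<ge>M. fractional_form s (f m - f n) (f m - f n) < e"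
  have "\<exists>M. \<forall>m\<ge>M. \<forall>n\<ge>M. gagliardo s (f m - f n) (f m - f n) < e" if "0 < e" for e
    using c[of "fractional_constant DIM('a) s / 2 * e"] ks_pos that
    by (simp add: fractional_form_gagliardo)
  from H_complete[OF f this] obtain u where u: "u \<in> H" "(\<lambda>n. gagliardo s (f n - u) (f n - u)) \<longlonglongrightarrow> 0" by blast
  from tendsto_mult_right_zero[OF u(2)]
  have "(\<lambda>n. fractional_form s (f n - u) (f n - u)) \<longlonglongrightarrow> 0" unfolding fractional_form_gagliardo .
  with u(1) show "\<exists>l\<in>H. (\<lambda>n. fractional_form s (f n - l) (f n - l)) \<longlonglongrightarrow> 0" by blast
next
  fix f :: "nat \<Rightarrow> 'a \<Rightarrow> real" and D
  assume f: "\<And>n. f n \<in> H" and D: "\<And>n. fractional_form s (f n) (f n) \<le> D"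
  have "gagliardo s (f n) (f n) \<le> 2 * D / fractional_constant DIM('a) s" for n
    using D[of n] ks_pos by (simp add: fractional_form_gagliardo field_simps)
  from rellich_sequence[OF H_energy[OF f] s(1) H_zero_ball[OF f] this]
  show "\<exists>r::nat\<Rightarrow>nat. strict_mono r \<and>
      (\<forall>e>0. \<exists>M. \<forall>m\<ge>M. \<forall>n\<ge>M. l2 (f (r m) - f (r n)) (f (r m) - f (r n)) < e)"
    unfolding l2_square by simp
next
  show "\<exists>g. (\<forall>i<n::nat. g i \<in> H \<and> 0 < l2 (g i) (g i)) \<and> (\<forall>i<n. \<forall>j<n. i \<noteq> j \<longrightarrow> l2 (g i) (g j) = 0)" for n
    by (rule infinitely_many_orthogonal)
qed

lemma weak_solution_iff: "weak_solution s \<Omega> \<mu> u \<longleftrightarrow> spectral.eigenpair \<mu> u"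
  unfolding weak_solution_def spectral.eigenpair_def using set_integral_l2[of u] by auto

lemma lincomb_apply: "(\<Sum>i\<in>I. c i *\<^sub>R f i) x = (\<Sum>i\<in>I. c i * f i x)" for f :: "'i \<Rightarrow> 'a \<Rightarrow> real"
  by (simp add: sum_fun_apply scaleR_fun_def)

lemma AE_independent_iff:
  assumes "\<And>i. i < m \<Longrightarrow> f i \<in> H"
  shows "AE_independent m f \<longleftrightarrow> (\<forall>c. l2 (\<Sum>i<m. c i *\<^sub>R f i) (\<Sum>i<m. c i *\<^sub>R f i) = 0 \<longrightarrow> (\<forall>i<m. c i = 0))"
proof -
  have "(\<Sum>i<m. c i *\<^sub>R f i) \<in> H" for c :: "nat \<Rightarrow> real"
    using assms by (intro spectral.B.in_V(5) H_lin(4)) auto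
  then show ?thesis unfolding AE_independent_def by (simp add: l2_eq_0_iff lincomb_apply)
qed

context
  fixes e
  assumes e: "spectral.eigenbasis e"
begin

text \<open>The supremum is bounded by \<open>independent_eigenvectors_bound\<close> and attained by
  the basis vectors that belong to \<open>\<mu>\<close>.\<close>

lemma eigenvalue_multiplicity_eq:
  "eigenvalue_multiplicity s \<Omega> \<mu> = enat (card {k. fractional_form s (e k) (e k) = \<mu>})"
proof -
  define K where "K = {k. fractional_form s (e k) (e k) = \<mu>}"
  have finK: "finite K" unfolding K_def
    by (rule finite_subset[OF _ spectral.finite_eigenvalues_below[OF e, of \<mu>]]) auto
  have "enat m \<le> enat (card K)"
    if "AE_independent m f" "\<forall>i<m. weak_solution s \<Omega> \<mu> (f i)" for m f
  proof -
    have ep: "spectral.eigenpair \<mu> (f i)" if "i < m" for i using \<open>\<forall>i<m. _ i\<close> that by (simp add: weak_solution_iff)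
    then have "f i \<in> H" if "i < m" for i using that by (simp add: spectral.eigenpair_def)
    with that(1) have "\<And>c. l2 (\<Sum>i<m. c i *\<^sub>R f i) (\<Sum>i<m. c i *\<^sub>R f i) = 0 \<Longrightarrow> \<forall>i<m. c i = 0"
      using AE_independent_iff[of m f] by blast
    from spectral.independent_eigenvectors_bound[OF e ep this] show ?thesis by (simp add: K_def)
  qed
  moreover have "\<exists>f. AE_independent (card K) f \<and> (\<forall>i<card K. weak_solution s \<Omega> \<mu> (f i))"
  proof -
    obtain h where h: "bij_betw h {..<card K} K"
      using ex_bij_betw_nat_finite[OF finK] by (auto simp: atLeast0LessThan)
    have hK: "h i \<in> K" if "i < card K" for i using h that by (auto simp: bij_betw_def)
    have "AE_independent (card K) (\<lambda>i. e (h i))"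
    proof (subst AE_independent_iff)
      show "e (h i) \<in> H" for i by (rule spectral.eigenbasis_props(1)[OF e])
      show "\<forall>c. l2 (\<Sum>i<card K. c i *\<^sub>R e (h i)) (\<Sum>i<card K. c i *\<^sub>R e (h i)) = 0 \<longrightarrow> (\<forall>i<card K. c i = 0)"
      proof (intro allI impI)
        fix c :: "nat \<Rightarrow> real" and i
        assume 0: "l2 (\<Sum>i<card K. c i *\<^sub>R e (h i)) (\<Sum>i<card K. c i *\<^sub>R e (h i)) = 0" and i: "i < card K"
        define d where "d k = c (inv_into {..<card K} h k)" for k
        have dh: "d (h i) = c i" if "i < card K" for i
          using h that by (simp add: d_def bij_betw_inv_into_left)
        have "(\<Sum>i<card K. c i *\<^sub>R e (h i)) = (\<Sum>i<card K. d (h i) *\<^sub>R e (h i))"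
          using dh by (intro sum.cong) auto
        also have "\<dots> = (\<Sum>k\<in>K. d k *\<^sub>R e k)" by (rule sum.reindex_bij_betw[OF h])
        finally have "l2 (\<Sum>k\<in>K. d k *\<^sub>R e k) (\<Sum>k\<in>K. d k *\<^sub>R e k) = 0" using 0 by simp
        from spectral.eigenbasis_independent[OF e finK this hK[OF i]] dh[OF i] show "c i = 0" by simp
      qed
    qed
    moreover have "weak_solution s \<Omega> \<mu> (e (h i))" if "i < card K" for i
      using spectral.eigenbasis_props(2)[OF e, of "h i"] hK[OF that] unfolding weak_solution_iff K_def mem_Collect_eq by metis
    ultimately show ?thesis by blast
  qed
  ultimately show ?thesis
    unfolding eigenvalue_multiplicity_def K_def[symmetric] by (intro antisym Sup_least Sup_upper) auto
qed

text \<open>The basis values form an enumeration by \<open>eigenvalue_multiplicity_eq\<close>, and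
  the only one by \<open>mono_with_fibre_cards_unique\<close>. The index shift makes
  \<open>e 1\<close> the vector of the second eigenvalue.\<close>

lemma dirichlet_eigenvalue_eq:
  "dirichlet_eigenvalue j s \<Omega> = fractional_form s (e (j - 1)) (e (j - 1))"
proof -
  define L where "L k = fractional_form s (e k) (e k)" for k
  have mono: "mono L" unfolding L_def by (rule spectral.eigenvalues_mono[OF e])
  have fin: "finite {k. L k = \<mu>}" for \<mu> unfolding L_def
    by (rule finite_subset[OF _ spectral.finite_eigenvalues_below[OF e, of \<mu>]]) auto
  have card: "enat (card {k. L k = \<mu>}) = eigenvalue_multiplicity s \<Omega> \<mu>" for \<mu>
    unfolding L_def by (rule eigenvalue_multiplicity_eq[symmetric])
  have "(THE L. eigenvalue_enumeration s \<Omega> L) = L"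
  proof (rule the_equality)
    show "eigenvalue_enumeration s \<Omega> L" using mono fin card by (simp add: eigenvalue_enumeration_def)
    fix M assume M: "eigenvalue_enumeration s \<Omega> M"
    show "M = L"
      using M mono fin by (intro mono_with_fibre_cards_unique) (auto simp: eigenvalue_enumeration_def card[symmetric])
  qed
  then show ?thesis by (simp add: dirichlet_eigenvalue_def L_def)
qed

end

section \<open>Truncation and coordinate multiplication in the form domain\<close>

lemma smooth_Ck: "f \<in> smooth_compact_support \<Omega> \<Longrightarrow> Ck_function k f"
  unfolding smooth_compact_support_def by blast

lemma H_AE_subseq:
  assumes u: "u \<in> H" and f: "\<And>n. f n \<in> H" "(\<lambda>n. gagliardo s (f n - u) (f n - u)) \<longlonglongrightarrow> 0"
  shows "\<exists>r::nat\<Rightarrow>nat. strict_mono r \<and> (AE x in lborel. (\<lambda>n. f (r n) x) \<longlonglongrightarrow> u x)"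
proof -
  have d: "f n - u \<in> H" for n using u f by auto
  have "(\<lambda>n. LINT x|lborel. norm (((f n - u) x)\<^sup>2)) \<longlonglongrightarrow> 0"
  proof (rule tendsto_sandwich[OF _ _ tendsto_const])
    show "\<forall>\<^sub>F n in sequentially. (LINT x|lborel. norm (((f n - u) x)\<^sup>2)) \<le> poincare_constant TYPE('a) s * gagliardo s (f n - u) (f n - u)"
      using l2_poincare[OF d] by (simp add: l2_square)
    show "(\<lambda>n. poincare_constant TYPE('a) s * gagliardo s (f n - u) (f n - u)) \<longlonglongrightarrow> 0"
      using f(2) by (rule tendsto_mult_right_zero)
  qed simp
  from tendsto_L1_AE_subseq[OF square_integrable[OF d] this]
  obtain r where r: "strict_mono (r :: nat \<Rightarrow> nat)" "AE x in lborel. (\<lambda>n. ((f (r n) - u) x)\<^sup>2) \<longlonglongrightarrow> 0" by blast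
  from r(2) have "AE x in lborel. (\<lambda>n. f (r n) x) \<longlonglongrightarrow> u x"
  proof eventually_elim
    case (elim x)
    then have "(\<lambda>n. sqrt (((f (r n) - u) x)\<^sup>2)) \<longlonglongrightarrow> sqrt 0" by (rule tendsto_real_sqrt)
    then have "(\<lambda>n. f (r n) x - u x) \<longlonglongrightarrow> 0" by (simp add: tendsto_rabs_zero_iff)
    then show ?case by (simp add: LIM_zero_iff)
  qed
  with r(1) show ?thesis by blast
qed

text \<open>The approximants are \<open>smooth_abs (c n)\<close> of test functions with
  \<open>c n\<close> tending to 0, which are test functions again. Composition is nonlinear, so
  energy convergence does not transfer directly; a subsequence supplies the pointwise convergence
  that \<open>gagliardo_contraction_limit\<close> demands.\<close>

lemma H_abs:
  assumes u: "u \<in> H"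
  shows "(\<lambda>x. \<bar>u x\<bar>) \<in> H"
proof -
  obtain f0 where f0: "\<And>n::nat. f0 n \<in> smooth_compact_support \<Omega>" "(\<lambda>n. gagliardo s (f0 n - u) (f0 n - u)) \<longlonglongrightarrow> 0"
    using u by (auto simp: H_iff)
  obtain r where r: "strict_mono (r :: nat \<Rightarrow> nat)" "AE x in lborel. (\<lambda>n. f0 (r n) x) \<longlonglongrightarrow> u x"
    using H_AE_subseq[OF u smooth_in_H[OF f0(1)] f0(2)] by blast
  define f where "f n = f0 (r n)" for n
  have f: "f n \<in> smooth_compact_support \<Omega>" for n using f0 by (simp add: f_def)
  have fl: "(\<lambda>n. gagliardo s (f n - u) (f n - u)) \<longlonglongrightarrow> 0"
    using LIMSEQ_subseq_LIMSEQ[OF f0(2) r(1)] by (simp add: f_def o_def)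
  define c where "c n = 1 / real (Suc n)" for n
  have c: "0 < c n" for n by (simp add: c_def)
  have clim: "c \<longlonglongrightarrow> 0" unfolding c_def by (intro LIMSEQ_Suc[OF lim_1_over_n])
  define g where "g n = (\<lambda>x. smooth_abs (c n) (f n x))" for n
  have gs: "g n \<in> smooth_compact_support \<Omega>" for n
  proof (rule smooth_vanishing[OF f[of n]])
    show "Ck_function k (g n)" for k
      unfolding g_def by (rule Ck_function_compose[OF Ck_function_smooth_abs[OF c] smooth_Ck[OF f]])
    show "g n x = 0" if "f n x = 0" for x using smooth_abs_0[OF c[of n]] that unfolding g_def by simp
  qed
  have [measurable]: "u \<in> borel_measurable borel" using u by (rule H_measurable)
  have wm: "(\<lambda>x. \<bar>u x\<bar>) \<in> borel_measurable borel" by measurable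
  have wu: "\<bar>\<bar>u x\<bar> - \<bar>u y\<bar>\<bar> \<le> \<bar>u x - u y\<bar>" for x y by linarith
  have aeg: "AE x in lborel. (\<lambda>n. g n x) \<longlonglongrightarrow> \<bar>u x\<bar>"
    using r(2)
  proof eventually_elim
    case (elim x)
    have "(\<lambda>n. g n x - \<bar>f n x\<bar>) \<longlonglongrightarrow> 0"
      by (rule tendsto_rabs_zero_cancel, rule tendsto_sandwich[OF _ _ tendsto_const clim])
         (use smooth_abs_diff[OF less_imp_le[OF c]] in \<open>auto simp: g_def\<close>)
    moreover have "(\<lambda>n. \<bar>f n x\<bar>) \<longlonglongrightarrow> \<bar>u x\<bar>" using elim unfolding f_def by (rule tendsto_rabs)
    ultimately have "(\<lambda>n. (g n x - \<bar>f n x\<bar>) + \<bar>f n x\<bar>) \<longlonglongrightarrow> 0 + \<bar>u x\<bar>" by (rule tendsto_add)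
    then show ?case by simp
  qed
  have lim: "(\<lambda>n. gagliardo s (g n - (\<lambda>x. \<bar>u x\<bar>)) (g n - (\<lambda>x. \<bar>u x\<bar>))) \<longlonglongrightarrow> 0"
  proof (rule gagliardo_contraction_limit[OF smooth_energy[OF f] H_energy[OF u] fl r(2)[folded f_def]
        H_measurable[OF smooth_in_H[OF gs]] wm _ wu aeg])
    show "\<bar>g n x - g n y\<bar> \<le> \<bar>f n x - f n y\<bar>" for n x y
      unfolding g_def by (rule smooth_abs_Lipschitz)
  qed
  have e: "(\<lambda>x. \<bar>u x\<bar>) \<in> energy_space s" by (rule energy_contraction(1)[OF H_energy[OF u] wm wu])
  have z: "AE x in lborel. x \<notin> \<Omega> \<longrightarrow> \<bar>u x\<bar> = 0" using H_zero[OF u] by eventually_elim simp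
  show ?thesis by (rule H_closed[OF e z smooth_in_H[OF gs] lim])
qed

lemma H_parts:
  assumes u: "u \<in> H"
  shows "(\<lambda>x. max (u x) 0) \<in> H" "(\<lambda>x. max (- u x) 0) \<in> H"
proof -
  have "(\<lambda>x. max (u x) 0) = (1/2) *\<^sub>R ((\<lambda>x. \<bar>u x\<bar>) + u)" "(\<lambda>x. max (- u x) 0) = (1/2) *\<^sub>R ((\<lambda>x. \<bar>u x\<bar>) - u)"
    by (auto simp: fun_eq_iff scaleR_fun_def max_def)
  with H_abs[OF u] u show "(\<lambda>x. max (u x) 0) \<in> H" "(\<lambda>x. max (- u x) 0) \<in> H" by auto
qed

text \<open>Product rule: \<open>x_i w(x) - y_i w(y)\<close> is \<open>x_i (w(x) - w(y))\<close>
  plus \<open>w(y) (x - y)_i\<close>. The first term is a contraction in the unit ball; the second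
  gains two powers of the distance and is controlled by \<open>near_bound\<close> and the Poincare
  inequality. If one point leaves the ball, \<open>w\<close> vanishes there and the factor at the
  other point only shrinks.\<close>

lemma coordinate_mult_bound:
  assumes w: "w \<in> H" and i: "i \<in> Basis"
  shows "(\<lambda>x. (x \<bullet> i) * w x) \<in> energy_space s"
    "gagliardo s (\<lambda>x. (x \<bullet> i) * w x) (\<lambda>x. (x \<bullet> i) * w x)
      \<le> (2 + 2 * near_constant TYPE('a) s * poincare_constant TYPE('a) s) * gagliardo s w w"
proof -
  define q where "q = real DIM('a) + 2 * s - 2"
  define C where "C = near_constant TYPE('a) s"
  have C: "0 \<le> C" by (simp add: C_def near_constant_def)
  define g where "g x = (x \<bullet> i) * w x" for x
  have [measurable]: "w \<in> borel_measurable borel" using w by (rule H_measurable)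
  have [measurable]: "g \<in> borel_measurable borel" unfolding g_def by measurable
  define N where "N x y = ennreal (w y ^ 2) * (indicator (ball 0 1) x * indicator (ball 0 1) y * ennreal (norm (x - y) powr - q))" for x y
  have le: "ennreal (difference_kernel s g g (x, y)) \<le> 2 * ennreal (difference_kernel s w w (x, y)) + 2 * N x y"
    if wx: "x \<notin> ball 0 1 \<longrightarrow> w x = 0" and wy: "y \<notin> ball 0 1 \<longrightarrow> w y = 0" for x y
  proof (cases "x = y")
    case True
    then show ?thesis by (simp add: difference_kernel_apply)
  next
    case False
    define K where "K = norm (x - y) powr (real DIM('a) + 2 * s)"
    have K: "0 < K" using False by (simp add: K_def)
    have b: "(z \<bullet> i)\<^sup>2 \<le> 1" if "z \<in> ball 0 1" for z
    proof -
      have "\<bar>z \<bullet> i\<bar> \<le> \<bar>1\<bar>" using Basis_le_norm[OF i, of z] that by simp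
      then show ?thesis by (simp only: abs_le_square_iff one_power2)
    qed
    have dw: "difference_kernel s w w (x, y) = (w x - w y)\<^sup>2 / K" and dg: "difference_kernel s g g (x, y) = (g x - g y)\<^sup>2 / K"
      by (simp_all add: difference_kernel_apply K_def power2_eq_square)
    show ?thesis
    proof (cases "x \<in> ball 0 1 \<and> y \<in> ball 0 1")
      case True
      have sq: "(a + b)\<^sup>2 \<le> 2 * a\<^sup>2 + 2 * b\<^sup>2" for a b :: real
        using zero_le_power2[of "a - b"] by (simp add: power2_eq_square algebra_simps)
      have eq: "g x - g y = (x \<bullet> i) * (w x - w y) + w y * ((x - y) \<bullet> i)"
        by (simp add: g_def algebra_simps)
      have "(g x - g y)\<^sup>2 \<le> 2 * ((x \<bullet> i)\<^sup>2 * (w x - w y)\<^sup>2) + 2 * ((w y)\<^sup>2 * ((x - y) \<bullet> i)\<^sup>2)"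
        unfolding eq power_mult_distrib[symmetric] by (rule sq)
      also have "\<dots> \<le> 2 * (1 * (w x - w y)\<^sup>2) + 2 * ((w y)\<^sup>2 * (norm (x - y))\<^sup>2)"
      proof -
        have "((x - y) \<bullet> i)\<^sup>2 \<le> (norm (x - y))\<^sup>2"
          using Basis_le_norm[OF i, of "x - y"] by (simp add: abs_le_square_iff[symmetric])
        then show ?thesis using b[of x] True by (intro add_mono mult_left_mono mult_right_mono) auto
      qed
      finally have "difference_kernel s g g (x, y) \<le> 2 * difference_kernel s w w (x, y) + 2 * ((w y)\<^sup>2 * ((norm (x - y))\<^sup>2 / K))"
        unfolding dw dg using K by (simp add: field_simps)
      also have "(norm (x - y))\<^sup>2 / K = norm (x - y) powr - q"
        using False by (simp add: q_def K_def powr_diff)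
      finally have "ennreal (difference_kernel s g g (x, y))
          \<le> ennreal (2 * difference_kernel s w w (x, y) + 2 * ((w y)\<^sup>2 * norm (x - y) powr - q))" by (rule ennreal_leI)
      also have "\<dots> = 2 * ennreal (difference_kernel s w w (x, y)) + 2 * N x y"
        using True by (simp add: N_def ennreal_mult ennreal_plus)
      finally show ?thesis .
    next
      case False
      have "(g x - g y)\<^sup>2 \<le> (w x - w y)\<^sup>2"
      proof (cases "x \<in> ball 0 1")
        case True
        then have "w y = 0" using False wy by auto
        with b[OF True] show ?thesis by (simp add: g_def power_mult_distrib mult_left_le_one_le)
      next
        case nx: False
        then have "w x = 0" using wx by auto
        then show ?thesis
          using b[of y] wy by (cases "y \<in> ball 0 1") (auto simp: g_def power_mult_distrib mult_left_le_one_le)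
      qed
      then have "difference_kernel s g g (x, y) \<le> difference_kernel s w w (x, y)"
        unfolding dw dg using K by (simp add: divide_right_mono)
      then have "ennreal (difference_kernel s g g (x, y)) \<le> ennreal (difference_kernel s w w (x, y))" by (rule ennreal_leI)
      also have "\<dots> \<le> 2 * ennreal (difference_kernel s w w (x, y)) + 2 * N x y"
        by (simp add: mult_2 add_increasing2)
      finally show ?thesis .
    qed
  qed
  have Nm: "(\<lambda>z. N (fst z) (snd z)) \<in> borel_measurable (lborel \<Otimes>\<^sub>M lborel)" unfolding N_def by measurable
  have "(\<integral>\<^sup>+z. ennreal (difference_kernel s g g z) \<partial>(lborel \<Otimes>\<^sub>M lborel))
      \<le> (\<integral>\<^sup>+z. 2 * ennreal (difference_kernel s w w z) + 2 * N (fst z) (snd z) \<partial>(lborel \<Otimes>\<^sub>M lborel))"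
  proof (rule nn_integral_mono_AE)
    show "AE z in lborel \<Otimes>\<^sub>M lborel. ennreal (difference_kernel s g g z) \<le> 2 * ennreal (difference_kernel s w w z) + 2 * N (fst z) (snd z)"
      using AE_lborel_pairI(1)[OF H_zero_ball[OF w]] AE_lborel_pairI(2)[OF H_zero_ball[OF w]]
      by eventually_elim (use le in \<open>metis prod.collapse\<close>)
  qed
  also have "\<dots> = 2 * (\<integral>\<^sup>+z. ennreal (difference_kernel s w w z) \<partial>(lborel \<Otimes>\<^sub>M lborel)) + 2 * (\<integral>\<^sup>+z. N (fst z) (snd z) \<partial>(lborel \<Otimes>\<^sub>M lborel))"
  proof -
    have m1: "(\<lambda>z. ennreal (difference_kernel s w w z)) \<in> borel_measurable (lborel \<Otimes>\<^sub>M lborel)" by measurable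
    have m2: "(\<lambda>z. 2 * ennreal (difference_kernel s w w z)) \<in> borel_measurable (lborel \<Otimes>\<^sub>M lborel)" by measurable
    have m3: "(\<lambda>z. 2 * N (fst z) (snd z)) \<in> borel_measurable (lborel \<Otimes>\<^sub>M lborel)" using Nm by measurable
    show ?thesis
      unfolding nn_integral_add[OF m2 m3] nn_integral_cmult[OF m1] nn_integral_cmult[OF Nm] ..
  qed
  also have "(\<integral>\<^sup>+z. N (fst z) (snd z) \<partial>(lborel \<Otimes>\<^sub>M lborel)) = (\<integral>\<^sup>+x. \<integral>\<^sup>+y. N x y \<partial>lborel \<partial>lborel)"
    using lborel.nn_integral_fst[OF Nm] by simp
  also have "(\<integral>\<^sup>+z. ennreal (difference_kernel s w w z) \<partial>(lborel \<Otimes>\<^sub>M lborel)) = ennreal (gagliardo s w w)"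
    by (rule nn_integral_energy[OF H_energy[OF w]])
  also have "(\<integral>\<^sup>+x. \<integral>\<^sup>+y. N x y \<partial>lborel \<partial>lborel) \<le> ennreal C * (\<integral>\<^sup>+x. ennreal (w x ^ 2) \<partial>lborel)"
    unfolding N_def q_def C_def by (rule near_bound(2)[OF _ s dim]) measurable
  also have "(\<integral>\<^sup>+x. ennreal (w x ^ 2) \<partial>lborel) \<le> ennreal (poincare_constant TYPE('a) s * gagliardo s w w)"
    using l2_poincare[OF w] by (subst nn_integral_eq_integral[OF square_integrable[OF w]]) (auto simp: l2_square intro: ennreal_leI)
  finally have "(\<integral>\<^sup>+z. ennreal (difference_kernel s g g z) \<partial>(lborel \<Otimes>\<^sub>M lborel))
      \<le> 2 * ennreal (gagliardo s w w) + 2 * (ennreal C * ennreal (poincare_constant TYPE('a) s * gagliardo s w w))"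
    by (simp add: add_left_mono mult_left_mono)
  also have "\<dots> = ennreal ((2 + 2 * C * poincare_constant TYPE('a) s) * gagliardo s w w)"
    using C poincare_constant_pos[where 'a='a, of s] gagliardo_nonneg[of s w]
    by (simp add: ennreal_mult ennreal_plus algebra_simps)
  finally have fin: "(\<integral>\<^sup>+z. ennreal (difference_kernel s g g z) \<partial>(lborel \<Otimes>\<^sub>M lborel))
      \<le> ennreal ((2 + 2 * C * poincare_constant TYPE('a) s) * gagliardo s w w)" .
  have "0 \<le> (2 + 2 * C * poincare_constant TYPE('a) s) * gagliardo s w w"
    using C poincare_constant_pos[where 'a='a, of s] gagliardo_nonneg[of s w] by simp
  from energy_spaceI_bound[OF _ this fin]
  show "(\<lambda>x. (x \<bullet> i) * w x) \<in> energy_space s"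
    "gagliardo s (\<lambda>x. (x \<bullet> i) * w x) (\<lambda>x. (x \<bullet> i) * w x)
      \<le> (2 + 2 * near_constant TYPE('a) s * poincare_constant TYPE('a) s) * gagliardo s w w"
    by (simp_all add: g_def[abs_def] C_def)
qed

text \<open>Applied to differences, \<open>coordinate_mult_bound\<close> makes the multiplication
  continuous in energy, and it maps test functions to test functions.\<close>

lemma H_coordinate_mult:
  assumes u: "u \<in> H" and i: "i \<in> Basis"
  shows "(\<lambda>x. (x \<bullet> i) * u x) \<in> H"
proof -
  obtain f where f: "\<And>n::nat. f n \<in> smooth_compact_support \<Omega>" "(\<lambda>n. gagliardo s (f n - u) (f n - u)) \<longlonglongrightarrow> 0"
    using u by (auto simp: H_iff)
  define m where "m v = (\<lambda>x. (x \<bullet> i) * v x)" for v :: "'a \<Rightarrow> real"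
  have md: "m v - m w = m (v - w)" for v w by (simp add: m_def fun_eq_iff algebra_simps)
  define c where "c = 2 + 2 * near_constant TYPE('a) s * poincare_constant TYPE('a) s"
  have "m u \<in> H"
  proof (rule H_closed)
    show "m u \<in> energy_space s" unfolding m_def by (rule coordinate_mult_bound(1)[OF u i])
    show "AE x in lborel. x \<notin> \<Omega> \<longrightarrow> m u x = 0" using H_zero[OF u] by eventually_elim (simp add: m_def)
    show "m (f n) \<in> H" for n
      unfolding m_def by (intro smooth_in_H smooth_mult f Ck_function_linear bounded_linear_inner_left)
    show "(\<lambda>n. gagliardo s (m (f n) - m u) (m (f n) - m u)) \<longlonglongrightarrow> 0"
    proof (rule tendsto_sandwich[OF _ _ tendsto_const])
      have "gagliardo s (m (f n) - m u) (m (f n) - m u) \<le> c * gagliardo s (f n - u) (f n - u)" for n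
        unfolding md unfolding m_def c_def
        using coordinate_mult_bound(2)[OF H_lin(3)[OF smooth_in_H[OF f(1)[of n]] u] i] .
      then show "\<forall>\<^sub>F n in sequentially. gagliardo s (m (f n) - m u) (m (f n) - m u) \<le> c * gagliardo s (f n - u) (f n - u)" by simp
      show "(\<lambda>n. c * gagliardo s (f n - u) (f n - u)) \<longlonglongrightarrow> 0" using f(2) by (rule tendsto_mult_right_zero)
    qed (simp add: gagliardo_nonneg)
  qed
  then show ?thesis by (simp add: m_def)
qed

end

section \<open>Reflections\<close>

text \<open>Being its own inverse lets preimages be written as images and one-sided estimates be
  applied twice. All symmetries of the argument are reflections.\<close>

locale involutive_isometry =
  fixes T :: "'a::euclidean_space \<Rightarrow> 'a"
  assumes lin: "linear T" and norm_T [simp]: "norm (T x) = norm x" and TT [simp]: "T (T x) = x"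
begin

lemma bounded_linear_T: "bounded_linear T"
  using lin by (simp add: linear_conv_bounded_linear)

lemma measurable_T [measurable]: "T \<in> borel_measurable borel"
  by (intro borel_measurable_continuous_onI linear_continuous_on bounded_linear_T)

lemma dist_T [simp]: "dist (T x) (T y) = dist x y"
  by (simp add: dist_norm linear_diff[OF lin, symmetric])

lemma vimage_T: "T -` S = T ` S"
  by (auto intro: image_eqI[where x = "T _"])

lemma image_ball: "T ` ball a r = ball (T a) r"
proof -
  have "x \<in> T ` ball a r" if "dist (T a) x < r" for x
    using that dist_T[of a "T x"] by (intro image_eqI[of _ _ "T x"]) auto
  then show ?thesis by auto
qed

lemma inj_T: "inj T" by (metis TT injI)

text \<open>An isometry preserves the measure of balls, and by Vitali's theorem almost all of an open set
  is a disjoint union of balls.\<close>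

lemma emeasure_open_le:
  assumes U: "open U"
  shows "emeasure lborel U \<le> emeasure lborel (T -` U)"
proof -
  define K where "K = {(x, r). 0 < r \<and> ball x r \<subseteq> U}"
  obtain C where C: "countable C" "C \<subseteq> K"
      "pairwise (\<lambda>i j. disjnt (ball (fst i) (snd i)) (ball (fst j) (snd j))) C"
      "negligible (U - (\<Union>i\<in>C. ball (fst i) (snd i)))"
  proof (rule Vitali_covering_theorem_balls[where a = fst and r = snd and K = K and S = U])
    fix x and d :: real
    assume "x \<in> U" "0 < d"
    then obtain e where e: "0 < e" "ball x e \<subseteq> U" using U by (meson openE)
    have "(x, min e (d / 2)) \<in> K" using e \<open>0 < d\<close> by (auto simp: K_def)
    then show "\<exists>i. i \<in> K \<and> x \<in> ball (fst i) (snd i) \<and> snd i < d"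
      using e \<open>0 < d\<close> by (intro exI[of _ "(x, min e (d / 2))"]) auto
  qed blast
  define X where "X i = ball (fst i) (snd i)" for i :: "'a \<times> real"
  have XU: "X i \<subseteq> U" if "i \<in> C" for i
    using subsetD[OF C(2) that] by (simp add: K_def X_def case_prod_beta)
  have disj: "disjoint_family_on X C"
    using C(3) by (auto simp: disjoint_family_on_def pairwise_def disjnt_def X_def)
  have UX: "(\<Union>i\<in>C. X i) \<in> sets lborel" using C(1) by (intro sets.countable_UN') (auto simp: X_def)
  have "U - (\<Union>i\<in>C. X i) \<in> null_sets lborel"
  proof -
    have "U - (\<Union>i\<in>C. X i) \<in> sets lborel" using U UX by auto
    moreover have "U - (\<Union>i\<in>C. X i) \<in> null_sets lebesgue"
      using C(4) by (simp add: negligible_iff_null_sets X_def)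
    ultimately show ?thesis by (simp add: null_sets_def emeasure_completion)
  qed
  then have "emeasure lborel U \<le> emeasure lborel (\<Union>i\<in>C. X i)"
    using emeasure_Diff_null_set[of "U - (\<Union>i\<in>C. X i)" lborel U] U XU
    by (simp add: Diff_Diff_Int Int_absorb1 UN_least)
  also have "\<dots> = (\<integral>\<^sup>+i. emeasure lborel (X i) \<partial>count_space C)"
    by (rule emeasure_UN_countable[OF _ C(1) disj]) (simp add: X_def)
  also have "\<dots> = (\<integral>\<^sup>+i. emeasure lborel (T ` X i) \<partial>count_space C)"
    using C(2) by (intro nn_integral_cong) (auto simp: X_def image_ball emeasure_ball K_def)
  also have "\<dots> = emeasure lborel (\<Union>i\<in>C. T ` X i)"
  proof (rule emeasure_UN_countable[symmetric])
    show "disjoint_family_on (\<lambda>i. T ` X i) C"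
      using disj inj_T by (auto simp: disjoint_family_on_def image_Int[symmetric])
  qed (use C(1) in \<open>auto simp: X_def image_ball\<close>)
  also have "\<dots> \<le> emeasure lborel (T -` U)"
    using XU measurable_sets[OF measurable_T, of U] U
    unfolding vimage_T by (intro emeasure_mono) (auto simp: vimage_T)
  finally show ?thesis .
qed

text \<open>\<open>emeasure_open_le\<close> is applied to a box and to its preimage, whose preimage
  is the box again; agreement on boxes determines Lebesgue measure.\<close>

lemma distr_T: "distr lborel borel T = lborel"
proof (rule lborel_eqI[symmetric])
  fix l u :: 'a
  assume lu: "\<And>b. b \<in> Basis \<Longrightarrow> l \<bullet> b \<le> u \<bullet> b"
  have "continuous_on UNIV T" by (intro linear_continuous_on bounded_linear_T)
  then have op: "open (T -` box l u)" by (auto intro: open_vimage)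
  have "T -` T -` box l u = box l u" by auto
  with emeasure_open_le[OF op] emeasure_open_le[OF open_box, of l u]
  have "emeasure lborel (T -` box l u) = emeasure lborel (box l u)" by (intro antisym) auto
  then show "emeasure (distr lborel borel T) (box l u) = ennreal (\<Prod>b\<in>Basis. (u - l) \<bullet> b)"
    using lu by (simp add: emeasure_distr emeasure_lborel_box)
qed simp

lemma nn_integral_T:
  assumes [measurable]: "f \<in> borel_measurable borel"
  shows "(\<integral>\<^sup>+x. f (T x) \<partial>lborel) = (\<integral>\<^sup>+x. f x \<partial>lborel)"
proof -
  have "(\<integral>\<^sup>+x. f x \<partial>lborel) = (\<integral>\<^sup>+x. f x \<partial>(distr lborel borel T))" by (simp only: distr_T)
  also have "\<dots> = (\<integral>\<^sup>+x. f (T x) \<partial>lborel)" by (rule nn_integral_distr) simp_all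
  finally show ?thesis by simp
qed

lemma integral_T:
  fixes f :: "'a \<Rightarrow> real"
  assumes [measurable]: "f \<in> borel_measurable borel"
  shows "(LINT x|lborel. f (T x)) = (LINT x|lborel. f x)"
proof -
  have "(LINT x|lborel. f x) = (LINT x|(distr lborel borel T). f x)" by (simp only: distr_T)
  also have "\<dots> = (LINT x|lborel. f (T x))" by (rule integral_distr) simp_all
  finally show ?thesis by simp
qed

lemma AE_T:
  assumes "AE x in lborel. P x"
  shows "AE x in lborel. P (T x)"
proof -
  obtain N where N: "{x. \<not> P x} \<subseteq> N" "N \<in> null_sets lborel"
    using assms by (auto simp: eventually_ae_filter)
  have [measurable]: "N \<in> sets borel" using N(2) by auto
  have "AE x in lborel. x \<notin> N" using N(2) by (rule AE_not_in)
  then have "AE x in distr lborel borel T. x \<notin> N" by (simp only: distr_T)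
  then have "AE x in lborel. T x \<notin> N" by (subst (asm) AE_distr_iff) auto
  then show ?thesis by (rule eventually_mono) (use N(1) in auto)
qed

end

text \<open>The energy is an integral over pairs, so its invariance is a change of variables for
  \<open>T\<close> acting on both components.\<close>

lemma involutive_isometry_prod:
  assumes "involutive_isometry T"
  shows "involutive_isometry (map_prod T T)"
proof -
  interpret involutive_isometry T by fact
  show ?thesis
  proof (rule involutive_isometry.intro)
    show "linear (map_prod T T)"
      using lin by (auto simp: linear_iff map_prod_def split: prod.splits)
    show "norm (map_prod T T x) = norm x" for x by (cases x) (simp add: norm_Pair)
    show "map_prod T T (map_prod T T x) = x" for x by (cases x) simp
  qed
qed

text \<open>Reflection in the hyperplane orthogonal to \<open>w\<close>. For \<open>w = 0\<close>
  division by zero makes it the identity, so this case need not be excluded.\<close>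

definition householder :: "'a::euclidean_space \<Rightarrow> 'a \<Rightarrow> 'a" where
  "householder w x = x - (2 * (x \<bullet> w) / (w \<bullet> w)) *\<^sub>R w"

lemma involutive_isometry_householder: "involutive_isometry (householder w)"
proof (rule involutive_isometry.intro)
  show "linear (householder w)"
    by (auto simp: linear_iff householder_def inner_add_left algebra_simps add_divide_distrib)
  show "norm (householder w x) = norm x" for x
    by (cases "w = 0") (simp_all add: householder_def norm_eq inner_diff_left inner_diff_right inner_commute field_simps power2_eq_square)
  show "householder w (householder w x) = x" for x
    by (cases "w = 0") (simp_all add: householder_def inner_diff_left field_simps scaleR_add_left[symmetric])
qed

text \<open>For equal norms, twice the inner product of \<open>a\<close> and \<open>a - b\<close> is
  the squared norm of \<open>a - b\<close>, so the coefficient in the reflection is 1. Reflections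
  thus act transitively on each sphere.\<close>

lemma householder_maps:
  assumes "norm a = norm b"
  shows "householder (a - b) a = b"
proof (cases "a = b")
  case False
  have "a \<bullet> a = b \<bullet> b" using assms by (simp add: norm_eq)
  then have "(a - b) \<bullet> (a - b) = 2 * (a \<bullet> (a - b))"
    by (simp add: inner_diff_left inner_diff_right inner_commute)
  moreover have "(a - b) \<bullet> (a - b) \<noteq> 0" using False by simp
  ultimately have 1: "2 * (a \<bullet> (a - b)) / ((a - b) \<bullet> (a - b)) = 1" by (metis divide_self)
  show ?thesis unfolding householder_def 1 by simp
qed (simp add: householder_def)

lemma householder_Basis: "i \<in> Basis \<Longrightarrow> householder i x \<bullet> i = - (x \<bullet> i)"
  by (simp add: householder_def inner_diff_left)

section \<open>Energy of reflected and of disjointly supported functions\<close>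

lemma (in involutive_isometry) difference_kernel_T:
  "difference_kernel s (\<lambda>x. u (T x)) (\<lambda>x. v (T x)) z = difference_kernel s u v (map_prod T T z)"
  by (cases z) (simp add: difference_kernel_def linear_diff[OF lin, symmetric])

lemma (in involutive_isometry) gagliardo_T:
  assumes [measurable]: "u \<in> borel_measurable borel" "v \<in> borel_measurable borel"
  shows "gagliardo s (\<lambda>x. u (T x)) (\<lambda>x. v (T x)) = gagliardo s u v"
proof -
  interpret P: involutive_isometry "map_prod T T" by (intro involutive_isometry_prod) unfold_locales
  have "difference_kernel s u v \<in> borel_measurable (borel :: ('a \<times> 'a) measure)"
    using borel_measurable_difference_kernel[OF assms, of s] by (simp add: lborel_prod)
  from P.integral_T[OF this] show ?thesis
    by (simp add: gagliardo_def difference_kernel_T lborel_prod)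
qed

lemma (in involutive_isometry) energy_space_T:
  assumes u: "u \<in> energy_space s"
  shows "(\<lambda>x. u (T x)) \<in> energy_space s"
proof (rule energy_spaceI)
  interpret P: involutive_isometry "map_prod T T" by (intro involutive_isometry_prod) unfold_locales
  have [measurable]: "u \<in> borel_measurable borel" using u by (rule energy_space_measurable)
  show "(\<lambda>x. u (T x)) \<in> borel_measurable borel" by measurable
  have "(\<lambda>z. ennreal (difference_kernel s u u z)) \<in> borel_measurable (lborel \<Otimes>\<^sub>M lborel)"
    by measurable
  then have "(\<lambda>z. ennreal (difference_kernel s u u z)) \<in> borel_measurable (borel :: ('a \<times> 'a) measure)"
    by (simp add: lborel_prod)
  from P.nn_integral_T[OF this] nn_integral_energy[OF u]
  show "(\<integral>\<^sup>+z. ennreal (difference_kernel s (\<lambda>x. u (T x)) (\<lambda>x. u (T x)) z) \<partial>(lborel \<Otimes>\<^sub>M lborel)) < \<infinity>"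
    by (simp add: difference_kernel_T lborel_prod)
qed

text \<open>Disjoint supports reduce the numerator to \<open>- (u x * v y + u y * v x)\<close>. If
  its integral is zero, \<open>u x * v y\<close> vanishes almost everywhere, and Tonelli factors the
  double integral into the two masses.\<close>

lemma gagliardo_disjoint_nonneg:
  assumes u: "u \<in> energy_space s" and v: "v \<in> energy_space s"
    and u0: "AE x in lborel. 0 \<le> u x" and v0: "AE x in lborel. 0 \<le> v x"
    and uv: "AE x in lborel. u x * v x = 0"
  shows "gagliardo s u v \<le> 0"
    and "gagliardo s u v = 0 \<Longrightarrow> (AE x in lborel. u x = 0) \<or> (AE x in lborel. v x = 0)"
proof -
  have [measurable]: "u \<in> borel_measurable borel" "v \<in> borel_measurable borel"
    using u v energy_space_measurable by auto
  have eq: "AE z in lborel \<Otimes>\<^sub>M lborel. 0 \<le> u (fst z) \<and> 0 \<le> u (snd z) \<and> 0 \<le> v (fst z) \<and> 0 \<le> v (snd z)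
      \<and> u (fst z) * v (fst z) = 0 \<and> u (snd z) * v (snd z) = 0"
    using AE_lborel_pairI(1)[OF u0] AE_lborel_pairI(2)[OF u0] AE_lborel_pairI(1)[OF v0] AE_lborel_pairI(2)[OF v0]
      AE_lborel_pairI(1)[OF uv] AE_lborel_pairI(2)[OF uv]
    by eventually_elim auto
  have pw: "(u x - u y) * (v x - v y) = - (u x * v y + u y * v x)" if "u x * v x = 0" "u y * v y = 0" for x y
  proof -
    have "(u x - u y) * (v x - v y) = u x * v x + u y * v y - (u x * v y + u y * v x)"
      by (simp add: algebra_simps)
    then show ?thesis unfolding that by simp
  qed
  have neg: "AE z in lborel \<Otimes>\<^sub>M lborel. 0 \<le> - difference_kernel s u v z"
    using eq
  proof eventually_elim
    case (elim z)
    obtain x y where z: "z = (x, y)" by (cases z)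
    have "0 \<le> u x * v y + u y * v x" using elim by (simp add: z)
    moreover have "(u x - u y) * (v x - v y) = - (u x * v y + u y * v x)" using elim by (intro pw) (auto simp: z)
    ultimately have "difference_kernel s u v z \<le> 0"
      unfolding z difference_kernel_apply by (simp only: divide_nonpos_nonneg neg_le_0_iff_le powr_ge_zero)
    then show ?case by simp
  qed
  have int: "integrable (lborel \<Otimes>\<^sub>M lborel) (\<lambda>z. - difference_kernel s u v z)"
    using integrable_difference_kernel[OF u v] by simp
  have val: "(LINT z|(lborel \<Otimes>\<^sub>M lborel). - difference_kernel s u v z) = - gagliardo s u v"
    by (simp add: gagliardo_def)
  show "gagliardo s u v \<le> 0" using integral_nonneg_AE[OF neg] val by simp
  assume "gagliardo s u v = 0"
  then have "AE z in lborel \<Otimes>\<^sub>M lborel. - difference_kernel s u v z = 0"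
    using integral_nonneg_eq_0_iff_AE[OF int neg] val by simp
  then have "AE z in lborel \<Otimes>\<^sub>M lborel. ennreal (u (fst z)) * ennreal (v (snd z)) = 0"
    using eq
  proof eventually_elim
    case (elim z)
    obtain x y where z: "z = (x, y)" by (cases z)
    have "u x * v y = 0"
    \<comment> \<open>On the diagonal the kernel is 0 and carries no information; there
      \<open>u x * v x = 0\<close> is the hypothesis.\<close>
    proof (cases "x = y")
      case True
      then show ?thesis using elim by (simp add: z)
    next
      case False
      then have "(u x - u y) * (v x - v y) = 0" using elim by (simp add: z difference_kernel_apply)
      moreover have "(u x - u y) * (v x - v y) = - (u x * v y + u y * v x)" using elim by (intro pw) (auto simp: z)
      ultimately have "u x * v y + u y * v x = 0" by (metis neg_equal_0_iff_equal)
      moreover have "0 \<le> u x * v y" "0 \<le> u y * v x" using elim by (auto simp: z)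
      ultimately show ?thesis by linarith
    qed
    then show ?case by (auto simp: z)
  qed
  then have "0 = (\<integral>\<^sup>+z. ennreal (u (fst z)) * ennreal (v (snd z)) \<partial>(lborel \<Otimes>\<^sub>M lborel))"
    by (subst nn_integral_0_iff_AE[THEN iffD2]) auto
  also have "\<dots> = (\<integral>\<^sup>+x. \<integral>\<^sup>+y. ennreal (u x) * ennreal (v y) \<partial>lborel \<partial>lborel)"
    by (subst lborel.nn_integral_fst[symmetric]) auto
  also have "\<dots> = (\<integral>\<^sup>+x. ennreal (u x) \<partial>lborel) * (\<integral>\<^sup>+y. ennreal (v y) \<partial>lborel)"
    by (simp add: nn_integral_cmult nn_integral_multc)
  finally have "(\<integral>\<^sup>+x. ennreal (u x) \<partial>lborel) = 0 \<or> (\<integral>\<^sup>+y. ennreal (v y) \<partial>lborel) = 0" by auto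
  then have "(AE x in lborel. ennreal (u x) = 0) \<or> (AE x in lborel. ennreal (v x) = 0)"
    by (simp add: nn_integral_0_iff_AE)
  then show "(AE x in lborel. u x = 0) \<or> (AE x in lborel. v x = 0)"
  proof
    assume "AE x in lborel. ennreal (u x) = 0"
    with u0 have "AE x in lborel. u x = 0" by eventually_elim (simp add: ennreal_eq_0_iff)
    then show ?thesis ..
  next
    assume "AE x in lborel. ennreal (v x) = 0"
    with v0 have "AE x in lborel. v x = 0" by eventually_elim (simp add: ennreal_eq_0_iff)
    then show ?thesis ..
  qed
qed

section \<open>Sign and symmetry of eigenfunctions\<close>

context fractional_domain
begin

lemma H_reflect:
  assumes "involutive_isometry T" and T\<Omega>: "\<And>x. x \<in> \<Omega> \<Longrightarrow> T x \<in> \<Omega>" and u: "u \<in> H"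
  shows "(\<lambda>x. u (T x)) \<in> H"
proof -
  interpret involutive_isometry T by fact
  obtain f where f: "\<And>n::nat. f n \<in> smooth_compact_support \<Omega>" "(\<lambda>n. gagliardo s (f n - u) (f n - u)) \<longlonglongrightarrow> 0"
    using u by (auto simp: H_iff)
  show ?thesis
  proof (rule H_closed)
    show "(\<lambda>x. u (T x)) \<in> energy_space s" by (rule energy_space_T[OF H_energy[OF u]])
    show "AE x in lborel. x \<notin> \<Omega> \<longrightarrow> u (T x) = 0"
      using AE_T[OF H_zero[OF u]] by eventually_elim (metis T\<Omega> TT)
    show "(\<lambda>x. f n (T x)) \<in> H" for n
    proof (rule smooth_in_H)
      define S where "S = {x. f n x \<noteq> 0}"
      have S: "compact (closure S)" "closure S \<subseteq> \<Omega>"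
        using f(1)[of n] unfolding smooth_compact_support_def S_def by blast+
      have "continuous_on UNIV T" by (intro linear_continuous_on bounded_linear_T)
      then have c: "compact (T ` closure S)" by (intro compact_continuous_image S(1)) (auto intro: continuous_on_subset)
      have "{x. f n (T x) \<noteq> 0} = T -` S" by (auto simp: S_def)
      also have "\<dots> \<subseteq> T ` closure S" unfolding vimage_T using closure_subset by (intro image_mono)
      finally have cl: "closure {x. f n (T x) \<noteq> 0} \<subseteq> T ` closure S"
        using c by (intro closure_minimal compact_imp_closed)
      moreover have "T ` closure S \<subseteq> \<Omega>" using S(2) T\<Omega> by auto
      moreover have "Ck_function k (\<lambda>x. f n (T x))" for k
        using Ck_function_compose_affine[OF bounded_linear_T smooth_Ck[OF f(1)[of n]], of k 0] by simp
      ultimately show "(\<lambda>x. f n (T x)) \<in> smooth_compact_support \<Omega>"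
        using compact_closure_subset[OF c cl] unfolding smooth_compact_support_def by blast
    qed
    have "gagliardo s ((\<lambda>x. f n (T x)) - (\<lambda>x. u (T x))) ((\<lambda>x. f n (T x)) - (\<lambda>x. u (T x))) = gagliardo s (f n - u) (f n - u)" for n
    proof -
      have "f n - u \<in> borel_measurable borel" using H_measurable[OF H_lin(3)[OF smooth_in_H[OF f(1)] u]] .
      from gagliardo_T[OF this this] show ?thesis by (simp add: fun_diff_def)
    qed
    with f(2) show "(\<lambda>n. gagliardo s ((\<lambda>x. f n (T x)) - (\<lambda>x. u (T x))) ((\<lambda>x. f n (T x)) - (\<lambda>x. u (T x)))) \<longlonglongrightarrow> 0" by simp
  qed
qed

lemma l2_reflect:
  assumes "involutive_isometry T" and u: "u \<in> H" and v: "v \<in> H"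
  shows "l2 (\<lambda>x. u (T x)) (\<lambda>x. v (T x)) = l2 u v"
proof -
  interpret involutive_isometry T by fact
  have "(\<lambda>x. u x * v x) \<in> borel_measurable borel" using H_measurable[OF u] H_measurable[OF v] by simp
  from integral_T[OF this] show ?thesis by (simp add: l2_def)
qed

lemma form_reflect:
  assumes "involutive_isometry T" and u: "u \<in> H" and v: "v \<in> H"
  shows "fractional_form s (\<lambda>x. u (T x)) (\<lambda>x. v (T x)) = fractional_form s u v"
  using involutive_isometry.gagliardo_T[OF assms(1) H_measurable[OF u] H_measurable[OF v]]
  by (simp add: fractional_form_gagliardo)

lemma eigenpair_reflect:
  assumes T: "involutive_isometry T" and T\<Omega>: "\<And>x. x \<in> \<Omega> \<Longrightarrow> T x \<in> \<Omega>" and u: "spectral.eigenpair \<mu> u"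
  shows "spectral.eigenpair \<mu> (\<lambda>x. u (T x))"
  unfolding spectral.eigenpair_def
proof (intro conjI ballI)
  have uH: "u \<in> H" and ue: "\<And>v. v \<in> H \<Longrightarrow> fractional_form s u v = \<mu> * l2 u v"
    using u by (auto simp: spectral.eigenpair_def)
  show "(\<lambda>x. u (T x)) \<in> H" by (rule H_reflect[OF T T\<Omega> uH])
  fix v assume v: "v \<in> H"
  have Tv: "(\<lambda>x. v (T x)) \<in> H" by (rule H_reflect[OF T T\<Omega> v])
  \<comment> \<open>The reflection is moved to the test function, as \<open>v\<close> is the
    reflection of its own reflection.\<close>
  have v2: "v = (\<lambda>x. (\<lambda>x. v (T x)) (T x))" using T by (simp add: involutive_isometry_def)
  have "fractional_form s (\<lambda>x. u (T x)) v = fractional_form s u (\<lambda>x. v (T x))"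
    by (subst v2) (rule form_reflect[OF T uH Tv])
  moreover have "l2 (\<lambda>x. u (T x)) v = l2 u (\<lambda>x. v (T x))"
    by (subst v2) (rule l2_reflect[OF T uH Tv])
  ultimately show "fractional_form s (\<lambda>x. u (T x)) v = \<mu> * l2 (\<lambda>x. u (T x)) v" using ue[OF Tv] by simp
qed

definition one_signed :: "('a \<Rightarrow> real) \<Rightarrow> bool" where
  "one_signed u \<longleftrightarrow> (AE x in lborel. 0 \<le> u x) \<or> (AE x in lborel. u x \<le> 0)"

text \<open>Orthogonality to an eigenfunction makes the mutual energy vanish as well. With signs
  normalised, zero L^2 product means disjoint supports, and then zero mutual energy forces one
  function to vanish.\<close>

lemma one_signed_orthogonal:
  assumes u: "spectral.eigenpair \<mu> u" and v: "v \<in> H" and orth: "l2 u v = 0"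
    and "one_signed u" "one_signed v"
  shows "(AE x in lborel. u x = 0) \<or> (AE x in lborel. v x = 0)"
proof -
  have uH: "u \<in> H" and E0: "fractional_form s u v = 0" using u v orth by (auto simp: spectral.eigenpair_def)
  obtain a :: real where a: "a \<noteq> 0" "AE x in lborel. 0 \<le> (a *\<^sub>R u) x"
    using \<open>one_signed u\<close> that[of 1] that[of "-1"] by (auto simp: one_signed_def scaleR_fun_def)
  obtain b :: real where b: "b \<noteq> 0" "AE x in lborel. 0 \<le> (b *\<^sub>R v) x"
    using \<open>one_signed v\<close> that[of 1] that[of "-1"] by (auto simp: one_signed_def scaleR_fun_def)
  define u' v' where "u' = a *\<^sub>R u" and "v' = b *\<^sub>R v"
  have H: "u' \<in> H" "v' \<in> H" using uH v by (auto simp: u'_def v'_def)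
  have "l2 u' v' = 0"
    using spectral.B.scale[OF uH H(2), of a] spectral.B.scale_right[OF v uH, of b] orth by (simp add: u'_def v'_def)
  moreover have "AE x in lborel. 0 \<le> u' x * v' x" using a(2) b(2) unfolding u'_def v'_def by eventually_elim simp
  ultimately have "AE x in lborel. u' x * v' x = 0"
    using integral_nonneg_eq_0_iff_AE[OF product_integrable[OF H]] by (simp add: l2_def)
  moreover have "gagliardo s u' v' = 0"
  proof -
    have "fractional_form s u' v' = 0"
      using spectral.E.scale[OF uH H(2), of a] spectral.E.scale_right[OF v uH, of b] E0 by (simp add: u'_def v'_def)
    then show ?thesis using ks_pos by (simp add: fractional_form_gagliardo)
  qed
  ultimately have "(AE x in lborel. u' x = 0) \<or> (AE x in lborel. v' x = 0)"
    using a(2) b(2) H by (intro gagliardo_disjoint_nonneg(2)[of _ s] H_energy) (auto simp: u'_def v'_def)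
  then show ?thesis using a(1) b(1) by (simp add: u'_def v'_def scaleR_fun_def)
qed

lemma parts_relations:
  fixes u :: "'a \<Rightarrow> real"
  defines "p \<equiv> \<lambda>x. max (u x) 0" and "n \<equiv> \<lambda>x. max (- u x) 0"
  shows "p - n = u" "p + n = (\<lambda>x. \<bar>u x\<bar>)" "p x * n x = 0" "0 \<le> p x" "0 \<le> n x"
  by (auto simp: p_def n_def fun_eq_iff max_def)

lemma gagliardo_parts:
  assumes u: "u \<in> H"
  shows "gagliardo s (\<lambda>x. max (u x) 0) (\<lambda>x. max (- u x) 0) \<le> 0"
    "gagliardo s (\<lambda>x. max (u x) 0) (\<lambda>x. max (- u x) 0) = 0 \<Longrightarrow> one_signed u"
proof -
  note pn = H_parts[OF u, THEN H_energy]
  have ae: "AE x in lborel. 0 \<le> max (u x) 0" "AE x in lborel. 0 \<le> max (- u x) 0"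
    "AE x in lborel. max (u x) 0 * max (- u x) 0 = 0"
    by (auto simp: max_def)
  show "gagliardo s (\<lambda>x. max (u x) 0) (\<lambda>x. max (- u x) 0) \<le> 0"
    by (rule gagliardo_disjoint_nonneg(1)[OF pn ae])
  assume "gagliardo s (\<lambda>x. max (u x) 0) (\<lambda>x. max (- u x) 0) = 0"
  from gagliardo_disjoint_nonneg(2)[OF pn ae this] show "one_signed u"
    unfolding one_signed_def
  proof
    assume "AE x in lborel. max (u x) 0 = 0"
    then have "AE x in lborel. u x \<le> 0" by eventually_elim (simp add: max_def split: if_splits)
    then show "(AE x in lborel. 0 \<le> u x) \<or> (AE x in lborel. u x \<le> 0)" ..
  next
    assume "AE x in lborel. max (- u x) 0 = 0"
    then have "AE x in lborel. 0 \<le> u x" by eventually_elim (simp add: max_def split: if_splits)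
    then show "(AE x in lborel. 0 \<le> u x) \<or> (AE x in lborel. u x \<le> 0)" ..
  qed
qed

context
  fixes e
  assumes e: "spectral.eigenbasis e"
begin

abbreviation "ev n \<equiv> fractional_form s (e n) (e n)"

text \<open>Passing from \<open>u = p - n\<close> to \<open>|u| = p + n\<close> keeps the L^2 norm
  and changes the energy by four times the mutual energy of \<open>p\<close> and \<open>n\<close>,
  which is nonpositive. Minimality of the first value makes it zero.\<close>

lemma ground_state_one_signed:
  assumes u: "spectral.eigenpair (ev 0) u"
  shows "one_signed u"
proof -
  have uH: "u \<in> H" and ue: "fractional_form s u u = ev 0 * l2 u u"
    using u by (auto simp: spectral.eigenpair_def)
  define p n where "p = (\<lambda>x. max (u x) 0)" and "n = (\<lambda>x. max (- u x) 0)"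
  have pn: "p \<in> H" "n \<in> H" using H_parts[OF uH] by (auto simp: p_def n_def)
  have rel: "p - n = u" "p + n = (\<lambda>x. \<bar>u x\<bar>)" unfolding p_def n_def by (rule parts_relations)+
  have l2: "l2 (p + n) (p + n) = l2 u u" unfolding rel by (simp add: l2_def)
  have "ev 0 * l2 (p + n) (p + n) \<le> fractional_form s (p + n) (p + n)"
    by (rule spectral.eigenbasis_props(5)[OF e]) (use pn in auto)
  moreover have "fractional_form s (p + n) (p + n) = fractional_form s u u + 4 * fractional_form s p n"
    using spectral.E.square_add[OF pn] spectral.E.square_diff[OF pn] by (simp add: rel(1))
  ultimately have "0 \<le> fractional_form s p n" using l2 ue by simp
  then have "0 \<le> gagliardo s p n" using ks_pos by (simp add: fractional_form_gagliardo zero_le_mult_iff)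
  with gagliardo_parts[OF uH] show ?thesis by (simp add: p_def n_def)
qed

lemma basis_nontrivial: "\<not> (AE x in lborel. e n x = 0)"
  using l2_eq_0_iff[of "e n"] spectral.eigenbasis_props(1,3)[OF e, of n] by auto

text \<open>Equality would make \<open>e 1\<close> a ground state, hence one-signed, yet orthogonal
  to the one-signed \<open>e 0\<close>.\<close>

lemma ground_state_simple: "ev 0 < ev 1"
proof (rule ccontr)
  assume "\<not> ev 0 < ev 1"
  with monoD[OF spectral.eigenvalues_mono[OF e], of 0 1] have eq: "ev 1 = ev 0" by simp
  have e1: "spectral.eigenpair (ev 0) (e 1)" using spectral.eigenbasis_props(2)[OF e, of 1] unfolding eq .
  have "l2 (e 1) (e 0) = 0" by (rule spectral.eigenbasis_props(4)[OF e]) simp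
  from one_signed_orthogonal[OF e1 spectral.eigenbasis_props(1)[OF e] this ground_state_one_signed[OF e1]
      ground_state_one_signed[OF spectral.eigenbasis_props(2)[OF e]]] basis_nontrivial
  show False by blast
qed

text \<open>Orthogonality to \<open>e 0\<close> excludes a fixed sign by
  \<open>one_signed_orthogonal\<close>. Later this gives the positive part nonzero mass.\<close>

lemma second_eigenfunction_not_one_signed:
  assumes u: "spectral.eigenpair (ev 1) u" and nt: "\<not> (AE x in lborel. u x = 0)"
  shows "\<not> one_signed u"
proof
  assume os: "one_signed u"
  have "l2 u (e 0) = 0"
    using spectral.eigenpair_orthogonal[OF u spectral.eigenbasis_props(2)[OF e]] ground_state_simple by simp
  from one_signed_orthogonal[OF u spectral.eigenbasis_props(1)[OF e] this os
      ground_state_one_signed[OF spectral.eigenbasis_props(2)[OF e]]] nt basis_nontrivial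
  show False by blast
qed

text \<open>The ground state is even under every symmetry of the domain, so odd functions are orthogonal to it.\<close>

lemma odd_function_bound:
  assumes T: "involutive_isometry T" and T\<Omega>: "\<And>x. x \<in> \<Omega> \<Longrightarrow> T x \<in> \<Omega>"
    and w: "w \<in> H" and odd: "AE x in lborel. w (T x) = - w x"
  shows "ev 1 * l2 w w \<le> fractional_form s w w"
proof -
  interpret involutive_isometry T by fact
  have e0: "spectral.eigenpair (ev 0) (e 0)" "e 0 \<in> H" using spectral.eigenbasis_props(1,2)[OF e] by auto
  \<comment> \<open>An eigenfunction for the first value, hence one-signed, and odd under
    \<open>T\<close>; so it vanishes.\<close>
  define d where "d = e 0 - (\<lambda>x. e 0 (T x))"
  have d: "spectral.eigenpair (ev 0) d"
    unfolding d_def by (intro spectral.eigenpair_diff e0 eigenpair_reflect[OF T T\<Omega>])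
  have dT: "d (T x) = - d x" for x by (simp add: d_def)
  have "AE x in lborel. d x = 0"
    using ground_state_one_signed[OF d] unfolding one_signed_def
  proof
    assume *: "AE x in lborel. 0 \<le> d x"
    from AE_T[OF *] have "AE x in lborel. d x \<le> 0" by (simp add: dT)
    with * show ?thesis by eventually_elim simp
  next
    assume *: "AE x in lborel. d x \<le> 0"
    from AE_T[OF *] have "AE x in lborel. 0 \<le> d x" by (simp add: dT)
    with * show ?thesis by eventually_elim simp
  qed
  with odd have "AE x in lborel. w (T x) * e 0 (T x) = - (w x * e 0 x)"
    by eventually_elim (simp add: d_def)
  moreover have [measurable]: "w \<in> borel_measurable borel" "e 0 \<in> borel_measurable borel"
    using w e0(2) H_measurable by auto
  ultimately have "(LINT x|lborel. w (T x) * e 0 (T x)) = (LINT x|lborel. - (w x * e 0 x))"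
    by (intro integral_cong_AE) auto
  with l2_reflect[OF T w e0(2)] have "l2 w (e 0) = 0" by (simp add: l2_def)
  then show ?thesis
    using spectral.eigenbasis_props(5)[OF e w, of 1] by simp
qed

end

end

section \<open>Nets on spheres\<close>

lemma power_diff_bound:
  fixes a b :: real
  assumes "0 \<le> b" "b \<le> a" "a \<le> 2"
  shows "a ^ n - b ^ n \<le> real n * (a - b) * 2 ^ n"
proof (induction n)
  case (Suc n)
  have "a ^ Suc n - b ^ Suc n = a * (a ^ n - b ^ n) + (a - b) * b ^ n" by (simp add: algebra_simps)
  also have "\<dots> \<le> 2 * (real n * (a - b) * 2 ^ n) + (a - b) * 2 ^ n"
  proof (intro add_mono mult_left_mono)
    have "a * (a ^ n - b ^ n) \<le> 2 * (a ^ n - b ^ n)"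
      using assms by (intro mult_right_mono) (auto intro: power_mono)
    also have "\<dots> \<le> 2 * (real n * (a - b) * 2 ^ n)" using Suc by simp
    finally show "a * (a ^ n - b ^ n) \<le> 2 * (real n * (a - b) * 2 ^ n)" .
    show "b ^ n \<le> 2 ^ n" using assms by (intro power_mono) auto
  qed (use assms in auto)
  also have "\<dots> \<le> real (Suc n) * (a - b) * 2 ^ Suc n"
  proof -
    have "0 \<le> (a - b) * 2 ^ n" using assms by simp
    then show ?thesis by (simp add: algebra_simps)
  qed
  finally show ?case .
qed simp

lemma measure_ball_eq: "0 \<le> r \<Longrightarrow> measure lborel (ball (x::'a::euclidean_space) r) = unit_ball_vol (real DIM('a)) * r ^ DIM('a)"
  by (simp add: content_ball)

lemma emeasure_ball_neq_top [simp]: "emeasure lborel (ball (x::'a::euclidean_space) r) \<noteq> top"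
  using emeasure_lborel_ball_finite[of x r] by auto

text \<open>Volume packing: balls of radius \<open>r / 2\<close> about the points are disjoint and
  lie in the shell between \<open>q\<close> and \<open>p + r / 2\<close>. The choice
  \<open>q = 0\<close> gives a crude finite bound, \<open>q = p - r / 2\<close> the right order for
  a sphere.\<close>

lemma separated_card_bound:
  fixes Z :: "'a::euclidean_space set"
  assumes Z: "finite Z" "Z \<subseteq> sphere 0 p" and sep: "\<And>x y. x \<in> Z \<Longrightarrow> y \<in> Z \<Longrightarrow> x \<noteq> y \<Longrightarrow> r \<le> dist x y"
    and r: "0 < r" and p: "0 \<le> p" and q: "0 \<le> q" "q \<le> p - r / 2 \<or> q = 0"
  shows "real (card Z) * (r / 2) ^ DIM('a) \<le> (p + r / 2) ^ DIM('a) - q ^ DIM('a)"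
proof (cases "Z = {}")
  case True
  have "q ^ DIM('a) \<le> (p + r / 2) ^ DIM('a)" using q r p by (intro power_mono) auto
  with True show ?thesis by simp
next
  case False
  define \<omega> where "\<omega> = unit_ball_vol (real DIM('a))"
  have \<omega>: "0 < \<omega>" by (simp add: \<omega>_def)
  have disj: "disjoint_family_on (\<lambda>z. ball z (r / 2)) Z"
  proof (unfold disjoint_family_on_def, intro ballI impI)
    fix x y assume "x \<in> Z" "y \<in> Z" "x \<noteq> y"
    then have "r \<le> dist x y" by (rule sep)
    then show "ball x (r / 2) \<inter> ball y (r / 2) = {}"
      by (intro disjoint_ballI) simp
  qed
  have sub: "(\<Union>z\<in>Z. ball z (r / 2)) \<subseteq> ball 0 (p + r / 2) - ball 0 q"
  proof
    fix y assume "y \<in> (\<Union>z\<in>Z. ball z (r / 2))"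
    then obtain z where z: "z \<in> Z" "dist z y < r / 2" by auto
    then have "norm z = p" using Z(2) by auto
    moreover have "\<bar>norm z - norm y\<bar> < r / 2" using z(2) norm_triangle_ineq3[of z y] by (simp add: dist_norm)
    ultimately have "norm y < p + r / 2" "p - r / 2 < norm y" by linarith+
    then show "y \<in> ball 0 (p + r / 2) - ball 0 q" using q by auto
  qed
  have qp: "ball (0::'a) q \<subseteq> ball 0 (p + r / 2)" using q r p by (intro subset_ball) auto
  have "real (card Z) * (\<omega> * (r / 2) ^ DIM('a)) = (\<Sum>z\<in>Z. measure lborel (ball z (r / 2)))"
    using r by (simp add: measure_ball_eq \<omega>_def)
  also have "\<dots> = measure lborel (\<Union>z\<in>Z. ball z (r / 2))"
    using Z(1) disj by (intro measure_finite_Union[symmetric]) (auto simp: emeasure_lborel_ball_finite less_top[symmetric])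
  also have "\<dots> \<le> measure lborel (ball (0::'a) (p + r / 2) - ball 0 q)"
  proof (rule measure_mono_fmeasurable[OF sub])
    show "ball (0::'a) (p + r / 2) - ball 0 q \<in> fmeasurable lborel"
      by (intro fmeasurable_Diff) (auto simp: fmeasurable_def less_top[symmetric])
  qed (use Z(1) in auto)
  also have "\<dots> = measure lborel (ball (0::'a) (p + r / 2)) - measure lborel (ball (0::'a) q)"
    using qp by (intro measure_Diff) (auto simp: emeasure_lborel_ball_finite less_top[symmetric])
  also have "\<dots> = \<omega> * ((p + r / 2) ^ DIM('a) - q ^ DIM('a))"
    using q p r by (simp add: measure_ball_eq \<omega>_def right_diff_distrib)
  finally show ?thesis using \<omega> by (simp add: mult.left_commute[of _ \<omega>])
qed

text \<open>A separated set of maximal cardinality also covers, since an uncovered point could be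
  added; the packing bound makes a maximum exist.\<close>

lemma sphere_net:
  assumes r: "0 < r" and p: "0 < p"
  shows "\<exists>Z :: 'a::euclidean_space set. finite Z \<and> Z \<subseteq> sphere 0 p \<and>
    (\<forall>x\<in>Z. \<forall>y\<in>Z. x \<noteq> y \<longrightarrow> r \<le> dist x y) \<and> (\<forall>x\<in>sphere 0 p. \<exists>z\<in>Z. dist x z < r)"
proof -
  define P where "P Z \<longleftrightarrow> finite Z \<and> Z \<subseteq> sphere 0 p \<and> (\<forall>x\<in>Z. \<forall>y\<in>Z. x \<noteq> y \<longrightarrow> r \<le> dist x y)" for Z :: "'a set"
  obtain b :: nat where b: "(p + r / 2) ^ DIM('a) / (r / 2) ^ DIM('a) < real b" using reals_Archimedean2 by blast
  have "card Z < b" if "P Z" for Z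
  proof -
    have "real (card Z) * (r / 2) ^ DIM('a) \<le> (p + r / 2) ^ DIM('a) - 0 ^ DIM('a)"
      using that r p by (intro separated_card_bound) (auto simp: P_def)
    then have "real (card Z) \<le> (p + r / 2) ^ DIM('a) / (r / 2) ^ DIM('a)"
      using r by (simp add: field_simps zero_power[OF DIM_positive])
    with b show ?thesis by simp
  qed
  moreover have "P {}" by (simp add: P_def)
  ultimately obtain Z where Z: "P Z" and max: "\<And>Y. P Y \<Longrightarrow> card Y \<le> card Z"
    using ex_has_greatest_nat[of P "{}" card b] by (meson less_imp_le)
  have "\<exists>z\<in>Z. dist x z < r" if x: "x \<in> sphere 0 p" for x
  proof (rule ccontr)
    assume no: "\<not> (\<exists>z\<in>Z. dist x z < r)"
    then have "x \<notin> Z" using r by force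
    have "P (insert x Z)" using Z x no by (auto simp: P_def dist_commute not_less)
    from max[OF this] \<open>x \<notin> Z\<close> Z show False by (simp add: P_def)
  qed
  then have cov: "\<forall>x\<in>sphere 0 p. \<exists>z\<in>Z. dist x z < r" by (rule ballI)
  show ?thesis
    using Z[unfolded P_def] cov by (intro exI[of _ Z]) (elim conjE, intro conjI; assumption)
qed

lemma radial_projection:
  fixes y :: "'a::real_normed_vector"
  assumes "y \<noteq> 0" "0 \<le> p"
  shows "(p / norm y) *\<^sub>R y \<in> sphere 0 p" "dist y ((p / norm y) *\<^sub>R y) = \<bar>norm y - p\<bar>"
proof -
  show "(p / norm y) *\<^sub>R y \<in> sphere 0 p" using assms by simp
  have "y - (p / norm y) *\<^sub>R y = ((norm y - p) / norm y) *\<^sub>R y"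
    using assms by (simp add: scaleR_left_diff_distrib diff_divide_distrib)
  then show "dist y ((p / norm y) *\<^sub>R y) = \<bar>norm y - p\<bar>" using assms by (simp add: dist_norm)
qed

text \<open>The shell between \<open>p\<close> and \<open>p + r\<close> has volume at least of order
  \<open>r\<close> and, by radial projection to the sphere, is covered by balls of radius
  \<open>2 r\<close>. The bound \<open>1/4\<close> for \<open>p\<close> fixes the constant
  \<open>4^N\<close>.\<close>

lemma covering_card_bound:
  fixes Z :: "'a::euclidean_space set"
  assumes Z: "finite Z" and cov: "\<And>x. x \<in> sphere 0 p \<Longrightarrow> \<exists>z\<in>Z. dist x z < r"
    and r: "0 < r" and p: "1 / 4 \<le> p"
  shows "r / 4 ^ DIM('a) \<le> real (card Z) * (2 * r) ^ DIM('a)"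
proof -
  define \<omega> where "\<omega> = unit_ball_vol (real DIM('a))"
  have \<omega>: "0 < \<omega>" by (simp add: \<omega>_def)
  define N where "N = DIM('a)"
  have N: "0 < N" by (simp add: N_def)
  have sub: "ball 0 (p + r) - ball 0 p \<subseteq> (\<Union>z\<in>Z. ball z (2 * r))"
  proof
    fix y :: 'a assume y: "y \<in> ball 0 (p + r) - ball 0 p"
    then have "y \<noteq> 0" using p by auto
    note pr = radial_projection[OF this, of p]
    from pr(1) p obtain z where z: "z \<in> Z" "dist ((p / norm y) *\<^sub>R y) z < r" using cov by fastforce
    have "dist y ((p / norm y) *\<^sub>R y) < r" using pr(2) y p by auto
    with z(2) have "dist z y < 2 * r"
      using dist_triangle[of y z "(p / norm y) *\<^sub>R y"] by (simp add: dist_commute)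
    with z(1) show "y \<in> (\<Union>z\<in>Z. ball z (2 * r))" by auto
  qed
  have "(1/4) ^ N * r \<le> p ^ (N - 1) * r"
  proof -
    have "(1/4::real) ^ N \<le> (1/4) ^ (N - 1)" by (intro power_decreasing) auto
    also have "\<dots> \<le> p ^ (N - 1)" using p by (intro power_mono) auto
    finally show ?thesis using r by simp
  qed
  also have "p ^ (N - 1) * r = (p + r) * p ^ (N - 1) - p ^ N"
    using N by (simp add: power_eq_if algebra_simps)
  also have "\<dots> \<le> (p + r) ^ N - p ^ N"
  proof -
    have "(p + r) * p ^ (N - 1) \<le> (p + r) * (p + r) ^ (N - 1)"
      using p r by (intro mult_left_mono power_mono) auto
    then show ?thesis using N by (simp add: power_eq_if)
  qed
  finally have 1: "(1/4) ^ N * r \<le> (p + r) ^ N - p ^ N" .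
  have "\<omega> * ((p + r) ^ N - p ^ N) = measure lborel (ball (0::'a) (p + r)) - measure lborel (ball (0::'a) p)"
    using p r by (simp add: measure_ball_eq \<omega>_def N_def right_diff_distrib)
  also have "\<dots> = measure lborel (ball (0::'a) (p + r) - ball 0 p)"
    using r by (intro measure_Diff[symmetric] subset_ball) (auto simp: emeasure_lborel_ball_finite less_top[symmetric])
  also have "\<dots> \<le> measure lborel (\<Union>z\<in>Z. ball z (2 * r))"
  proof (rule measure_mono_fmeasurable[OF sub])
    show "(\<Union>z\<in>Z. ball z (2 * r)) \<in> fmeasurable lborel"
      using Z by (intro fmeasurable.finite_UN) (auto simp: fmeasurable_def less_top[symmetric])
  qed auto
  also have "\<dots> \<le> (\<Sum>z\<in>Z. measure lborel (ball z (2 * r)))"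
    using Z by (intro measure_subadditive_finite) (auto simp: emeasure_lborel_ball_finite less_top[symmetric])
  also have "\<dots> = \<omega> * (real (card Z) * (2 * r) ^ N)"
    using r by (simp add: measure_ball_eq \<omega>_def N_def)
  finally have "(p + r) ^ N - p ^ N \<le> real (card Z) * (2 * r) ^ N" using \<omega> by simp
  moreover have "(1/4) ^ N * r = r / 4 ^ N" by (simp add: power_one_over)
  ultimately show ?thesis using 1 unfolding N_def by linarith
qed

section \<open>Local averages of radial functions\<close>

text \<open>Radiality up to null sets: the exceptional set may depend on the reflection.\<close>

definition rotation_invariant :: "('a::euclidean_space \<Rightarrow> real) \<Rightarrow> bool" where
  "rotation_invariant u \<longleftrightarrow> u \<in> borel_measurable borel \<and> (\<forall>w. AE x in lborel. u (householder w x) = u x)"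

definition mass :: "('a::euclidean_space \<Rightarrow> real) \<Rightarrow> 'a \<Rightarrow> real \<Rightarrow> ennreal" where
  "mass u x r = (\<integral>\<^sup>+y. ennreal (u y) * indicator (ball x r) y \<partial>lborel)"

lemma mass_rotate:
  assumes u: "rotation_invariant u" and ab: "norm a = norm b"
  shows "mass u a r = mass u b r"
proof -
  define T where "T = householder (a - b)"
  interpret involutive_isometry T unfolding T_def by (rule involutive_isometry_householder)
  have [measurable]: "u \<in> borel_measurable borel" using u by (simp add: rotation_invariant_def)
  have Ta: "T a = b" unfolding T_def by (rule householder_maps[OF ab])
  have "mass u b r = (\<integral>\<^sup>+y. ennreal (u (T y)) * indicator (ball b r) (T y) \<partial>lborel)"
    unfolding mass_def by (rule nn_integral_T[symmetric]) measurable
  also have "\<dots> = (\<integral>\<^sup>+y. ennreal (u y) * indicator (ball a r) y \<partial>lborel)"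
  proof (rule nn_integral_cong_AE)
    have ae: "AE y in lborel. u (T y) = u y" using u by (simp add: rotation_invariant_def T_def)
    have ind: "indicator (ball b r) (T y) = (indicator (ball a r) y :: ennreal)" for y
      unfolding Ta[symmetric] by (simp add: indicator_def)
    show "AE y in lborel. ennreal (u (T y)) * indicator (ball b r) (T y) = ennreal (u y) * indicator (ball a r) y"
      using ae by eventually_elim (simp only: ind)
  qed
  finally show ?thesis by (simp add: mass_def)
qed

text \<open>Disjoint rotated copies of a ball carry the same mass.\<close>

lemma mass_upper:
  fixes u :: "'a::euclidean_space \<Rightarrow> real"
  assumes u: "rotation_invariant u" and x: "1 / 4 \<le> norm x" and r: "0 < r"
  shows "mass u x r * ennreal (2 * r) \<le> ennreal ((16 * r) ^ DIM('a)) * (\<integral>\<^sup>+y. ennreal (u y) \<partial>lborel)"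
proof -
  have [measurable]: "u \<in> borel_measurable borel" using u by (simp add: rotation_invariant_def)
  define p where "p = norm x"
  have p: "0 < p" "1 / 4 \<le> p" using x by (auto simp: p_def)
  \<comment> \<open>Separation \<open>2 r\<close> makes the balls of radius \<open>r\<close>
    disjoint; covering at the same scale bounds their number from below.\<close>
  obtain Z :: "'a set" where Z: "finite Z" "Z \<subseteq> sphere 0 p"
    and sep': "\<forall>x\<in>Z. \<forall>y\<in>Z. x \<noteq> y \<longrightarrow> 2 * r \<le> dist x y"
    and cov': "\<forall>x\<in>sphere 0 p. \<exists>z\<in>Z. dist x z < 2 * r"
  proof -
    have "0 < 2 * r" using r by simp
    from sphere_net[OF this p(1), where 'a = 'a] show thesis by (elim exE conjE) (rule that)
  qed
  note sep = sep'[rule_format] and cov = cov'[rule_format]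
  have "2 * r / 4 ^ DIM('a) \<le> real (card Z) * (2 * (2 * r)) ^ DIM('a)"
    using covering_card_bound[OF Z(1) cov] r p by simp
  then have card: "2 * r \<le> real (card Z) * (16 * r) ^ DIM('a)"
  proof -
    \<comment> \<open>Origin of 16: the covering balls have radius \<open>2 (2 r)\<close>, and
      \<open>covering_card_bound\<close> adds a factor 4 per dimension.\<close>
    have "(2 * (2 * r)) ^ DIM('a) * 4 ^ DIM('a) = (16 * r) ^ DIM('a)"
      unfolding power_mult_distrib[symmetric] by simp
    moreover have "2 * r \<le> real (card Z) * (2 * (2 * r)) ^ DIM('a) * 4 ^ DIM('a)"
      using \<open>2 * r / 4 ^ DIM('a) \<le> _\<close> by (simp only: pos_divide_le_eq zero_less_power zero_less_numeral)
    ultimately show ?thesis by (simp only: mult.assoc)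
  qed
  have "of_nat (card Z) * mass u x r = (\<Sum>z\<in>Z. mass u z r)"
  proof -
    have "mass u z r = mass u x r" if "z \<in> Z" for z
      using that Z(2) by (intro mass_rotate[OF u]) (auto simp: p_def)
    then show ?thesis by simp
  qed
  also have "\<dots> = (\<integral>\<^sup>+y. (\<Sum>z\<in>Z. ennreal (u y) * indicator (ball z r) y) \<partial>lborel)"
    unfolding mass_def by (rule nn_integral_sum[symmetric]) measurable
  also have "\<dots> \<le> (\<integral>\<^sup>+y. ennreal (u y) \<partial>lborel)"
  proof (intro nn_integral_mono)
    fix y
    show "(\<Sum>z\<in>Z. ennreal (u y) * indicator (ball z r) y) \<le> ennreal (u y)"
    proof (cases "\<exists>z\<in>Z. y \<in> ball z r")
      case True
      then obtain z0 where z0: "z0 \<in> Z" "y \<in> ball z0 r" by auto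
      have "y \<notin> ball z r" if "z \<in> Z" "z \<noteq> z0" for z
        using sep[OF z0(1) that(1)] that(2) z0(2) dist_triangle2[of z0 z y] by auto
      then have "(\<Sum>z\<in>Z. ennreal (u y) * indicator (ball z r) y) = (\<Sum>z\<in>Z. if z = z0 then ennreal (u y) else 0)"
        using z0 by (intro sum.cong) auto
      then show ?thesis using Z(1) z0 by simp
    next
      case False
      then have "(\<Sum>z\<in>Z. ennreal (u y) * indicator (ball z r) y) = 0" by (intro sum.neutral) auto
      then show ?thesis by simp
    qed
  qed
  finally have le: "of_nat (card Z) * mass u x r \<le> (\<integral>\<^sup>+y. ennreal (u y) \<partial>lborel)" .
  have "mass u x r * ennreal (2 * r) \<le> mass u x r * ennreal (real (card Z) * (16 * r) ^ DIM('a))"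
    by (intro mult_left_mono ennreal_leI card) auto
  also have "\<dots> = ennreal ((16 * r) ^ DIM('a)) * (of_nat (card Z) * mass u x r)"
    using r by (simp add: ennreal_mult mult_ac ennreal_of_nat_eq_real_of_nat)
  also have "\<dots> \<le> ennreal ((16 * r) ^ DIM('a)) * (\<integral>\<^sup>+y. ennreal (u y) \<partial>lborel)"
    by (intro mult_left_mono le) auto
  finally show ?thesis .
qed

text \<open>Rotated copies of a ball cover the annulus.\<close>

lemma mass_lower:
  fixes u :: "'a::euclidean_space \<Rightarrow> real"
  assumes u: "rotation_invariant u" and \<delta>: "0 < \<delta>" "\<delta> \<le> 1 / 2"
    and zero: "AE y in lborel. \<not> (1 - \<delta> < norm y \<and> norm y < 1) \<longrightarrow> u y = 0"
    and x: "1 - \<delta> < norm x" "norm x < 1"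
  shows "ennreal (\<delta> ^ DIM('a)) * (\<integral>\<^sup>+y. ennreal (u y) \<partial>lborel)
    \<le> ennreal (real DIM('a) * 4 ^ DIM('a) * \<delta>) * mass u x (2 * \<delta>)"
proof -
  have [measurable]: "u \<in> borel_measurable borel" using u by (simp add: rotation_invariant_def)
  define N where "N = DIM('a)"
  define p where "p = norm x"
  have p: "1 - \<delta> < p" "p < 1" "0 < p" "1 / 2 < p" using x \<delta> by (auto simp: p_def)
  \<comment> \<open>A point of the annulus is within \<open>\<delta>\<close> of its projection to
    the sphere through \<open>x\<close>, and that within \<open>\<delta>\<close> of the net; hence
    balls of radius \<open>2 \<delta>\<close>.\<close>
  obtain Z :: "'a set" where Z: "finite Z" "Z \<subseteq> sphere 0 p"
    and sep': "\<forall>x\<in>Z. \<forall>y\<in>Z. x \<noteq> y \<longrightarrow> \<delta> \<le> dist x y"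
    and cov': "\<forall>x\<in>sphere 0 p. \<exists>z\<in>Z. dist x z < \<delta>"
  proof -
    have "0 < \<delta>" using \<delta> by simp
    from sphere_net[OF this p(3), where 'a = 'a] show thesis by (elim exE conjE) (rule that)
  qed
  note sep = sep'[rule_format] and cov = cov'[rule_format]
  \<comment> \<open>The thin shell has volume of order \<open>\<delta>\<close>, so the net has only
    about \<open>\<delta>^(1 - N)\<close> points instead of \<open>\<delta>^(- N)\<close>.\<close>
  have "real (card Z) * (\<delta> / 2) ^ N \<le> (p + \<delta> / 2) ^ N - (p - \<delta> / 2) ^ N"
    unfolding N_def using \<delta> p by (intro separated_card_bound Z sep) auto
  also have "\<dots> \<le> real N * ((p + \<delta> / 2) - (p - \<delta> / 2)) * 2 ^ N"
    using \<delta> p by (intro power_diff_bound) auto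
  finally have *: "real (card Z) * (\<delta> / 2) ^ N \<le> real N * (p + \<delta> / 2 - (p - \<delta> / 2)) * 2 ^ N" .
  have card: "real (card Z) * \<delta> ^ N \<le> real N * 4 ^ N * \<delta>"
  proof -
    have 4: "(2::real) ^ N * 2 ^ N = 4 ^ N" unfolding power_mult_distrib[symmetric] by simp
    have "real (card Z) * \<delta> ^ N = real (card Z) * (\<delta> / 2) ^ N * 2 ^ N" by (simp add: power_divide)
    also have "\<dots> \<le> real N * (p + \<delta> / 2 - (p - \<delta> / 2)) * 2 ^ N * 2 ^ N"
      using * by (intro mult_right_mono) auto
    also have "\<dots> = real N * 4 ^ N * \<delta>" unfolding 4[symmetric] by (simp add: field_simps)
    finally show ?thesis .
  qed
  have "(\<integral>\<^sup>+y. ennreal (u y) \<partial>lborel) \<le> (\<integral>\<^sup>+y. (\<Sum>z\<in>Z. ennreal (u y) * indicator (ball z (2 * \<delta>)) y) \<partial>lborel)"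
  proof (rule nn_integral_mono_AE)
    show "AE y in lborel. ennreal (u y) \<le> (\<Sum>z\<in>Z. ennreal (u y) * indicator (ball z (2 * \<delta>)) y)"
      using zero
    proof eventually_elim
      case (elim y)
      show ?case
      proof (cases "1 - \<delta> < norm y \<and> norm y < 1")
        case True
        then have "y \<noteq> 0" using \<delta> by auto
        note pr = radial_projection[OF this, of p]
        obtain z where z: "z \<in> Z" "dist ((p / norm y) *\<^sub>R y) z < \<delta>" using pr(1) p cov by fastforce
        have "dist y ((p / norm y) *\<^sub>R y) < \<delta>" using pr(2) True p by auto
        with z(2) have "dist z y < 2 * \<delta>"
          using dist_triangle[of y z "(p / norm y) *\<^sub>R y"] by (simp add: dist_commute)
        then have "ennreal (u y) = ennreal (u y) * indicator (ball z (2 * \<delta>)) y" by simp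
        also have "\<dots> \<le> (\<Sum>z\<in>Z. ennreal (u y) * indicator (ball z (2 * \<delta>)) y)"
          using Z(1) z(1) by (intro member_le_sum) auto
        finally show ?thesis .
      qed (use elim in simp)
    qed
  qed
  also have "\<dots> = (\<Sum>z\<in>Z. mass u z (2 * \<delta>))"
    unfolding mass_def by (rule nn_integral_sum) measurable
  also have "\<dots> = of_nat (card Z) * mass u x (2 * \<delta>)"
  proof -
    have "mass u z (2 * \<delta>) = mass u x (2 * \<delta>)" if "z \<in> Z" for z
      using that Z(2) by (intro mass_rotate[OF u]) (auto simp: p_def)
    then show ?thesis by simp
  qed
  finally have "ennreal (\<delta> ^ N) * (\<integral>\<^sup>+y. ennreal (u y) \<partial>lborel) \<le> ennreal (\<delta> ^ N) * (of_nat (card Z) * mass u x (2 * \<delta>))"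
    by (intro mult_left_mono) auto
  also have "\<dots> = ennreal (real (card Z) * \<delta> ^ N) * mass u x (2 * \<delta>)"
    using \<delta> by (simp add: ennreal_mult mult_ac ennreal_of_nat_eq_real_of_nat)
  also have "\<dots> \<le> ennreal (real N * 4 ^ N * \<delta>) * mass u x (2 * \<delta>)"
    by (intro mult_right_mono ennreal_leI card) auto
  finally show ?thesis by (simp add: N_def)
qed

section \<open>Scaling\<close>

lemma integral_lborel_affine:
  fixes f :: "'b::euclidean_space \<Rightarrow> real"
  assumes [measurable]: "f \<in> borel_measurable borel" and c: "0 < c"
  shows "(LINT x|lborel. f x) = c ^ DIM('b) * (LINT x|lborel. f (t + c *\<^sub>R x))"
proof -
  have "(LINT x|lborel. f x) = (LINT x|density (distr lborel borel (\<lambda>x. t + c *\<^sub>R x)) (\<lambda>_. ennreal (\<bar>c\<bar> ^ DIM('b))). f x)"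
    using lborel_affine[of c t] c by simp
  also have "\<dots> = (LINT x|distr lborel borel (\<lambda>x. t + c *\<^sub>R x). (\<bar>c\<bar> ^ DIM('b)) *\<^sub>R f x)"
    by (rule integral_density) auto
  also have "\<dots> = (LINT x|lborel. (\<bar>c\<bar> ^ DIM('b)) *\<^sub>R f (t + c *\<^sub>R x))"
    by (rule integral_distr) auto
  finally show ?thesis using c by simp
qed

text \<open>Dilation of pairs: the Jacobian contributes \<open>c^(2 N)\<close> and the kernel
  \<open>c^(- N - 2 s)\<close>.\<close>

lemma gagliardo_scale:
  fixes u :: "'a::euclidean_space \<Rightarrow> real"
  assumes [measurable]: "u \<in> borel_measurable borel" and c: "0 < c"
  shows "gagliardo s (\<lambda>x. u ((1 / c) *\<^sub>R (x - a))) (\<lambda>x. u ((1 / c) *\<^sub>R (x - a)))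
    = c powr (real DIM('a) - 2 * s) * gagliardo s u u"
proof -
  define v where "v x = u ((1 / c) *\<^sub>R (x - a))" for x
  have [measurable]: "v \<in> borel_measurable borel" unfolding v_def by measurable
  define p where "p = real DIM('a) + 2 * s"
  have m: "difference_kernel s v v \<in> borel_measurable (borel :: ('a \<times> 'a) measure)"
    using borel_measurable_difference_kernel[of v v s] by (simp add: lborel_prod)
  have sc: "difference_kernel s v v ((a, a) + c *\<^sub>R z) = c powr - p * difference_kernel s u u z" for z
  proof -
    obtain x y where z: "z = (x, y)" by (cases z)
    have "norm ((a + c *\<^sub>R x) - (a + c *\<^sub>R y)) = c * norm (x - y)"
      using c by (simp add: scaleR_diff_right[symmetric])
    moreover have "c powr - p = inverse (c powr (real DIM('a) + 2 * s))" unfolding p_def by (rule powr_minus)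
    ultimately show ?thesis using c
      by (simp add: z difference_kernel_apply v_def powr_mult divide_inverse mult_ac)
  qed
  from integral_lborel_affine[OF m c, of "(a, a)"]
  have "gagliardo s v v = c ^ (2 * DIM('a)) * (LINT z|lborel. difference_kernel s v v ((a, a) + c *\<^sub>R z))"
    by (simp add: gagliardo_def lborel_prod mult_2)
  also have "(LINT z|lborel. difference_kernel s v v ((a, a) + c *\<^sub>R z)) = c powr - p * gagliardo s u u"
    unfolding sc by (simp add: gagliardo_def lborel_prod)
  also have "c ^ (2 * DIM('a)) * (c powr - p * gagliardo s u u) = c powr (real DIM('a) - 2 * s) * gagliardo s u u"
  proof -
    have "c ^ (2 * DIM('a)) * c powr - p = c powr real (2 * DIM('a)) * c powr - p"
      by (subst powr_realpow[OF c]) (rule refl)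
    also have "\<dots> = c powr (real (2 * DIM('a)) + - p)" by (rule powr_add[symmetric])
    also have "real (2 * DIM('a)) + - p = real DIM('a) - 2 * s" by (simp add: p_def)
    finally show ?thesis by (metis mult.assoc)
  qed
  finally show ?thesis by (simp add: v_def[abs_def])
qed

section \<open>Thin annuli\<close>

definition annulus :: "real \<Rightarrow> 'a::euclidean_space set" where
  "annulus \<tau> = ball 0 1 - closure (ball 0 \<tau>)"

lemma annulus_iff: "0 < \<tau> \<Longrightarrow> x \<in> annulus \<tau> \<longleftrightarrow> \<tau> < norm x \<and> norm x < 1"
  by (auto simp: annulus_def closure_ball)

lemma fractional_domain_annulus:
  assumes "0 < s" "s < 1" "2 \<le> DIM('a::euclidean_space)" "0 < \<tau>" "\<tau> < 1"
  shows "fractional_domain s (annulus \<tau> :: 'a set)"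
proof
  show "open (annulus \<tau> :: 'a set)" by (simp add: annulus_def open_Diff)
  obtain e :: 'a where "norm e = (1 + \<tau>) / 2" using vector_choose_size[of "(1 + \<tau>) / 2"] assms by auto
  then have "e \<in> annulus \<tau>" using assms by (simp add: annulus_iff)
  then show "annulus \<tau> \<noteq> ({} :: 'a set)" by auto
  show "annulus \<tau> \<subseteq> ball (0::'a) 1" by (auto simp: annulus_def)
qed (use assms in auto)

text \<open>The bound \<open>1 / 2 \<le> \<tau>\<close> keeps the annulus away from the origin,
  which makes norms bounded below there.\<close>

locale annulus_domain = fractional_domain s "annulus \<tau> :: 'a::euclidean_space set" for s \<tau> +
  fixes e :: "nat \<Rightarrow> 'a::euclidean_space \<Rightarrow> real"
  assumes \<tau>: "1 / 2 \<le> \<tau>" "\<tau> < 1" and e: "spectral.eigenbasis e"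
begin

definition "\<delta> = 1 - \<tau>"
text \<open>The second eigenvalue in the normalisation of \<open>gagliardo\<close>.\<close>

definition "\<mu> = 2 * fractional_form s (e 1) (e 1) / fractional_constant DIM('a) s"

lemma \<delta>: "0 < \<delta>" "\<delta> \<le> 1 / 2" using \<tau> by (auto simp: \<delta>_def)

lemma annulus_iff': "x \<in> annulus \<tau> \<longleftrightarrow> 1 - \<delta> < norm x \<and> norm x < 1"
  using \<tau> by (simp add: annulus_iff \<delta>_def)

lemma householder_annulus: "x \<in> annulus \<tau> \<Longrightarrow> householder w x \<in> annulus \<tau>"
  by (simp add: annulus_iff' involutive_isometry.norm_T[OF involutive_isometry_householder])

lemma odd_bound:
  assumes w: "w \<in> H" and odd: "AE x in lborel. w (householder i x) = - w x"
  shows "\<mu> * l2 w w \<le> gagliardo s w w"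
proof -
  have "fractional_form s (e 1) (e 1) * l2 w w \<le> fractional_form s w w"
    by (rule odd_function_bound[OF e involutive_isometry_householder householder_annulus w odd])
  also have "\<dots> = fractional_constant DIM('a) s / 2 * gagliardo s w w" by (rule fractional_form_gagliardo)
  finally show ?thesis using ks_pos by (simp add: \<mu>_def field_simps)
qed

lemma eigen_gagliardo:
  assumes \<phi>: "spectral.eigenpair (fractional_form s (e 1) (e 1)) \<phi>" and v: "v \<in> H"
  shows "gagliardo s \<phi> v = \<mu> * l2 \<phi> v"
proof -
  have "fractional_form s \<phi> v = fractional_form s (e 1) (e 1) * l2 \<phi> v"
    using \<phi> v unfolding spectral.eigenpair_def by blast
  then show ?thesis using ks_pos by (simp add: \<mu>_def fractional_form_gagliardo field_simps)
qed

text \<open>The test function is a bump of the width of the annulus minus its mirror image.\<close>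

lemma second_eigenvalue_bound:
  fixes i :: 'a
  assumes i: "i \<in> Basis"
  defines "G \<equiv> gagliardo s (bump (0::'a) 1) (bump 0 1)" and "m \<equiv> LINT x|lborel. (bump (0::'a) 1 x)\<^sup>2"
  shows "0 < m" "\<mu> \<le> 2 * G / m * (\<delta> / 4) powr - (2 * s)"
proof -
  \<comment> \<open>A quarter of the width, with the centre on the middle sphere, keeps the closed
    ball inside the annulus.\<close>
  define \<rho> where "\<rho> = \<delta> / 4"
  have \<rho>: "0 < \<rho>" using \<delta> by (simp add: \<rho>_def)
  define a where "a = (1 - \<delta> / 2) *\<^sub>R i"
  have na: "norm a = 1 - \<delta> / 2" using i \<delta> by (simp add: a_def)
  \<comment> \<open>A dilated unit bump rather than \<open>bump a \<rho>\<close>, since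
    \<open>flat_exp\<close> does not scale; its energy and norm follow from those of one fixed
    function. \<open>bump a \<rho>\<close> has the same zeros and serves for the support and for
    positivity.\<close>
  define \<beta> where "\<beta> x = bump 0 1 ((1 / \<rho>) *\<^sub>R (x - a))" for x
  have \<beta>0: "\<beta> x = 0 \<longleftrightarrow> x \<notin> ball a \<rho>" for x
    unfolding \<beta>_def bump_eq_0_iff[OF zero_less_one] mem_ball_0 norm_scaleR using \<rho>
    by (simp add: mem_ball dist_norm norm_minus_commute pos_divide_less_eq)
  have sub: "cball a \<rho> \<subseteq> annulus \<tau>"
  proof
    fix x assume "x \<in> cball a \<rho>"
    then have "\<bar>norm a - norm x\<bar> \<le> \<rho>" using norm_triangle_ineq3[of a x] by (simp add: dist_norm)
    then have "1 - \<delta> < norm x" "norm x < 1" using \<delta> na unfolding \<rho>_def by linarith+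
    then show "x \<in> annulus \<tau>" by (simp add: annulus_iff')
  qed
  have bs: "bump a \<rho> \<in> smooth_compact_support (annulus \<tau>)" by (rule bump_smooth[OF \<rho> sub])
  have \<beta>s: "\<beta> \<in> smooth_compact_support (annulus \<tau>)"
  proof (rule smooth_vanishing[OF bs])
    have lin: "bounded_linear (\<lambda>x::'a. (1 / \<rho>) *\<^sub>R x)" by (rule bounded_linear_scaleR_right)
    have eq: "\<beta> = (\<lambda>x. bump 0 1 ((- (1 / \<rho>) *\<^sub>R a) + (1 / \<rho>) *\<^sub>R x))"
      by (simp add: \<beta>_def fun_eq_iff algebra_simps)
    show "Ck_function k \<beta>" for k
      unfolding eq by (rule Ck_function_compose_affine[OF lin Ck_function_bump])
    show "bump a \<rho> x = 0 \<Longrightarrow> \<beta> x = 0" for x using \<beta>0 bump_eq_0_iff[OF \<rho>] by blast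
  qed
  have \<beta>H: "\<beta> \<in> H" by (rule smooth_in_H[OF \<beta>s])
  have [measurable]: "\<beta> \<in> borel_measurable borel" by (rule H_measurable[OF \<beta>H])
  have bm: "bump (0::'a) 1 \<in> borel_measurable borel"
    using Ck_function_bump[of 0 "0::'a" 1] by (intro borel_measurable_continuous_onI) simp
  have l2\<beta>: "l2 \<beta> \<beta> = \<rho> ^ DIM('a) * m"
  proof -
    have "(\<lambda>x. (\<beta> x)\<^sup>2) \<in> borel_measurable borel" by measurable
    from integral_lborel_affine[OF this \<rho>, of a] show ?thesis
      using \<rho> by (simp add: l2_square m_def \<beta>_def)
  qed
  have l2pos: "0 < l2 \<beta> \<beta>"
  proof (rule ccontr)
    assume "\<not> 0 < l2 \<beta> \<beta>"
    with spectral.B.nonneg[OF \<beta>H] have "l2 \<beta> \<beta> = 0" by simp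
    then have "AE x in lborel. \<beta> x = 0" using l2_eq_0_iff[OF \<beta>H] by simp
    then have "AE x in lborel. bump a \<rho> x = 0"
      by (rule eventually_mono) (use \<beta>0 bump_eq_0_iff[OF \<rho>] in blast)
    then have "l2 (bump a \<rho>) (bump a \<rho>) = 0" using l2_eq_0_iff[OF smooth_in_H[OF bs]] by simp
    with l2_bump_pos[OF \<rho> sub] show False by simp
  qed
  then show m: "0 < m" using \<rho> by (simp add: l2\<beta> zero_less_mult_iff)
  have gag\<beta>: "gagliardo s \<beta> \<beta> = \<rho> powr (real DIM('a) - 2 * s) * G"
    unfolding \<beta>_def[abs_def] G_def by (rule gagliardo_scale[OF bm \<rho>])
  define T where "T = householder i"
  have T: "involutive_isometry T" unfolding T_def by (rule involutive_isometry_householder)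
  interpret T: involutive_isometry T by (rule T)
  define \<beta>' where "\<beta>' x = \<beta> (T x)" for x
  have \<beta>'H: "\<beta>' \<in> H"
    unfolding \<beta>'_def using householder_annulus by (intro H_reflect[OF T _ \<beta>H]) (simp add: T_def)
  have disj: "\<beta> x = 0 \<or> \<beta>' x = 0" for x
  proof (rule ccontr)
    \<comment> \<open>The ball lies in the half space of positive \<open>i\<close>-coordinate, its
      mirror image in the negative one.\<close>
    have side: "0 < y \<bullet> i" if "y \<in> ball a \<rho>" for y
    proof -
      have "\<bar>(a - y) \<bullet> i\<bar> < \<rho>" using Basis_le_norm[OF i, of "a - y"] that by (simp add: dist_norm)
      moreover have "a \<bullet> i = 1 - \<delta> / 2" using i by (simp add: a_def)
      ultimately show ?thesis using \<delta> unfolding inner_diff_left \<rho>_def by linarith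
    qed
    assume "\<not> (\<beta> x = 0 \<or> \<beta>' x = 0)"
    then have "x \<in> ball a \<rho>" "T x \<in> ball a \<rho>" unfolding \<beta>'_def \<beta>0 by auto
    from side[OF this(1)] side[OF this(2)] show False by (simp add: T_def householder_Basis[OF i])
  qed
  define w where "w = \<beta> - \<beta>'"
  have wH: "w \<in> H" using \<beta>H \<beta>'H by (auto simp: w_def)
  have "l2 \<beta>' \<beta>' = l2 \<beta> \<beta>" unfolding \<beta>'_def by (rule l2_reflect[OF T \<beta>H \<beta>H])
  then have l2w: "l2 w w = 2 * l2 \<beta> \<beta>"
    unfolding w_def spectral.B.square_diff[OF \<beta>H \<beta>'H] using l2_disjoint_support[of \<beta> \<beta>', OF disj] by simp
  have "gagliardo s \<beta>' \<beta>' = gagliardo s \<beta> \<beta>"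
    unfolding \<beta>'_def by (rule T.gagliardo_T) measurable
  \<comment> \<open>A crude factor 4 from the parallelogram law; against the squared norm
    \<open>2 * l2 \<beta> \<beta>\<close> it produces the factor 2 in the bound.\<close>
  then have gw: "gagliardo s w w \<le> 4 * gagliardo s \<beta> \<beta>"
    using gagliardo.parallelogram[OF H_energy[OF \<beta>H] H_energy[OF \<beta>'H]] gagliardo_nonneg[of s "\<beta> + \<beta>'"]
    by (simp add: w_def)
  have "w (T x) = - w x" for x by (simp add: w_def \<beta>'_def)
  then have "\<mu> * l2 w w \<le> gagliardo s w w" unfolding T_def by (intro odd_bound[OF wH, of i] AE_I2)
  with gw l2w have "\<mu> * (2 * (\<rho> ^ DIM('a) * m)) \<le> 4 * (\<rho> powr (real DIM('a) - 2 * s) * G)"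
    by (simp only: l2\<beta> gag\<beta>)
  also have "\<rho> powr (real DIM('a) - 2 * s) = \<rho> ^ DIM('a) * \<rho> powr - (2 * s)"
    using \<rho> by (simp add: powr_diff powr_realpow powr_minus divide_inverse)
  finally have "(\<rho> ^ DIM('a) * 2) * (\<mu> * m) \<le> (\<rho> ^ DIM('a) * 2) * (2 * G * \<rho> powr - (2 * s))"
    by (simp add: mult_ac)
  then have "\<mu> * m \<le> 2 * G * \<rho> powr - (2 * s)" using \<rho> by (simp only: mult_le_cancel_left_pos mult_pos_pos zero_less_power zero_less_numeral)
  then show "\<mu> \<le> 2 * G / m * (\<delta> / 4) powr - (2 * s)" using m by (simp add: \<rho>_def field_simps)
qed

lemma H_integrable:
  assumes u: "u \<in> H"
  shows "integrable lborel u"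
proof (rule Bochner_Integration.integrable_bound)
  show "integrable lborel (\<lambda>x. indicator (ball 0 1) x + (u x)\<^sup>2)"
    using square_integrable[OF u] by (intro Bochner_Integration.integrable_add integrable_real_indicator) (auto simp: less_top[symmetric])
  show "AE x in lborel. norm (u x) \<le> norm (indicator (ball 0 1) x + (u x)\<^sup>2)"
    using H_zero_ball[OF u]
  proof eventually_elim
    case (elim x)
    have "2 * \<bar>u x\<bar> \<le> (u x)\<^sup>2 + 1" using sum_squares_bound[of "\<bar>u x\<bar>" 1] by simp
    with elim show ?case by (cases "x \<in> ball 0 1") auto
  qed
qed (use H_measurable[OF u] in simp)

text \<open>The estimate \<open>a\<^sup>2 \<le> (a - b)\<^sup>2 + 2 a b\<close> reduces the \<open>L\<^sup>2\<close> norm to the energy and local masses.\<close>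

lemma radial_nash:
  assumes u: "u \<in> H" and u0: "\<And>x. 0 \<le> u x" and rot: "rotation_invariant u" and h: "0 < h"
  shows "unit_ball_vol (real DIM('a)) * l2 u u
    \<le> h powr (2 * s) * gagliardo s u u + 16 ^ DIM('a) / h * (LINT x|lborel. u x)\<^sup>2"
proof -
  define N where "N = DIM('a)"
  define p where "p = real N + 2 * s"
  define \<omega> where "\<omega> = unit_ball_vol (real N)"
  have \<omega>: "0 < \<omega>" by (simp add: \<omega>_def)
  have [measurable]: "u \<in> borel_measurable borel" by (rule H_measurable[OF u])
  define a where "a = (LINT x|lborel. u x)"
  have a0: "0 \<le> a" unfolding a_def by (intro Bochner_Integration.integral_nonneg u0)
  have U: "(\<integral>\<^sup>+x. ennreal (u x) \<partial>lborel) = ennreal a"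
    unfolding a_def using u0 by (intro nn_integral_eq_integral H_integrable[OF u]) auto
  have L: "(\<integral>\<^sup>+x. ennreal ((u x)\<^sup>2) \<partial>lborel) = ennreal (l2 u u)"
    unfolding l2_square by (intro nn_integral_eq_integral square_integrable[OF u]) auto
  have [measurable]: "(\<lambda>z. indicator (ball (fst z) h) (snd z) :: ennreal) \<in> borel_measurable (lborel \<Otimes>\<^sub>M (lborel :: 'a measure))"
  proof -
    have "(\<lambda>z. indicator (ball (fst z) h) (snd z) :: ennreal) = indicator {z :: 'a \<times> 'a. dist (fst z) (snd z) < h}"
      by (auto simp: fun_eq_iff indicator_def)
    moreover have "{z :: 'a \<times> 'a. dist (fst z) (snd z) < h} \<in> sets (lborel \<Otimes>\<^sub>M lborel)"
      unfolding lborel_prod sets_lborel by (intro borel_open open_Collect_less continuous_intros)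
    ultimately show ?thesis by simp
  qed
  have mm: "(\<lambda>x. mass u x h) \<in> borel_measurable lborel"
  proof -
    have "(\<lambda>z. ennreal (u (snd z)) * indicator (ball (fst z) h) (snd z)) \<in> borel_measurable (lborel \<Otimes>\<^sub>M lborel)" by measurable
    from lborel.borel_measurable_nn_integral_fst[OF this] show ?thesis by (simp add: mass_def)
  qed
  \<comment> \<open>The volume of the ball of radius \<open>h\<close> is written as an integral over
    \<open>y\<close>, which creates the pairs that the energy and the local mass control.\<close>
  have "ennreal (\<omega> * h ^ N) * ennreal (l2 u u) = (\<integral>\<^sup>+x. ennreal ((u x)\<^sup>2) * emeasure lborel (ball x h) \<partial>lborel)"
    using h by (simp add: L[symmetric] emeasure_ball \<omega>_def N_def nn_integral_multc mult.commute)
  also have "\<dots> = (\<integral>\<^sup>+x. \<integral>\<^sup>+y. ennreal ((u x)\<^sup>2) * indicator (ball x h) y \<partial>lborel \<partial>lborel)"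
    by (intro nn_integral_cong) (subst nn_integral_cmult_indicator, auto)
  also have "\<dots> \<le> (\<integral>\<^sup>+x. \<integral>\<^sup>+y. ennreal (h powr p) * ennreal (difference_kernel s u u (x, y))
      + ennreal (2 * u x) * (ennreal (u y) * indicator (ball x h) y) \<partial>lborel \<partial>lborel)"
  proof (intro nn_integral_mono)
    fix x y
    show "ennreal ((u x)\<^sup>2) * indicator (ball x h) y \<le> ennreal (h powr p) * ennreal (difference_kernel s u u (x, y))
      + ennreal (2 * u x) * (ennreal (u y) * indicator (ball x h) y)"
    proof (cases "y \<in> ball x h")
      case True
      have "(u x - u y)\<^sup>2 \<le> h powr p * difference_kernel s u u (x, y)"
      proof (cases "x = y")
        case False
        have "norm (x - y) powr p \<le> h powr p"
          using True s by (intro powr_mono2) (auto simp: p_def dist_norm)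
        then have "(u x - u y)\<^sup>2 * norm (x - y) powr p \<le> (u x - u y)\<^sup>2 * h powr p" by (intro mult_left_mono) auto
        then have "(u x - u y)\<^sup>2 \<le> (u x - u y)\<^sup>2 * h powr p / norm (x - y) powr p"
          using False by (simp add: pos_le_divide_eq)
        then show ?thesis by (simp add: difference_kernel_apply p_def N_def power2_eq_square mult.commute)
      qed (simp add: difference_kernel_apply)
      moreover have "(u x)\<^sup>2 \<le> (u x - u y)\<^sup>2 + 2 * u x * u y" by (simp add: power2_eq_square algebra_simps)
      ultimately have "(u x)\<^sup>2 \<le> h powr p * difference_kernel s u u (x, y) + 2 * u x * u y" by linarith
      then have "ennreal ((u x)\<^sup>2) \<le> ennreal (h powr p * difference_kernel s u u (x, y) + 2 * u x * u y)" by (rule ennreal_leI)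
      also have "\<dots> = ennreal (h powr p) * ennreal (difference_kernel s u u (x, y)) + ennreal (2 * u x) * ennreal (u y)"
        using u0 by (simp add: ennreal_plus ennreal_mult')
      finally show ?thesis using True by simp
    qed simp
  qed
  also have "\<dots> = (\<integral>\<^sup>+x. ennreal (h powr p) * (\<integral>\<^sup>+y. ennreal (difference_kernel s u u (x, y)) \<partial>lborel)
      + ennreal (2 * u x) * mass u x h \<partial>lborel)"
  proof (rule nn_integral_cong)
    fix x
    have 1: "(\<lambda>y. ennreal (difference_kernel s u u (x, y))) \<in> borel_measurable lborel" by measurable
    have 2: "(\<lambda>y. ennreal (u y) * indicator (ball x h) y) \<in> borel_measurable lborel" by measurable
    have 3: "(\<lambda>y. ennreal (h powr p) * ennreal (difference_kernel s u u (x, y))) \<in> borel_measurable lborel" by measurable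
    have 4: "(\<lambda>y. ennreal (2 * u x) * (ennreal (u y) * indicator (ball x h) y)) \<in> borel_measurable lborel" by measurable
    show "(\<integral>\<^sup>+y. ennreal (h powr p) * ennreal (difference_kernel s u u (x, y))
      + ennreal (2 * u x) * (ennreal (u y) * indicator (ball x h) y) \<partial>lborel)
      = ennreal (h powr p) * (\<integral>\<^sup>+y. ennreal (difference_kernel s u u (x, y)) \<partial>lborel) + ennreal (2 * u x) * mass u x h"
      unfolding nn_integral_add[OF 3 4] nn_integral_cmult[OF 1] nn_integral_cmult[OF 2] mass_def ..
  qed
  also have "\<dots> = ennreal (h powr p) * ennreal (gagliardo s u u) + (\<integral>\<^sup>+x. ennreal (2 * u x) * mass u x h \<partial>lborel)"
  proof -
    have 1: "(\<lambda>x. \<integral>\<^sup>+y. ennreal (difference_kernel s u u (x, y)) \<partial>lborel) \<in> borel_measurable lborel"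
      by (rule lborel.borel_measurable_nn_integral_fst) measurable
    have 2: "(\<lambda>x. ennreal (h powr p) * (\<integral>\<^sup>+y. ennreal (difference_kernel s u u (x, y)) \<partial>lborel)) \<in> borel_measurable lborel"
      using 1 by measurable
    have 3: "(\<lambda>x. ennreal (2 * u x) * mass u x h) \<in> borel_measurable lborel" using mm by measurable
    show ?thesis
      unfolding nn_integral_add[OF 2 3] nn_integral_cmult[OF 1] nn_integral_energy_iterated[OF H_energy[OF u]] ..
  qed
  \<comment> \<open>\<open>mass_upper\<close> bounds the local mass by
    \<open>(16 h)^N / (2 h)\<close> times the total, and the factor 2 of the mixed term
    cancels.\<close>
  also have "(\<integral>\<^sup>+x. ennreal (2 * u x) * mass u x h \<partial>lborel)
      \<le> (\<integral>\<^sup>+x. ennreal (u x) * (ennreal ((16 * h) ^ N / h) * ennreal a) \<partial>lborel)"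
  proof (rule nn_integral_mono_AE)
    show "AE x in lborel. ennreal (2 * u x) * mass u x h \<le> ennreal (u x) * (ennreal ((16 * h) ^ N / h) * ennreal a)"
      using H_zero[OF u]
    proof eventually_elim
      case (elim x)
      show ?case
      proof (cases "x \<in> annulus \<tau>")
        case True
        then have "1 / 4 \<le> norm x" using \<delta> by (simp add: annulus_iff')
        from mass_upper[OF rot this h] have *: "mass u x h * ennreal (2 * h) \<le> ennreal ((16 * h) ^ N) * ennreal a"
          by (simp add: N_def U)
        have "ennreal (2 * u x) * mass u x h = ennreal (u x) * (ennreal (1 / h) * (mass u x h * ennreal (2 * h)))"
        proof -
          have "ennreal (1 / h) * ennreal (2 * h) = 2"
            using h by (simp add: ennreal_mult[symmetric])
          then have "ennreal (1 / h) * (mass u x h * ennreal (2 * h)) = 2 * mass u x h"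
            by (metis mult.assoc mult.commute)
          moreover have "ennreal (2 * u x) = ennreal (u x) * 2" using u0[of x] by (simp add: ennreal_mult mult.commute)
          ultimately show ?thesis by (simp add: mult.assoc)
        qed
        also have "\<dots> \<le> ennreal (u x) * (ennreal (1 / h) * (ennreal ((16 * h) ^ N) * ennreal a))"
          by (intro mult_left_mono *) auto
        also have "ennreal (1 / h) * (ennreal ((16 * h) ^ N) * ennreal a) = ennreal ((16 * h) ^ N / h) * ennreal a"
          using h by (simp add: mult.assoc[symmetric] ennreal_mult[symmetric])
        finally show ?thesis .
      qed (use elim in simp)
    qed
  qed
  also have "(\<integral>\<^sup>+x. ennreal (u x) * (ennreal ((16 * h) ^ N / h) * ennreal a) \<partial>lborel) = ennreal ((16 * h) ^ N / h * a\<^sup>2)"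
    using a0 h by (simp add: nn_integral_multc U ennreal_mult[symmetric] power2_eq_square mult_ac)
  finally have "ennreal (\<omega> * h ^ N) * ennreal (l2 u u) \<le> ennreal (h powr p) * ennreal (gagliardo s u u) + ennreal ((16 * h) ^ N / h * a\<^sup>2)"
    by (simp add: add_left_mono)
  also have "\<dots> = ennreal (h powr p * gagliardo s u u + (16 * h) ^ N / h * a\<^sup>2)"
    using h by (simp add: ennreal_mult[symmetric] ennreal_plus[symmetric] gagliardo_nonneg del: ennreal_plus)
  also have "ennreal (\<omega> * h ^ N) * ennreal (l2 u u) = ennreal (\<omega> * h ^ N * l2 u u)"
    using \<omega> h spectral.B.nonneg[OF u] by (intro ennreal_mult[symmetric]) auto
  finally have "\<omega> * h ^ N * l2 u u \<le> h powr p * gagliardo s u u + (16 * h) ^ N / h * a\<^sup>2"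
    using h gagliardo_nonneg[of s u] by (subst (asm) ennreal_le_iff) auto
  also have "h powr p = h ^ N * h powr (2 * s)" using h by (simp add: p_def powr_add powr_realpow)
  also have "(16 * h) ^ N = h ^ N * 16 ^ N" by (simp add: power_mult_distrib)
  finally have "h ^ N * (\<omega> * l2 u u) \<le> h ^ N * (h powr (2 * s) * gagliardo s u u + 16 ^ N / h * a\<^sup>2)"
    by (simp add: algebra_simps)
  then show ?thesis using h by (simp add: \<omega>_def N_def a_def mult_le_cancel_left_pos)
qed


text \<open>In one coordinate the products of \<open>u\<close> with itself collapse to
  \<open>u x * u y * (x_i - y_i)^2\<close>, as the diagonal terms cancel, and those with
  \<open>v\<close> keep only mixed terms because \<open>u v = 0\<close>. The signs follow from
  \<open>\<phi> = u - v\<close>.\<close>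

lemma coordinate_kernel_sum:
  fixes x y :: 'a
  assumes "u x * v x = 0" "u y * v y = (0::real)"
  shows "(\<Sum>i\<in>Basis. difference_kernel s (\<lambda>x. (x \<bullet> i) * u x) (\<lambda>x. (x \<bullet> i) * u x) (x, y)
      - difference_kernel s u (\<lambda>x. (x \<bullet> i) * ((x \<bullet> i) * u x)) (x, y)
      + difference_kernel s v (\<lambda>x. (x \<bullet> i) * ((x \<bullet> i) * u x)) (x, y))
    = (u x * u y * (norm (x - y))\<^sup>2 - (v x * u y * (norm y)\<^sup>2 + v y * u x * (norm x)\<^sup>2))
      / norm (x - y) powr (real DIM('a) + 2 * s)"
proof -
  define P where "P = norm (x - y) powr (real DIM('a) + 2 * s)"
  have nsq: "(norm z)\<^sup>2 = (\<Sum>i\<in>Basis. (z \<bullet> i)\<^sup>2)" for z :: 'a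
    unfolding power2_norm_eq_inner euclidean_inner[of z z] by (simp add: power2_eq_square)
  have "difference_kernel s (\<lambda>x. (x \<bullet> i) * u x) (\<lambda>x. (x \<bullet> i) * u x) (x, y)
      - difference_kernel s u (\<lambda>x. (x \<bullet> i) * ((x \<bullet> i) * u x)) (x, y)
      + difference_kernel s v (\<lambda>x. (x \<bullet> i) * ((x \<bullet> i) * u x)) (x, y)
    = (u x * u y * ((x - y) \<bullet> i)\<^sup>2 - (v x * u y * (y \<bullet> i)\<^sup>2 + v y * u x * (x \<bullet> i)\<^sup>2)) / P" for i
  proof -
    have "((x \<bullet> i) * u x - (y \<bullet> i) * u y) * ((x \<bullet> i) * u x - (y \<bullet> i) * u y)
        - (u x - u y) * ((x \<bullet> i) * ((x \<bullet> i) * u x) - (y \<bullet> i) * ((y \<bullet> i) * u y))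
        + (v x - v y) * ((x \<bullet> i) * ((x \<bullet> i) * u x) - (y \<bullet> i) * ((y \<bullet> i) * u y))
      = u x * u y * ((x \<bullet> i) - (y \<bullet> i))\<^sup>2 - (v x * u y * (y \<bullet> i)\<^sup>2 + v y * u x * (x \<bullet> i)\<^sup>2)
        + (u x * v x) * (x \<bullet> i)\<^sup>2 + (u y * v y) * (y \<bullet> i)\<^sup>2"
      by (simp add: power2_eq_square algebra_simps)
    then show ?thesis
      unfolding difference_kernel_apply P_def[symmetric] assms
      by (simp add: diff_divide_distrib[symmetric] add_divide_distrib[symmetric] inner_diff_left)
  qed
  then have "(\<Sum>i\<in>Basis. difference_kernel s (\<lambda>x. (x \<bullet> i) * u x) (\<lambda>x. (x \<bullet> i) * u x) (x, y)
      - difference_kernel s u (\<lambda>x. (x \<bullet> i) * ((x \<bullet> i) * u x)) (x, y)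
      + difference_kernel s v (\<lambda>x. (x \<bullet> i) * ((x \<bullet> i) * u x)) (x, y))
    = (\<Sum>i\<in>Basis. (u x * u y * ((x - y) \<bullet> i)\<^sup>2 - (v x * u y * (y \<bullet> i)\<^sup>2 + v y * u x * (x \<bullet> i)\<^sup>2)) / P)"
    by simp
  also have "\<dots> = (u x * u y * (norm (x - y))\<^sup>2 - (v x * u y * (norm y)\<^sup>2 + v y * u x * (norm x)\<^sup>2)) / P"
    unfolding nsq sum_divide_distrib[symmetric] sum_subtractf sum.distrib sum_distrib_left ..
  finally show ?thesis by (simp add: P_def)
qed

text \<open>Testing with \<open>x\<^sub>i u\<close> for all coordinates \<open>i\<close>, where \<open>u\<close> is the positive part of a radial
  second eigenfunction and \<open>v\<close> its negative part: these functions are odd, so their Rayleigh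
  quotients are at least the eigenvalue, and in the sum over \<open>i\<close> the eigenvalue cancels.\<close>

lemma coordinate_test_inequality:
  fixes \<phi> :: "'a \<Rightarrow> real"
  assumes \<phi>: "spectral.eigenpair (fractional_form s (e 1) (e 1)) \<phi>"
    and rot: "\<And>w. AE x in lborel. \<phi> (householder w x) = \<phi> x"
  defines "u \<equiv> \<lambda>x. max (\<phi> x) 0" and "v \<equiv> \<lambda>x. max (- \<phi> x) 0"
  shows "integrable (lborel \<Otimes>\<^sub>M lborel) (\<lambda>(x, y). (u x * u y * (norm (x - y))\<^sup>2
        - (v x * u y * (norm y)\<^sup>2 + v y * u x * (norm x)\<^sup>2)) / norm (x - y) powr (real DIM('a) + 2 * s))"
    and "0 \<le> (LINT (x, y)|(lborel \<Otimes>\<^sub>M lborel). (u x * u y * (norm (x - y))\<^sup>2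
        - (v x * u y * (norm y)\<^sup>2 + v y * u x * (norm x)\<^sup>2)) / norm (x - y) powr (real DIM('a) + 2 * s))"
proof -
  have \<phi>H: "\<phi> \<in> H" using \<phi> by (simp add: spectral.eigenpair_def)
  have uH: "u \<in> H" and vH: "v \<in> H" using H_parts[OF \<phi>H] by (simp_all add: u_def v_def)
  have uv: "u x * v x = 0" for x by (simp add: u_def v_def max_def)
  define w where "w i = (\<lambda>x. (x \<bullet> i) * u x)" for i
  define z where "z i = (\<lambda>x. (x \<bullet> i) * ((x \<bullet> i) * u x))" for i
  have wH: "w i \<in> H" and zH: "z i \<in> H" if "i \<in> Basis" for i
    unfolding w_def z_def using that by (auto intro!: H_coordinate_mult uH)
  define S where "S i p = difference_kernel s (w i) (w i) p - difference_kernel s u (z i) p + difference_kernel s v (z i) p" for i p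
  have intS: "integrable (lborel \<Otimes>\<^sub>M lborel) (S i)" if "i \<in> Basis" for i
    unfolding S_def using wH[OF that] zH[OF that] uH vH
    by (intro Bochner_Integration.integrable_add Bochner_Integration.integrable_diff integrable_difference_kernel H_energy)
  have nonneg: "0 \<le> (LINT p|(lborel \<Otimes>\<^sub>M lborel). S i p)" if i: "i \<in> Basis" for i
  proof -
    note k = integrable_difference_kernel[OF wH[OF i, THEN H_energy] wH[OF i, THEN H_energy]]
      integrable_difference_kernel[OF uH[THEN H_energy] zH[OF i, THEN H_energy]]
      integrable_difference_kernel[OF vH[THEN H_energy] zH[OF i, THEN H_energy]]
    have "(LINT p|(lborel \<Otimes>\<^sub>M lborel). S i p) = gagliardo s (w i) (w i) - gagliardo s u (z i) + gagliardo s v (z i)"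
      unfolding S_def gagliardo_def using k by simp
    moreover have "gagliardo s \<phi> (z i) = gagliardo s u (z i) - gagliardo s v (z i)"
    proof -
      have "\<phi> = u - v" unfolding u_def v_def by (rule parts_relations(1)[symmetric])
      then show ?thesis using gagliardo.diff[OF uH[THEN H_energy] vH[THEN H_energy] zH[OF i, THEN H_energy]] by simp
    qed
    \<comment> \<open>The equation tested with \<open>x_i^2 u\<close>: since
      \<open>\<phi> u = u^2\<close>, the right side carries the squared norm of \<open>w i\<close>
      itself, and the eigenvalue cancels against \<open>odd_bound\<close>.\<close>
    moreover have "gagliardo s \<phi> (z i) = \<mu> * l2 (w i) (w i)"
    proof -
      have "\<phi> x * z i x = w i x * w i x" for x by (simp add: u_def w_def z_def max_def)
      then have "l2 \<phi> (z i) = l2 (w i) (w i)" by (simp add: l2_def)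
      with eigen_gagliardo[OF \<phi> zH[OF i]] show ?thesis by simp
    qed
    moreover have "AE x in lborel. w i (householder i x) = - w i x"
      using rot[of i] by eventually_elim (simp add: w_def u_def householder_Basis[OF i])
    from odd_bound[OF wH[OF i] this] have "\<mu> * l2 (w i) (w i) \<le> gagliardo s (w i) (w i)" .
    ultimately show ?thesis by simp
  qed
  define F where "F = (\<lambda>(x, y). (u x * u y * (norm (x - y))\<^sup>2
        - (v x * u y * (norm y)\<^sup>2 + v y * u x * (norm x)\<^sup>2)) / norm (x - y) powr (real DIM('a) + 2 * s))"
  have F: "F = (\<lambda>p. \<Sum>i\<in>Basis. S i p)"
    using coordinate_kernel_sum[of u _ v, OF uv uv] by (auto simp: F_def S_def w_def z_def fun_eq_iff)
  have "integrable (lborel \<Otimes>\<^sub>M lborel) F"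
    unfolding F using intS by (intro Bochner_Integration.integrable_sum)
  then show "integrable (lborel \<Otimes>\<^sub>M lborel) (\<lambda>(x, y). (u x * u y * (norm (x - y))\<^sup>2
        - (v x * u y * (norm y)\<^sup>2 + v y * u x * (norm x)\<^sup>2)) / norm (x - y) powr (real DIM('a) + 2 * s))"
    unfolding F_def .
  have "(LINT p|(lborel \<Otimes>\<^sub>M lborel). F p) = (\<Sum>i\<in>Basis. (LINT p|(lborel \<Otimes>\<^sub>M lborel). S i p))"
    unfolding F by (intro Bochner_Integration.integral_sum intS)
  then have "0 \<le> (LINT p|(lborel \<Otimes>\<^sub>M lborel). F p)" using nonneg by (simp add: sum_nonneg)
  then show "0 \<le> (LINT (x, y)|(lborel \<Otimes>\<^sub>M lborel). (u x * u y * (norm (x - y))\<^sup>2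
        - (v x * u y * (norm y)\<^sup>2 + v y * u x * (norm x)\<^sup>2)) / norm (x - y) powr (real DIM('a) + 2 * s))"
    unfolding F_def .
qed

text \<open>The product \<open>u x * u y\<close> is at most the mean of the squares, and
  \<open>|x - y|^2\<close> lowers the singularity to that of \<open>near_constant\<close>; each half
  is one case of \<open>near_bound\<close>.\<close>

lemma interaction_upper:
  assumes u: "u \<in> H"
  shows "(\<integral>\<^sup>+p. ennreal (u (fst p) * u (snd p) * (norm (fst p - snd p))\<^sup>2 / norm (fst p - snd p) powr (real DIM('a) + 2 * s))
      \<partial>(lborel \<Otimes>\<^sub>M lborel)) \<le> ennreal (near_constant TYPE('a) s * l2 u u)"
proof -
  define q where "q = real DIM('a) + 2 * s - 2"
  have [measurable]: "u \<in> borel_measurable borel" by (rule H_measurable[OF u])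
  define c where "c = near_constant TYPE('a) s"
  have c: "0 \<le> c" by (simp add: c_def near_constant_def)
  have L: "(\<integral>\<^sup>+x. ennreal ((u x)\<^sup>2) \<partial>lborel) = ennreal (l2 u u)"
    unfolding l2_square by (intro nn_integral_eq_integral square_integrable[OF u]) auto
  define k where "k p = indicator (ball 0 1) (fst p) * indicator (ball 0 1) (snd p) * ennreal (norm (fst p - snd p) powr - q)" for p :: "'a \<times> 'a"
  have k [measurable]: "k \<in> borel_measurable (lborel \<Otimes>\<^sub>M lborel)" unfolding k_def by measurable
  have "(\<integral>\<^sup>+p. ennreal (u (fst p) * u (snd p) * (norm (fst p - snd p))\<^sup>2 / norm (fst p - snd p) powr (real DIM('a) + 2 * s)) \<partial>(lborel \<Otimes>\<^sub>M lborel))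
    \<le> (\<integral>\<^sup>+p. ennreal (1/2) * (ennreal ((u (fst p))\<^sup>2) * k p) + ennreal (1/2) * (ennreal ((u (snd p))\<^sup>2) * k p) \<partial>(lborel \<Otimes>\<^sub>M lborel))"
  proof (rule nn_integral_mono_AE)
    show "AE p in lborel \<Otimes>\<^sub>M lborel. ennreal (u (fst p) * u (snd p) * (norm (fst p - snd p))\<^sup>2 / norm (fst p - snd p) powr (real DIM('a) + 2 * s))
      \<le> ennreal (1/2) * (ennreal ((u (fst p))\<^sup>2) * k p) + ennreal (1/2) * (ennreal ((u (snd p))\<^sup>2) * k p)"
      using AE_lborel_pairI(1)[OF H_zero_ball[OF u]] AE_lborel_pairI(2)[OF H_zero_ball[OF u]]
    proof eventually_elim
      case (elim p)
      obtain x y where p: "p = (x, y)" by (cases p)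
      show ?case
      proof (cases "x \<in> ball 0 1 \<and> y \<in> ball 0 1 \<and> x \<noteq> y")
        case True
        have "(norm (x - y))\<^sup>2 / norm (x - y) powr (real DIM('a) + 2 * s) = norm (x - y) powr - q"
          using True by (simp add: q_def powr_diff)
        then have "u x * u y * (norm (x - y))\<^sup>2 / norm (x - y) powr (real DIM('a) + 2 * s) = u x * u y * norm (x - y) powr - q"
          by (metis times_divide_eq_right)
        also have "\<dots> \<le> (1/2 * (u x)\<^sup>2 + 1/2 * (u y)\<^sup>2) * norm (x - y) powr - q"
          using sum_squares_bound[of "u x" "u y"] by (intro mult_right_mono) auto
        finally have "ennreal (u x * u y * (norm (x - y))\<^sup>2 / norm (x - y) powr (real DIM('a) + 2 * s))
            \<le> ennreal (1/2 * ((u x)\<^sup>2 * norm (x - y) powr - q) + 1/2 * ((u y)\<^sup>2 * norm (x - y) powr - q))"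
          by (intro ennreal_leI) (simp add: algebra_simps)
        also have "\<dots> = ennreal (1/2 * ((u x)\<^sup>2 * norm (x - y) powr - q)) + ennreal (1/2 * ((u y)\<^sup>2 * norm (x - y) powr - q))"
          by (rule ennreal_plus) auto
        also have "ennreal (1/2 * ((u x)\<^sup>2 * norm (x - y) powr - q)) = ennreal (1/2) * (ennreal ((u x)\<^sup>2) * k p)"
          unfolding k_def p using True by (subst ennreal_mult, simp, simp, subst ennreal_mult) auto
        also have "ennreal (1/2 * ((u y)\<^sup>2 * norm (x - y) powr - q)) = ennreal (1/2) * (ennreal ((u y)\<^sup>2) * k p)"
          unfolding k_def p using True by (subst ennreal_mult, simp, simp, subst ennreal_mult) auto
        finally show ?thesis by (simp only: p fst_conv snd_conv)
      next
        case False
        then have "u x * u y * (norm (x - y))\<^sup>2 / norm (x - y) powr (real DIM('a) + 2 * s) = 0"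
          using elim by (auto simp: p)
        then show ?thesis by (simp only: p fst_conv snd_conv) simp
      qed
    qed
  qed
  also have "\<dots> = ennreal (1/2) * (\<integral>\<^sup>+p. ennreal ((u (fst p))\<^sup>2) * k p \<partial>(lborel \<Otimes>\<^sub>M lborel))
      + ennreal (1/2) * (\<integral>\<^sup>+p. ennreal ((u (snd p))\<^sup>2) * k p \<partial>(lborel \<Otimes>\<^sub>M lborel))"
  proof -
    have 1: "(\<lambda>p. ennreal ((u (fst p))\<^sup>2) * k p) \<in> borel_measurable (lborel \<Otimes>\<^sub>M lborel)" by measurable
    have 2: "(\<lambda>p. ennreal ((u (snd p))\<^sup>2) * k p) \<in> borel_measurable (lborel \<Otimes>\<^sub>M lborel)" by measurable
    have 3: "(\<lambda>p. ennreal (1/2) * (ennreal ((u (fst p))\<^sup>2) * k p)) \<in> borel_measurable (lborel \<Otimes>\<^sub>M lborel)" by measurable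
    have 4: "(\<lambda>p. ennreal (1/2) * (ennreal ((u (snd p))\<^sup>2) * k p)) \<in> borel_measurable (lborel \<Otimes>\<^sub>M lborel)" by measurable
    show ?thesis unfolding nn_integral_add[OF 3 4] nn_integral_cmult[OF 1] nn_integral_cmult[OF 2] ..
  qed
  also have "(\<integral>\<^sup>+p. ennreal ((u (fst p))\<^sup>2) * k p \<partial>(lborel \<Otimes>\<^sub>M lborel)) \<le> ennreal c * ennreal (l2 u u)"
  proof -
    have m: "(\<lambda>p. ennreal ((u (fst p))\<^sup>2) * k p) \<in> borel_measurable (lborel \<Otimes>\<^sub>M lborel)" by measurable
    show ?thesis
      unfolding lborel.nn_integral_fst[OF m, symmetric]
      unfolding c_def L[symmetric] k_def q_def fst_conv snd_conv
      by (rule near_bound(1)[OF _ s dim]) measurable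
  qed
  also have "(\<integral>\<^sup>+p. ennreal ((u (snd p))\<^sup>2) * k p \<partial>(lborel \<Otimes>\<^sub>M lborel)) \<le> ennreal c * ennreal (l2 u u)"
  proof -
    have m: "(\<lambda>p. ennreal ((u (snd p))\<^sup>2) * k p) \<in> borel_measurable (lborel \<Otimes>\<^sub>M lborel)" by measurable
    show ?thesis
      unfolding lborel.nn_integral_fst[OF m, symmetric]
      unfolding c_def L[symmetric] k_def q_def fst_conv snd_conv
      by (rule near_bound(2)[OF _ s dim]) measurable
  qed
  also have "ennreal (1/2) * (ennreal c * ennreal (l2 u u)) + ennreal (1/2) * (ennreal c * ennreal (l2 u u)) = ennreal (c * l2 u u)"
  proof -
    have 1: "ennreal c * ennreal (l2 u u) = ennreal (c * l2 u u)"
      using c spectral.B.nonneg[OF u] by (intro ennreal_mult[symmetric])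
    have 2: "ennreal (1/2) * ennreal (c * l2 u u) = ennreal (1/2 * (c * l2 u u))"
      using c spectral.B.nonneg[OF u] by (intro ennreal_mult[symmetric]) auto
    show ?thesis unfolding 1 2 using c spectral.B.nonneg[OF u] by (subst ennreal_plus[symmetric]) auto
  qed
  finally show ?thesis by (simp add: c_def add_mono mult_left_mono)
qed

text \<open>Only pairs at distance below \<open>2 \<delta>\<close> are kept, where the kernel is at
  least \<open>(2 \<delta>)^(- N - 2 s)\<close>. Around each point of the annulus
  \<open>mass_lower\<close> guarantees enough mass of \<open>u\<close>, and this is integrated
  against \<open>v\<close>.\<close>

lemma interaction_lower:
  assumes u: "u \<in> H" and u0: "\<And>x. 0 \<le> u x" and rot: "rotation_invariant u" and v: "v \<in> H" and v0: "\<And>x. 0 \<le> v x"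
  shows "ennreal ((2 * \<delta>) powr - (real DIM('a) + 2 * s) * \<delta> ^ DIM('a) * (LINT x|lborel. u x) * (LINT x|lborel. v x))
    \<le> ennreal (real DIM('a) * 4 ^ DIM('a) * \<delta>) *
      (\<integral>\<^sup>+p. ennreal (v (fst p) * u (snd p) / norm (fst p - snd p) powr (real DIM('a) + 2 * s)) \<partial>(lborel \<Otimes>\<^sub>M lborel))"
proof -
  define p where "p = real DIM('a) + 2 * s"
  have [measurable]: "u \<in> borel_measurable borel" "v \<in> borel_measurable borel" using u v H_measurable by auto
  define a where "a = (LINT x|lborel. u x)"
  define b where "b = (LINT x|lborel. v x)"
  have ab: "0 \<le> a" "0 \<le> b" unfolding a_def b_def by (auto intro!: Bochner_Integration.integral_nonneg u0 v0)
  have U: "(\<integral>\<^sup>+x. ennreal (u x) \<partial>lborel) = ennreal a" "(\<integral>\<^sup>+x. ennreal (v x) \<partial>lborel) = ennreal b"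
    unfolding a_def b_def using u0 v0 by (auto intro!: nn_integral_eq_integral H_integrable u v)
  define C where "C = real DIM('a) * 4 ^ DIM('a) * \<delta>"
  define K where "K x y = ennreal (v x * u y / norm (x - y) powr p)" for x y
  have Km: "(\<lambda>z. K (fst z) (snd z)) \<in> borel_measurable (lborel \<Otimes>\<^sub>M lborel)" unfolding K_def by measurable
  have pt: "ennreal ((2 * \<delta>) powr - p * (\<delta> ^ DIM('a) * a)) * ennreal (v x) \<le> ennreal C * (\<integral>\<^sup>+y. K x y \<partial>lborel)"
    if z: "x \<notin> annulus \<tau> \<longrightarrow> v x = 0" for x
  proof (cases "x \<in> annulus \<tau>")
    case True
    then have x: "1 - \<delta> < norm x" "norm x < 1" by (auto simp: annulus_iff')
    have zero: "AE y in lborel. \<not> (1 - \<delta> < norm y \<and> norm y < 1) \<longrightarrow> u y = 0"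
      using H_zero[OF u] unfolding annulus_iff' .
    from mass_lower[OF rot \<delta> zero x] have ml: "ennreal (\<delta> ^ DIM('a)) * ennreal a \<le> ennreal C * mass u x (2 * \<delta>)"
      by (simp add: U C_def)
    have "ennreal ((2 * \<delta>) powr - p * (\<delta> ^ DIM('a) * a)) * ennreal (v x)
        = ennreal ((2 * \<delta>) powr - p * v x) * (ennreal (\<delta> ^ DIM('a)) * ennreal a)"
      using ab v0[of x] \<delta> by (simp add: ennreal_mult[symmetric] mult_ac)
    also have "\<dots> \<le> ennreal ((2 * \<delta>) powr - p * v x) * (ennreal C * mass u x (2 * \<delta>))"
      by (intro mult_left_mono ml) auto
    also have "\<dots> = ennreal C * (ennreal ((2 * \<delta>) powr - p * v x) * mass u x (2 * \<delta>))"
      by (simp add: mult_ac)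
    also have "ennreal ((2 * \<delta>) powr - p * v x) * mass u x (2 * \<delta>)
        = (\<integral>\<^sup>+y. ennreal ((2 * \<delta>) powr - p * v x) * (ennreal (u y) * indicator (ball x (2 * \<delta>)) y) \<partial>lborel)"
      unfolding mass_def by (rule nn_integral_cmult[symmetric]) measurable
    also have "\<dots> \<le> (\<integral>\<^sup>+y. K x y \<partial>lborel)"
    proof (rule nn_integral_mono_AE)
      show "AE y in lborel. ennreal ((2 * \<delta>) powr - p * v x) * (ennreal (u y) * indicator (ball x (2 * \<delta>)) y) \<le> K x y"
        \<comment> \<open>At \<open>y = x\<close> the quotient is 0 by division by zero, so this one
          point is discarded.\<close>
        using AE_lborel_singleton[of x]
      proof eventually_elim
        case (elim y)
        show ?case
        proof (cases "y \<in> ball x (2 * \<delta>)")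
          case True
          have "(2 * \<delta>) powr - p \<le> norm (x - y) powr - p"
            using True elim s by (intro powr_mono2') (auto simp: p_def dist_norm)
          then have "(2 * \<delta>) powr - p * (v x * u y) \<le> norm (x - y) powr - p * (v x * u y)"
            using u0 v0 by (intro mult_right_mono) auto
          also have "\<dots> = v x * u y / norm (x - y) powr p" by (simp add: powr_minus divide_inverse mult_ac)
          finally have "ennreal ((2 * \<delta>) powr - p * (v x * u y)) \<le> K x y" unfolding K_def by (rule ennreal_leI)
          also have "ennreal ((2 * \<delta>) powr - p * (v x * u y)) = ennreal ((2 * \<delta>) powr - p * v x) * ennreal (u y)"
            using u0 v0 by (simp add: ennreal_mult[symmetric] mult.assoc)
          finally show ?thesis using True by simp
        qed simp
      qed
    qed
    finally show ?thesis by (simp add: mult_left_mono)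
  qed (use z in simp)
  have "ennreal ((2 * \<delta>) powr - p * (\<delta> ^ DIM('a) * a)) * ennreal b
      = (\<integral>\<^sup>+x. ennreal ((2 * \<delta>) powr - p * (\<delta> ^ DIM('a) * a)) * ennreal (v x) \<partial>lborel)"
    unfolding U(2)[symmetric] by (rule nn_integral_cmult[symmetric]) measurable
  also have "\<dots> \<le> (\<integral>\<^sup>+x. ennreal C * (\<integral>\<^sup>+y. K x y \<partial>lborel) \<partial>lborel)"
  proof (rule nn_integral_mono_AE)
    show "AE x in lborel. ennreal ((2 * \<delta>) powr - p * (\<delta> ^ DIM('a) * a)) * ennreal (v x) \<le> ennreal C * (\<integral>\<^sup>+y. K x y \<partial>lborel)"
      using H_zero[OF v] by (rule eventually_mono) (rule pt)
  qed
  also have "\<dots> = ennreal C * (\<integral>\<^sup>+x. \<integral>\<^sup>+y. K x y \<partial>lborel \<partial>lborel)"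
  proof (rule nn_integral_cmult)
    show "(\<lambda>x. \<integral>\<^sup>+y. K x y \<partial>lborel) \<in> borel_measurable lborel"
      using lborel.borel_measurable_nn_integral_fst[OF Km] by simp
  qed
  also have "(\<integral>\<^sup>+x. \<integral>\<^sup>+y. K x y \<partial>lborel \<partial>lborel) = (\<integral>\<^sup>+z. K (fst z) (snd z) \<partial>(lborel \<Otimes>\<^sub>M lborel))"
    using lborel.nn_integral_fst[OF Km] by simp
  finally have "ennreal ((2 * \<delta>) powr - p * (\<delta> ^ DIM('a) * a)) * ennreal b
    \<le> ennreal C * (\<integral>\<^sup>+z. K (fst z) (snd z) \<partial>(lborel \<Otimes>\<^sub>M lborel))" .
  also have "ennreal ((2 * \<delta>) powr - p * (\<delta> ^ DIM('a) * a)) * ennreal b = ennreal ((2 * \<delta>) powr - p * \<delta> ^ DIM('a) * a * b)"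
    using ab \<delta> by (simp add: ennreal_mult[symmetric] mult_ac)
  finally show ?thesis by (simp add: K_def C_def p_def a_def b_def)
qed

end

text \<open>Here \<open>\<kappa>\<close> is the multiple of \<open>\<delta> / 4\<close> at which the energy term in the Nash inequality is half of the
  left side.\<close>

definition thin_constant :: "'a::euclidean_space itself \<Rightarrow> real \<Rightarrow> real" where
  "thin_constant _ s =
    (let N = DIM('a); \<omega> = unit_ball_vol (real N);
       G = gagliardo s (bump (0::'a) 1) (bump 0 1); m = (LINT x|lborel. (bump (0::'a) 1 x)\<^sup>2);
       \<kappa> = (\<omega> / (2 * (2 * G / m + 1))) powr (1 / (2 * s))
     in 2 powr (real N + 2 * s) * (4 * (real N * 4 ^ N) * near_constant TYPE('a) s * (8 * 16 ^ N / (\<kappa> * \<omega>))))"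

section \<open>Comparison of the two interactions\<close>

context annulus_domain
begin

text \<open>The mutual energy of the parts is nonpositive, so the energy of \<open>u\<close> is at
  most \<open>\<mu>\<close> times its squared norm. At a scale of order \<open>\<delta>\<close> the
  Nash inequality absorbs this term and leaves the L^1 norm.\<close>

lemma positive_part_L2_bound:
  assumes \<phi>: "spectral.eigenpair (fractional_form s (e 1) (e 1)) \<phi>"
    and rot: "rotation_invariant (\<lambda>x. max (\<phi> x) 0)"
  defines "u \<equiv> \<lambda>x. max (\<phi> x) 0" and "\<omega> \<equiv> unit_ball_vol (real DIM('a))"
    and "G \<equiv> gagliardo s (bump (0::'a) 1) (bump 0 1)" and "m \<equiv> LINT x|lborel. (bump (0::'a) 1 x)\<^sup>2"
  defines "\<kappa> \<equiv> (\<omega> / (2 * (2 * G / m + 1))) powr (1 / (2 * s))"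
  shows "\<delta> * l2 u u \<le> 8 * 16 ^ DIM('a) / (\<kappa> * \<omega>) * (LINT x|lborel. u x)\<^sup>2"
proof -
  have \<phi>H: "\<phi> \<in> H" using \<phi> by (simp add: spectral.eigenpair_def)
  define v where "v = (\<lambda>x. max (- \<phi> x) 0)"
  have uH: "u \<in> H" and vH: "v \<in> H" using H_parts[OF \<phi>H] by (simp_all add: u_def v_def)
  have L0: "0 \<le> l2 u u" by (rule spectral.B.nonneg[OF uH])
  have \<omega>: "0 < \<omega>" by (simp add: \<omega>_def)
  obtain i :: 'a where i: "i \<in> Basis" using nonempty_Basis by blast
  have m: "0 < m" and \<mu>: "\<mu> \<le> 2 * G / m * (\<delta> / 4) powr - (2 * s)"
    using second_eigenvalue_bound[OF i] by (simp_all add: m_def G_def)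
  have G: "0 \<le> G" unfolding G_def by (rule gagliardo_nonneg)
  \<comment> \<open>The summand 1 makes this positive without a positive lower bound for
    \<open>G\<close>.\<close>
  define \<Lambda> where "\<Lambda> = 2 * G / m + 1"
  have \<Lambda>: "0 < \<Lambda>" using m G by (simp add: \<Lambda>_def add_nonneg_pos)
  have \<kappa>: "0 < \<kappa>" using \<omega> \<Lambda> by (simp add: \<kappa>_def \<Lambda>_def[symmetric])
  define h where "h = \<kappa> * (\<delta> / 4)"
  have h: "0 < h" using \<kappa> \<delta> by (simp add: h_def)
  have "gagliardo s u u \<le> \<mu> * l2 u u"
  proof -
    have "\<phi> = u - v" unfolding u_def v_def by (rule parts_relations(1)[symmetric])
    then have "gagliardo s \<phi> u = gagliardo s u u - gagliardo s v u"
      using gagliardo.diff[OF uH[THEN H_energy] vH[THEN H_energy] uH[THEN H_energy]] by simp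
    moreover have "gagliardo s v u \<le> 0"
      using gagliardo_parts(1)[OF \<phi>H] gagliardo.sym[OF uH[THEN H_energy] vH[THEN H_energy]] by (simp add: u_def v_def)
    moreover have "l2 \<phi> u = l2 u u"
    proof -
      have "\<phi> x * u x = u x * u x" for x by (simp add: u_def max_def)
      then show ?thesis by (simp only: l2_def)
    qed
    ultimately show ?thesis using eigen_gagliardo[OF \<phi> uH] by simp
  qed
  also have "\<dots> \<le> (\<Lambda> * (\<delta> / 4) powr - (2 * s)) * l2 u u"
  proof (intro mult_right_mono L0)
    have "\<mu> \<le> 2 * G / m * (\<delta> / 4) powr - (2 * s)" by (rule \<mu>)
    also have "\<dots> \<le> \<Lambda> * (\<delta> / 4) powr - (2 * s)" by (intro mult_right_mono) (auto simp: \<Lambda>_def)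
    finally show "\<mu> \<le> \<Lambda> * (\<delta> / 4) powr - (2 * s)" .
  qed
  finally have "h powr (2 * s) * gagliardo s u u \<le> h powr (2 * s) * ((\<Lambda> * (\<delta> / 4) powr - (2 * s)) * l2 u u)"
    by (intro mult_left_mono) auto
  also have "\<dots> = (\<kappa> powr (2 * s) * \<Lambda>) * ((\<delta> / 4) powr (2 * s) * (\<delta> / 4) powr - (2 * s)) * l2 u u"
    unfolding h_def powr_mult by (simp only: mult_ac)
  also have "(\<delta> / 4) powr (2 * s) * (\<delta> / 4) powr - (2 * s) = 1"
    using \<delta> by (simp add: powr_add[symmetric] powr_minus)
  also have "\<kappa> powr (2 * s) * \<Lambda> = \<omega> / 2"
    using \<omega> \<Lambda> s by (simp add: \<kappa>_def \<Lambda>_def[symmetric] powr_powr)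
  finally have 1: "h powr (2 * s) * gagliardo s u u \<le> \<omega> / 2 * l2 u u" by simp
  have u0: "0 \<le> u x" for x by (simp add: u_def)
  have "\<omega> * l2 u u \<le> h powr (2 * s) * gagliardo s u u + 16 ^ DIM('a) / h * (LINT x|lborel. u x)\<^sup>2"
    unfolding \<omega>_def by (rule radial_nash[OF uH u0 _ h]) (use rot in \<open>simp add: u_def\<close>)
  with 1 have "\<omega> / 2 * l2 u u \<le> 16 ^ DIM('a) / h * (LINT x|lborel. u x)\<^sup>2" by linarith
  then have "(2 * \<delta> / \<omega>) * (\<omega> / 2 * l2 u u) \<le> (2 * \<delta> / \<omega>) * (16 ^ DIM('a) / h * (LINT x|lborel. u x)\<^sup>2)"
    using \<delta> \<omega> by (intro mult_left_mono) auto
  also have "(2 * \<delta> / \<omega>) * (\<omega> / 2 * l2 u u) = \<delta> * l2 u u" using \<omega> by simp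
  also have "(2 * \<delta> / \<omega>) * (16 ^ DIM('a) / h * (LINT x|lborel. u x)\<^sup>2) = 8 * 16 ^ DIM('a) / (\<kappa> * \<omega>) * (LINT x|lborel. u x)\<^sup>2"
    using \<delta> \<omega> \<kappa> by (simp add: h_def field_simps)
  finally show ?thesis .
qed

text \<open>The test inequality links the two interaction estimates. The factor 4 undoes the weight
  \<open>|y|^2\<close>, which is at least \<open>1/4\<close> on the annulus.\<close>

lemma interaction_bound:
  assumes \<phi>: "spectral.eigenpair (fractional_form s (e 1) (e 1)) \<phi>"
    and rot: "\<And>w. AE x in lborel. \<phi> (householder w x) = \<phi> x"
  defines "u \<equiv> \<lambda>x. max (\<phi> x) 0" and "v \<equiv> \<lambda>x. max (- \<phi> x) 0"
  shows "(2 * \<delta>) powr - (real DIM('a) + 2 * s) * \<delta> ^ DIM('a) * (LINT x|lborel. u x) * (LINT x|lborel. v x)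
    \<le> 4 * (real DIM('a) * 4 ^ DIM('a)) * near_constant TYPE('a) s * (\<delta> * l2 u u)"
proof -
  have \<phi>H: "\<phi> \<in> H" using \<phi> by (simp add: spectral.eigenpair_def)
  have uH: "u \<in> H" and vH: "v \<in> H" using H_parts[OF \<phi>H] by (simp_all add: u_def v_def)
  have [measurable]: "u \<in> borel_measurable borel" "v \<in> borel_measurable borel" using uH vH H_measurable by auto
  have u0: "0 \<le> u x" and v0: "0 \<le> v x" for x by (simp_all add: u_def v_def)
  have rotu: "rotation_invariant u"
    unfolding rotation_invariant_def
  proof (intro conjI allI)
    show "AE x in lborel. u (householder w x) = u x" for w
      using rot[of w] by eventually_elim (simp add: u_def)
  qed measurable
  define c where "c = near_constant TYPE('a) s"
  have c: "0 \<le> c" by (simp add: c_def near_constant_def)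
  have L0: "0 \<le> l2 u u" by (rule spectral.B.nonneg[OF uH])
  define P where "P z = norm (fst z - snd z) powr (real DIM('a) + 2 * s)" for z :: "'a \<times> 'a"
  have P0: "0 \<le> P z" for z by (simp add: P_def)
  have [measurable]: "P \<in> borel_measurable (lborel \<Otimes>\<^sub>M lborel)" unfolding P_def by measurable
  define F where "F z = u (fst z) * u (snd z) * (norm (fst z - snd z))\<^sup>2 / P z" for z
  define A where "A z = (v (fst z) * u (snd z) * (norm (snd z))\<^sup>2 + v (snd z) * u (fst z) * (norm (fst z))\<^sup>2) / P z" for z
  have F0: "0 \<le> F z" and A0: "0 \<le> A z" for z
    using u0 v0 P0 by (auto simp: F_def A_def intro!: divide_nonneg_nonneg add_nonneg_nonneg mult_nonneg_nonneg)
  have [measurable]: "F \<in> borel_measurable (lborel \<Otimes>\<^sub>M lborel)" unfolding F_def by measurable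
  have Fle: "(\<integral>\<^sup>+z. ennreal (F z) \<partial>(lborel \<Otimes>\<^sub>M lborel)) \<le> ennreal (c * l2 u u)"
    unfolding F_def P_def c_def by (rule interaction_upper[OF uH])
  have Fint: "integrable (lborel \<Otimes>\<^sub>M lborel) F"
    using Fle F0 by (intro integrableI_nonneg) (auto simp: le_less_trans)
  have Sint: "integrable (lborel \<Otimes>\<^sub>M lborel) (\<lambda>z. F z - A z)" and S0: "0 \<le> (LINT z|(lborel \<Otimes>\<^sub>M lborel). F z - A z)"
    using coordinate_test_inequality[OF \<phi> rot] unfolding F_def A_def P_def u_def v_def
    by (simp_all add: case_prod_beta' diff_divide_distrib)
  \<comment> \<open>The test inequality controls only the difference; \<open>A\<close> is integrable
    by itself because the self-interaction \<open>F\<close> is.\<close>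
  have Aint: "integrable (lborel \<Otimes>\<^sub>M lborel) A"
    using Bochner_Integration.integrable_diff[OF Fint Sint] by simp
  have "(LINT z|(lborel \<Otimes>\<^sub>M lborel). A z) \<le> (LINT z|(lborel \<Otimes>\<^sub>M lborel). F z)"
    using S0 Fint Aint by simp
  then have Ale: "(\<integral>\<^sup>+z. ennreal (A z) \<partial>(lborel \<Otimes>\<^sub>M lborel)) \<le> ennreal (c * l2 u u)"
    using nn_integral_eq_integral[OF Aint] nn_integral_eq_integral[OF Fint] F0 A0 Fle
    by (metis (mono_tags, lifting) AE_I2 ennreal_leI order_trans)
  have "(\<integral>\<^sup>+z. ennreal (v (fst z) * u (snd z) / P z) \<partial>(lborel \<Otimes>\<^sub>M lborel))
      \<le> (\<integral>\<^sup>+z. ennreal 4 * ennreal (A z) \<partial>(lborel \<Otimes>\<^sub>M lborel))"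
  proof (rule nn_integral_mono_AE)
    show "AE z in lborel \<Otimes>\<^sub>M lborel. ennreal (v (fst z) * u (snd z) / P z) \<le> ennreal 4 * ennreal (A z)"
      using AE_lborel_pairI(2)[OF H_zero[OF uH]]
    proof eventually_elim
      case (elim z)
      have "v (fst z) * u (snd z) * 1 \<le> v (fst z) * u (snd z) * (4 * (norm (snd z))\<^sup>2)"
      proof (cases "snd z \<in> annulus \<tau>")
        case True
        then have "1 / 2 \<le> norm (snd z)" using \<delta> by (simp add: annulus_iff')
        then have "(1 / 2)\<^sup>2 \<le> (norm (snd z))\<^sup>2" by (intro power_mono) auto
        then have "1 \<le> 4 * (norm (snd z))\<^sup>2" by (simp add: power2_eq_square)
        then show ?thesis using u0 v0 by (intro mult_left_mono) auto
      qed (use elim in simp)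
      also have "\<dots> \<le> 4 * (v (fst z) * u (snd z) * (norm (snd z))\<^sup>2 + v (snd z) * u (fst z) * (norm (fst z))\<^sup>2)"
        using u0 v0 by simp
      finally have "v (fst z) * u (snd z) / P z
          \<le> 4 * (v (fst z) * u (snd z) * (norm (snd z))\<^sup>2 + v (snd z) * u (fst z) * (norm (fst z))\<^sup>2) / P z"
        using P0 by (intro divide_right_mono) auto
      then have "v (fst z) * u (snd z) / P z \<le> 4 * A z" by (simp add: A_def)
      then have "ennreal (v (fst z) * u (snd z) / P z) \<le> ennreal (4 * A z)" by (rule ennreal_leI)
      then show ?case using A0 by (subst ennreal_mult[symmetric]) auto
    qed
  qed
  also have "\<dots> = ennreal 4 * (\<integral>\<^sup>+z. ennreal (A z) \<partial>(lborel \<Otimes>\<^sub>M lborel))"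
    using Aint by (intro nn_integral_cmult) auto
  also have "\<dots> \<le> ennreal 4 * ennreal (c * l2 u u)" by (intro mult_left_mono Ale) auto
  finally have X: "(\<integral>\<^sup>+z. ennreal (v (fst z) * u (snd z) / P z) \<partial>(lborel \<Otimes>\<^sub>M lborel)) \<le> ennreal 4 * ennreal (c * l2 u u)" .
  define D where "D = real DIM('a) * 4 ^ DIM('a) * \<delta>"
  have D: "0 \<le> D" using \<delta> by (simp add: D_def)
  have "ennreal ((2 * \<delta>) powr - (real DIM('a) + 2 * s) * \<delta> ^ DIM('a) * (LINT x|lborel. u x) * (LINT x|lborel. v x))
    \<le> ennreal D * (\<integral>\<^sup>+z. ennreal (v (fst z) * u (snd z) / P z) \<partial>(lborel \<Otimes>\<^sub>M lborel))"
    unfolding P_def D_def by (rule interaction_lower[OF uH u0 rotu vH v0])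
  also have "\<dots> \<le> ennreal D * (ennreal 4 * ennreal (c * l2 u u))" by (intro mult_left_mono X) auto
  also have "\<dots> = ennreal (D * (4 * (c * l2 u u)))" using D c L0 by (simp only: ennreal_mult mult_nonneg_nonneg zero_le_numeral)
  finally have "(2 * \<delta>) powr - (real DIM('a) + 2 * s) * \<delta> ^ DIM('a) * (LINT x|lborel. u x) * (LINT x|lborel. v x) \<le> D * (4 * (c * l2 u u))"
    using D c L0 by (subst (asm) ennreal_le_iff) auto
  then show ?thesis by (simp add: D_def c_def mult_ac)
qed

text \<open>The assumption on the masses bounds \<open>a b\<close> below by \<open>a^2\<close>.
  After cancelling \<open>a^2\<close>, the left side of the combined estimates is
  \<open>2^(- N - 2 s)\<close> times \<open>\<delta>^(- 2 s)\<close>, and the right side is free of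
  \<open>\<delta>\<close>.\<close>

lemma radial_thin_bound:
  assumes \<phi>: "spectral.eigenpair (fractional_form s (e 1) (e 1)) \<phi>" and nontriv: "\<not> (AE x in lborel. \<phi> x = 0)"
    and rot: "\<And>w. AE x in lborel. \<phi> (householder w x) = \<phi> x"
    and le: "(LINT x|lborel. max (\<phi> x) 0) \<le> (LINT x|lborel. max (- \<phi> x) 0)"
  shows "1 \<le> thin_constant TYPE('a) s * \<delta> powr (2 * s)"
proof -
  have \<phi>H: "\<phi> \<in> H" using \<phi> by (simp add: spectral.eigenpair_def)
  define N where "N = DIM('a)"
  define p where "p = real N + 2 * s"
  define u where "u = (\<lambda>x. max (\<phi> x) 0)"
  define v where "v = (\<lambda>x. max (- \<phi> x) 0)"
  have uH: "u \<in> H" using H_parts[OF \<phi>H] by (simp add: u_def)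
  have [measurable]: "u \<in> borel_measurable borel" using uH H_measurable by auto
  define a where "a = (LINT x|lborel. u x)"
  define b where "b = (LINT x|lborel. v x)"
  have u0: "0 \<le> u x" for x by (simp add: u_def)
  \<comment> \<open>A second eigenfunction changes sign, so its positive part has mass; this permits
    the division by \<open>a^2\<close>.\<close>
  have "a \<noteq> 0"
  proof
    assume "a = 0"
    then have "AE x in lborel. u x = 0"
      using integral_nonneg_eq_0_iff_AE[OF H_integrable[OF uH]] u0 by (simp add: a_def)
    then have "AE x in lborel. \<phi> x \<le> 0" by eventually_elim (simp add: u_def max_def split: if_splits)
    with second_eigenfunction_not_one_signed[OF e \<phi> nontriv] show False by (simp add: one_signed_def)
  qed
  moreover have "0 \<le> a" unfolding a_def by (intro Bochner_Integration.integral_nonneg u0)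
  ultimately have a: "0 < a" by simp
  have ab: "a \<le> b" using le by (simp add: a_def b_def u_def v_def)
  have rotu: "rotation_invariant (\<lambda>x. max (\<phi> x) 0)"
    unfolding rotation_invariant_def
  proof (intro conjI allI)
    show "AE x in lborel. max (\<phi> (householder w x)) 0 = max (\<phi> x) 0" for w
      using rot[of w] by eventually_elim simp
    show "(\<lambda>x. max (\<phi> x) 0) \<in> borel_measurable borel" using H_measurable[OF uH] by (simp add: u_def)
  qed
  define \<omega> where "\<omega> = unit_ball_vol (real N)"
  define \<kappa> where "\<kappa> = (\<omega> / (2 * (2 * gagliardo s (bump (0::'a) 1) (bump 0 1) / (LINT x|lborel. (bump (0::'a) 1 x)\<^sup>2) + 1))) powr (1 / (2 * s))"
  define C5 where "C5 = 8 * 16 ^ N / (\<kappa> * \<omega>)"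
  define C6 where "C6 = 4 * (real N * 4 ^ N) * near_constant TYPE('a) s"
  have C6: "0 \<le> C6" by (simp add: C6_def near_constant_def)
  have L: "\<delta> * l2 u u \<le> C5 * a\<^sup>2"
    using positive_part_L2_bound[OF \<phi> rotu] by (simp add: C5_def \<kappa>_def \<omega>_def N_def u_def a_def)
  have "(2 * \<delta>) powr - p * \<delta> ^ N * a\<^sup>2 \<le> (2 * \<delta>) powr - p * \<delta> ^ N * a * b"
    using ab a \<delta> by (simp add: power2_eq_square mult.assoc mult_left_mono)
  also have "\<dots> \<le> C6 * (\<delta> * l2 u u)"
    using interaction_bound[OF \<phi> rot] by (simp add: C6_def a_def b_def u_def v_def p_def N_def)
  also have "\<dots> \<le> C6 * (C5 * a\<^sup>2)" by (intro mult_left_mono L C6)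
  finally have "(2 * \<delta>) powr - p * \<delta> ^ N * a\<^sup>2 \<le> (C6 * C5) * a\<^sup>2" by (simp add: mult.assoc)
  then have 1: "(2 * \<delta>) powr - p * \<delta> ^ N \<le> C6 * C5" using a by (simp add: mult_le_cancel_right_pos)
  have "1 = 2 powr p * \<delta> powr (2 * s) * ((2 * \<delta>) powr - p * \<delta> ^ N)"
  proof -
    have "(2 * \<delta>) powr - p = 2 powr - p * \<delta> powr - p" by (rule powr_mult)
    moreover have "\<delta> ^ N = \<delta> powr real N" using \<delta> by (simp add: powr_realpow)
    moreover have "2 powr p * 2 powr - p = (1::real)" by (simp add: powr_add[symmetric])
    moreover have "\<delta> powr (2 * s) * (\<delta> powr - p * \<delta> powr real N) = 1"
      using \<delta> by (simp add: powr_add[symmetric] p_def)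
    ultimately show ?thesis by (metis (no_types, lifting) mult.assoc mult.left_commute mult.right_neutral)
  qed
  also have "\<dots> \<le> 2 powr p * \<delta> powr (2 * s) * (C6 * C5)" by (intro mult_left_mono 1) auto
  also have "\<dots> = thin_constant TYPE('a) s * \<delta> powr (2 * s)"
    by (simp add: thin_constant_def Let_def C5_def C6_def \<kappa>_def \<omega>_def N_def p_def mult_ac)
  finally show ?thesis .
qed

text \<open>If the positive part has the larger mass, \<open>- \<phi>\<close> is used instead: it is
  an eigenfunction for the same value with the two parts exchanged.\<close>

lemma second_eigenfunction_radial_bound:
  fixes \<phi> :: "'a \<Rightarrow> real"
  assumes "second_eigenfunction s (annulus \<tau>) \<phi>" "radial \<phi>"
  shows "1 \<le> thin_constant TYPE('a) s * \<delta> powr (2 * s)"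
proof -
  have \<phi>: "spectral.eigenpair (fractional_form s (e 1) (e 1)) \<phi>" and nt: "\<not> (AE x in lborel. \<phi> x = 0)"
    using assms(1) dirichlet_eigenvalue_eq[OF e, of 2]
    by (simp_all add: second_eigenfunction_def AE_nontrivial_def weak_solution_iff)
  obtain g :: "real \<Rightarrow> real" where g: "AE x in lborel. \<phi> x = g (norm x)" using assms(2) by (auto simp: radial_def)
  have rot: "AE x in lborel. \<phi> (householder w x) = \<phi> x" for w
    using involutive_isometry.AE_T[OF involutive_isometry_householder g, of w] g
    by eventually_elim (simp add: involutive_isometry.norm_T[OF involutive_isometry_householder])
  show ?thesis
  proof (cases "(LINT x|lborel. max (\<phi> x) 0) \<le> (LINT x|lborel. max (- \<phi> x) 0)")
    case True
    then show ?thesis by (rule radial_thin_bound[OF \<phi> nt rot])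
  next
    case False
    have "spectral.eigenpair (fractional_form s (e 1) (e 1)) (\<Sum>i\<in>{0::nat}. (- 1) *\<^sub>R \<phi>)"
      by (rule spectral.eigenpair_lincomb) (rule \<phi>)
    then have "spectral.eigenpair (fractional_form s (e 1) (e 1)) (\<lambda>x. - \<phi> x)"
      by (simp add: fun_Compl_def)
    then show ?thesis by (rule radial_thin_bound) (use nt rot False in auto)
  qed
qed

end

theorem corollary1p2:
  fixes s :: real
  assumes "DIM('a::euclidean_space) \<ge> 2" and "0 < s" and "s < 1"
  shows "\<exists>\<tau>\<^sub>0\<in>{0<..<1}. \<forall>\<tau>\<in>{\<tau>\<^sub>0..<1}. \<forall>\<phi> :: 'a \<Rightarrow> real.
           second_eigenfunction s (ball 0 1 - closure (ball 0 \<tau>)) \<phi> \<longrightarrow> \<not> radial \<phi>"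
proof -
  \<comment> \<open>A positive majorant of \<open>thin_constant\<close>, obtained without
    determining its sign.\<close>
  define C where "C = \<bar>thin_constant TYPE('a) s\<bar> + 1"
  have C: "0 < C" by (simp add: C_def add_nonneg_pos)
  \<comment> \<open>The second entry gives \<open>C \<delta>^(2 s) \<le> 1/2\<close>, short of the
    value 1 that a radial eigenfunction would force; the first ensures
    \<open>1 / 2 \<le> \<tau>\<close>.\<close>
  define \<delta>\<^sub>0 where "\<delta>\<^sub>0 = min (1 / 2) ((1 / (2 * C)) powr (1 / (2 * s)))"
  have \<delta>\<^sub>0: "0 < \<delta>\<^sub>0" "\<delta>\<^sub>0 \<le> 1 / 2" "\<delta>\<^sub>0 \<le> (1 / (2 * C)) powr (1 / (2 * s))"
    using C by (auto simp: \<delta>\<^sub>0_def)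
  have "\<not> radial \<phi>" if \<tau>: "1 - \<delta>\<^sub>0 \<le> \<tau>" "\<tau> < 1" and \<phi>: "second_eigenfunction s (annulus \<tau>) \<phi>"
    for \<tau> and \<phi> :: "'a \<Rightarrow> real"
  proof
    assume rad: "radial \<phi>"
    have le: "1 - \<tau> \<le> \<delta>\<^sub>0" using \<tau>(1) by simp
    interpret fractional_domain s "annulus \<tau> :: 'a set"
      using assms \<tau> \<delta>\<^sub>0 by (intro fractional_domain_annulus) auto
    obtain e where e: "spectral.eigenbasis e" using spectral.eigenbasis_exists by blast
    interpret annulus_domain s \<tau> e
      by unfold_locales (use \<tau> \<delta>\<^sub>0 e in auto)
    have "\<delta> \<le> (1 / (2 * C)) powr (1 / (2 * s))" using le \<delta>\<^sub>0(3) unfolding \<delta>_def by linarith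
    then have "\<delta> powr (2 * s) \<le> ((1 / (2 * C)) powr (1 / (2 * s))) powr (2 * s)"
      using \<delta> assms by (intro powr_mono2) auto
    also have "\<dots> = 1 / (2 * C)" using assms C by (simp add: powr_powr)
    finally have "C * \<delta> powr (2 * s) \<le> C * (1 / (2 * C))" using C by (intro mult_left_mono) auto
    also have "\<dots> = 1 / 2" using C by simp
    finally have "C * \<delta> powr (2 * s) \<le> 1 / 2" .
    moreover have "1 \<le> C * \<delta> powr (2 * s)"
    proof -
      have "1 \<le> thin_constant TYPE('a) s * \<delta> powr (2 * s)"
        by (rule second_eigenfunction_radial_bound[OF \<phi> rad])
      also have "\<dots> \<le> C * \<delta> powr (2 * s)" by (intro mult_right_mono) (auto simp: C_def)
      finally show ?thesis .
    qed
    ultimately show False by simp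
  qed
  with \<delta>\<^sub>0 show ?thesis
    by (intro bexI[of _ "1 - \<delta>\<^sub>0"]) (auto simp: annulus_def)
qed

end
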